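(* Let $P$ be a continuous fibre seminorm on $T^*M$ that satisfies the Lipschitz seminorm condition. For all $x,y\in M$ such that $x\ne y$, $$\varrho_P(x,y)\ge\liminf_{z\to y}\varrho_P^{\mathrm{flow}}(x,z).$$ If $\varrho_P^{\mathrm{flow}}$ is varietal, then $\varrho_P=\varrho_P^{\mathrm{flow}}$. More generally, if $\varrho_P^\infty$ is varietal, then $\varrho_P(x,y)=\varrho_P^\infty(x,y)$, and both are equal to $$\inf\{\ell_P(\gamma):\gamma:[a,b]\to M\text{ a }C^\infty\text{ curve},\ \gamma(a)=x,\ \gamma(b)=y\}$$ for all $x,y\in M$.
   Context: $M$ is a smooth $n$-dimensional $\sigma$-compact manifold without boundary. An extended distance function is a map $M\times M\to[0,\infty]$ satisfying the usual axioms of a distance function (the value $\infty$ being allowed); it is varietal if the topology it induces coincides with the manifold topology. The limit $z\to y$ refers to the manifold topology (with $z\neq y$). A continuous fibre seminorm $P$ on $T^*M$ is a continuous map $P:T^*M\to[0,\infty)$ whose restriction to each fibre is a seminorm; its dual extended fibre norm is $P^*(v)=\sup\{|\xi(v)|:\xi\in T^*_xM,\ P(\xi)\le1\}\in[0,\infty]$ for $v\in T_xM$. A curve $\gamma:[a,b]\to M$ is $P$-subunit if it is absolutely continuous (in coordinate charts) and $P^*(\gamma'(t))\le1$ for almost all $t$. A $P$-subunit vector field is a smooth vector field $X$ with $P^*(X|_x)\le1$ at every point $x$. A $P$-subunit piecewise flow curve is a (finite) concatenation of flow curves of $P$-subunit vector fields on $M$. The extended distances $\varrho_P(x,y)$,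 $\varrho_P^\infty(x,y)$, $\varrho_P^{\mathrm{flow}}(x,y)$ are the infima (with $\inf\emptyset=\infty$) of all $T>0$ for which there is a curve $\gamma:[0,T]\to M$ with $\gamma(0)=x$, $\gamma(T)=y$ that is, respectively, $P$-subunit; $C^\infty$ and $P$-subunit; a $P$-subunit piecewise flow curve. For a continuous curve $\gamma:[a,b]\to M$, $\ell_P(\gamma)=\sup\{\sum_{j=1}^m\varrho_P(\gamma(t_{j-1}),\gamma(t_j)): m\in\mathbb{N},\ a=t_0\le\dots\le t_m=b\}$. Lipschitz seminorm condition: fix a countable locally finite atlas of diffeomorphisms $\phi_\alpha:U_\alpha\to\mathbb{R}^n$ ($U_\alpha\subseteq M$ open) such that the sets $V_\alpha=\phi_\alpha^{-1}(B_{\mathbb{R}^n}(0,1))$ cover $M$ (the condition does not depend on the choice of such an atlas). $P$ satisfies the condition if for every $\alpha$ there are a countable family $\mathfrak{X}$ of $P$-subunit vector fields on $U_\alpha$ and a constant $L$ (possibly depending on $\alpha$) such that (i) $|\tau_\alpha X(x)-\tau_\alpha X(y)|\le L|x-y|$ for all $x,y\in B_{\mathbb{R}^n}(0,1)$ and $X\in\mathfrak{X}$, where $\tau_\alpha X:\mathbb{R}^n\to\mathbb{R}^n$ is the expression of $X$ in the coordinates $\phi_\alpha$; and (ii) for all $x\in V_\alpha$, the closure of $\{X|_x:X\in\mathfrak{X}\}$ is $\{v\in T_xM:P^*(v)\le1\}$. *)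

theory Defs
  imports "HOL-Analysis.Analysis"
begin

section \<open>Smooth manifolds\<close>

primrec Ck_on :: "nat \<Rightarrow> 'a::real_normed_vector set \<Rightarrow> ('a \<Rightarrow> 'b::real_normed_vector) \<Rightarrow> bool" where
  "Ck_on 0 W f \<longleftrightarrow> continuous_on W f"
| "Ck_on (Suc k) W f \<longleftrightarrow>
     (\<forall>x\<in>W. f differentiable (at x)) \<and> (\<forall>v. Ck_on k W (\<lambda>x. frechet_derivative f (at x) v))"

definition smooth_on :: "'a::real_normed_vector set \<Rightarrow> ('a \<Rightarrow> 'b::real_normed_vector) \<Rightarrow> bool" where
  "smooth_on W f \<longleftrightarrow> (\<forall>k. Ck_on k W f)"  \<comment> \<open>used only for open \<open>W\<close>\<close>

text \<open>The manifold is the whole type \<open>'m\<close>, and its dimension is \<open>DIM('e)\<close>. A chart is a pair of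
  an open domain and a coordinate map, whose values off the domain are irrelevant.\<close>

type_synonym ('m, 'e) chart = "'m set \<times> ('m \<Rightarrow> 'e)"

definition chart_inv :: "('m, 'e) chart \<Rightarrow> 'e \<Rightarrow> 'm" where
  "chart_inv c = inv_into (fst c) (snd c)"

definition chart_image :: "('m, 'e) chart \<Rightarrow> 'e set" where
  "chart_image c = snd c ` fst c"

definition is_chart :: "('m::topological_space, 'e::topological_space) chart \<Rightarrow> bool" where
  "is_chart c \<longleftrightarrow> open (fst c) \<and> open (chart_image c) \<and>
     homeomorphism (fst c) (chart_image c) (snd c) (chart_inv c)"

definition smoothly_compatible ::
    "('m, 'e::euclidean_space) chart \<Rightarrow> ('m, 'e) chart \<Rightarrow> bool" where
  "smoothly_compatible c d \<longleftrightarrow>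
     smooth_on (snd c ` (fst c \<inter> fst d)) (snd d \<circ> chart_inv c) \<and>
     smooth_on (snd d ` (fst c \<inter> fst d)) (snd c \<circ> chart_inv d)"

text \<open>\<open>S\<close> is the smooth structure, i.e. a maximal smooth atlas.\<close>

definition smooth_manifold :: "('m::t2_space, 'e::euclidean_space) chart set \<Rightarrow> bool" where
  "smooth_manifold S \<longleftrightarrow>
     (\<exists>K::nat \<Rightarrow> 'm set. (\<forall>i. compact (K i)) \<and> (\<Union>i. K i) = UNIV) \<and>
     (\<forall>c\<in>S. is_chart c) \<and>
     (\<Union>c\<in>S. fst c) = UNIV \<and>
     (\<forall>c\<in>S. \<forall>d\<in>S. smoothly_compatible c d) \<and>
     (\<forall>c. is_chart c \<and> (\<forall>d\<in>S. smoothly_compatible c d) \<longrightarrow> c \<in> S)"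

definition charts_at :: "('m, 'e) chart set \<Rightarrow> 'm \<Rightarrow> ('m, 'e) chart set" where
  "charts_at S x = {c \<in> S. x \<in> fst c}"


section \<open>Tangent and cotangent spaces\<close>

text \<open>A tangent vector at \<open>x\<close> is the family of its coordinate representations in all charts around
  \<open>x\<close>, related by the derivatives of the coordinate changes. It is set to \<open>0\<close> at the remaining
  charts, so that the vector space operations are the pointwise ones.\<close>

type_synonym ('m, 'e) tangent_vector = "('m, 'e) chart \<Rightarrow> 'e"

definition tangent_space ::
    "('m, 'e::euclidean_space) chart set \<Rightarrow> 'm \<Rightarrow> ('m, 'e) tangent_vector set" where
  "tangent_space S x =
     {v. (\<forall>c\<in>charts_at S x. \<forall>d\<in>charts_at S x.
            v d = frechet_derivative (snd d \<circ> chart_inv c) (at (snd c x)) (v c)) \<and>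
         (\<forall>c. c \<notin> charts_at S x \<longrightarrow> v c = 0)}"

text \<open>Covectors are the linear functionals on the tangent space, extended by \<open>0\<close> off it.\<close>

type_synonym ('m, 'e) covector = "('m, 'e) tangent_vector \<Rightarrow> real"

definition cotangent_space ::
    "('m, 'e::euclidean_space) chart set \<Rightarrow> 'm \<Rightarrow> ('m, 'e) covector set" where
  "cotangent_space S x =
     {\<xi>. (\<forall>v\<in>tangent_space S x. \<forall>w\<in>tangent_space S x. \<xi> (\<lambda>c. v c + w c) = \<xi> v + \<xi> w) \<and>
         (\<forall>v\<in>tangent_space S x. \<forall>r::real. \<xi> (\<lambda>c. r *\<^sub>R v c) = r * \<xi> v) \<and>
         (\<forall>v. v \<notin> tangent_space S x \<longrightarrow> \<xi> v = 0)}"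

definition cotangent_bundle ::
    "('m, 'e::euclidean_space) chart set \<Rightarrow> ('m \<times> ('m, 'e) covector) set" where
  "cotangent_bundle S = Sigma UNIV (cotangent_space S)"

text \<open>The inverse of the bundle chart of \<open>T\<^sup>*M\<close> induced by \<open>c\<close>, defined on
  \<open>chart_image c \<times> UNIV\<close>; \<open>p\<close> lists the components of the covector in the coordinates \<open>c\<close>.\<close>

definition cotangent_param ::
    "('m, 'e::euclidean_space) chart set \<Rightarrow> ('m, 'e) chart \<Rightarrow> 'e \<times> 'e \<Rightarrow> 'm \<times> ('m, 'e) covector" where
  "cotangent_param S c = (\<lambda>(u, p). (chart_inv c u,
     (\<lambda>v. if v \<in> tangent_space S (chart_inv c u) then p \<bullet> v c else 0)))"

definition cotangent_topology ::
    "('m, 'e::euclidean_space) chart set \<Rightarrow> ('m \<times> ('m, 'e) covector) topology" where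
  "cotangent_topology S = topology (\<lambda>W. W \<subseteq> cotangent_bundle S \<and>
     (\<forall>c\<in>S. open {z \<in> chart_image c \<times> UNIV. cotangent_param S c z \<in> W}))"

lemma openin_cotangent_topology:
  "openin (cotangent_topology S) W \<longleftrightarrow> W \<subseteq> cotangent_bundle S \<and>
     (\<forall>c\<in>S. open {z \<in> chart_image c \<times> UNIV. cotangent_param S c z \<in> W})"
proof -
  let ?pre = "\<lambda>c W. {z \<in> chart_image c \<times> UNIV. cotangent_param S c z \<in> W}"
  have "?pre c (V \<inter> W) = ?pre c V \<inter> ?pre c W" for c V W by blast
  moreover have "?pre c (\<Union>\<W>) = (\<Union>W\<in>\<W>. ?pre c W)" for c \<W> by blast
  ultimately have "istopology (\<lambda>W. W \<subseteq> cotangent_bundle S \<and> (\<forall>c\<in>S. open (?pre c W)))"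
    unfolding istopology_def by (simp add: le_infI1 open_Int open_UN Sup_le_iff)
  then show ?thesis
    by (simp add: cotangent_topology_def)
qed


section \<open>Fibre seminorms\<close>

definition continuous_fibre_seminorm ::
    "('m, 'e::euclidean_space) chart set \<Rightarrow> ('m \<times> ('m, 'e) covector \<Rightarrow> real) \<Rightarrow> bool" where
  "continuous_fibre_seminorm S P \<longleftrightarrow>
     continuous_map (cotangent_topology S) euclideanreal P \<and>
     (\<forall>x. \<forall>\<xi>\<in>cotangent_space S x. 0 \<le> P (x, \<xi>)) \<and>
     (\<forall>x. \<forall>\<xi>\<in>cotangent_space S x. \<forall>\<eta>\<in>cotangent_space S x.
        P (x, \<lambda>v. \<xi> v + \<eta> v) \<le> P (x, \<xi>) + P (x, \<eta>)) \<and>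
     (\<forall>x. \<forall>\<xi>\<in>cotangent_space S x. \<forall>r::real. P (x, \<lambda>v. r * \<xi> v) = \<bar>r\<bar> * P (x, \<xi>))"

definition dual_norm ::
    "('m, 'e::euclidean_space) chart set \<Rightarrow> ('m \<times> ('m, 'e) covector \<Rightarrow> real) \<Rightarrow>
     'm \<Rightarrow> ('m, 'e) tangent_vector \<Rightarrow> ennreal" where
  "dual_norm S P x v = (SUP \<xi> \<in> {\<xi> \<in> cotangent_space S x. P (x, \<xi>) \<le> 1}. ennreal \<bar>\<xi> v\<bar>)"

definition smooth_vector_field ::
    "('m, 'e::euclidean_space) chart set \<Rightarrow> 'm set \<Rightarrow> ('m \<Rightarrow> ('m, 'e) tangent_vector) \<Rightarrow> bool" where
  "smooth_vector_field S U X \<longleftrightarrow>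
     (\<forall>x\<in>U. X x \<in> tangent_space S x) \<and>
     (\<forall>c\<in>S. smooth_on (snd c ` (fst c \<inter> U)) (\<lambda>u. X (chart_inv c u) c))"

definition subunit_field ::
    "('m, 'e::euclidean_space) chart set \<Rightarrow> ('m \<times> ('m, 'e) covector \<Rightarrow> real) \<Rightarrow>
     'm set \<Rightarrow> ('m \<Rightarrow> ('m, 'e) tangent_vector) \<Rightarrow> bool" where
  "subunit_field S P U X \<longleftrightarrow> smooth_vector_field S U X \<and> (\<forall>x\<in>U. dual_norm S P x (X x) \<le> 1)"


section \<open>Curves\<close>

definition abs_continuous_on :: "real \<Rightarrow> real \<Rightarrow> (real \<Rightarrow> 'e::real_normed_vector) \<Rightarrow> bool" where
  "abs_continuous_on a b f \<longleftrightarrow>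
     (\<forall>\<epsilon>>0. \<exists>\<delta>>0. \<forall>(n::nat) l r.
        (\<forall>i<n. a \<le> l i \<and> l i \<le> r i \<and> r i \<le> b) \<and>
        disjoint_family_on (\<lambda>i. {l i<..<r i}) {..<n} \<and>
        (\<Sum>i<n. r i - l i) < \<delta> \<longrightarrow> (\<Sum>i<n. norm (f (r i) - f (l i))) < \<epsilon>)"

definition abs_continuous_curve ::
    "('m::topological_space, 'e::euclidean_space) chart set \<Rightarrow> real \<Rightarrow> real \<Rightarrow> (real \<Rightarrow> 'm) \<Rightarrow> bool" where
  "abs_continuous_curve S a b \<gamma> \<longleftrightarrow> continuous_on {a..b} \<gamma> \<and>
     (\<forall>c\<in>S. \<forall>s t. a \<le> s \<and> s \<le> t \<and> t \<le> b \<and> \<gamma> ` {s..t} \<subseteq> fst c \<longrightarrow>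
        abs_continuous_on s t (snd c \<circ> \<gamma>))"

text \<open>A smooth curve on a compact interval is one that extends smoothly to a larger open interval.\<close>

definition smooth_curve ::
    "('m::topological_space, 'e::euclidean_space) chart set \<Rightarrow> real \<Rightarrow> real \<Rightarrow> (real \<Rightarrow> 'm) \<Rightarrow> bool" where
  "smooth_curve S a b \<gamma> \<longleftrightarrow>
     (\<exists>\<epsilon>>0. \<exists>\<beta>. (\<forall>t\<in>{a..b}. \<beta> t = \<gamma> t) \<and> continuous_on {a-\<epsilon><..<b+\<epsilon>} \<beta> \<and>
        (\<forall>c\<in>S. smooth_on ({a-\<epsilon><..<b+\<epsilon>} \<inter> \<beta> -` fst c) (snd c \<circ> \<beta>)))"

text \<open>Continuity is required separately because the coordinate map is an arbitrary function off the
  domain of the chart.\<close>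

definition has_velocity ::
    "('m::topological_space, 'e::euclidean_space) chart set \<Rightarrow> (real \<Rightarrow> 'm) \<Rightarrow>
     ('m, 'e) tangent_vector \<Rightarrow> real \<Rightarrow> real set \<Rightarrow> bool" where
  "has_velocity S \<gamma> v t I \<longleftrightarrow>
     v \<in> tangent_space S (\<gamma> t) \<and> continuous (at t within I) \<gamma> \<and>
     (\<forall>c\<in>charts_at S (\<gamma> t). ((snd c \<circ> \<gamma>) has_vector_derivative v c) (at t within I))"

definition subunit_curve ::
    "('m::topological_space, 'e::euclidean_space) chart set \<Rightarrow> ('m \<times> ('m, 'e) covector \<Rightarrow> real) \<Rightarrow>
     real \<Rightarrow> real \<Rightarrow> (real \<Rightarrow> 'm) \<Rightarrow> bool" where
  "subunit_curve S P a b \<gamma> \<longleftrightarrow> abs_continuous_curve S a b \<gamma> \<and>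
     (AE t in lebesgue. t \<in> {a..b} \<longrightarrow>
        (\<exists>v. has_velocity S \<gamma> v t {a..b} \<and> dual_norm S P (\<gamma> t) v \<le> 1))"

definition flow_curve ::
    "('m::topological_space, 'e::euclidean_space) chart set \<Rightarrow> ('m \<Rightarrow> ('m, 'e) tangent_vector) \<Rightarrow>
     real \<Rightarrow> real \<Rightarrow> (real \<Rightarrow> 'm) \<Rightarrow> bool" where
  "flow_curve S X a b \<gamma> \<longleftrightarrow> (\<forall>t\<in>{a..b}. has_velocity S \<gamma> (X (\<gamma> t)) t {a..b})"

definition subunit_piecewise_flow_curve ::
    "('m::topological_space, 'e::euclidean_space) chart set \<Rightarrow> ('m \<times> ('m, 'e) covector \<Rightarrow> real) \<Rightarrow>
     real \<Rightarrow> real \<Rightarrow> (real \<Rightarrow> 'm) \<Rightarrow> bool" where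
  "subunit_piecewise_flow_curve S P a b \<gamma> \<longleftrightarrow>
     (\<exists>(m::nat) s. s 0 = a \<and> s m = b \<and>
        (\<forall>i<m. s i < s (Suc i) \<and>
           (\<exists>X. subunit_field S P UNIV X \<and> flow_curve S X (s i) (s (Suc i)) \<gamma>)))"


section \<open>Extended distances and length\<close>

definition distance_of :: "(real \<Rightarrow> (real \<Rightarrow> 'm) \<Rightarrow> bool) \<Rightarrow> 'm \<Rightarrow> 'm \<Rightarrow> ennreal" where
  "distance_of C x y = Inf {ennreal T | T. T > 0 \<and> (\<exists>\<gamma>. C T \<gamma> \<and> \<gamma> 0 = x \<and> \<gamma> T = y)}"

definition rho ::
    "('m::topological_space, 'e::euclidean_space) chart set \<Rightarrow> ('m \<times> ('m, 'e) covector \<Rightarrow> real) \<Rightarrow>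
     'm \<Rightarrow> 'm \<Rightarrow> ennreal" where
  "rho S P = distance_of (\<lambda>T \<gamma>. subunit_curve S P 0 T \<gamma>)"

definition rho_smooth ::
    "('m::topological_space, 'e::euclidean_space) chart set \<Rightarrow> ('m \<times> ('m, 'e) covector \<Rightarrow> real) \<Rightarrow>
     'm \<Rightarrow> 'm \<Rightarrow> ennreal" where
  "rho_smooth S P = distance_of (\<lambda>T \<gamma>. smooth_curve S 0 T \<gamma> \<and> subunit_curve S P 0 T \<gamma>)"

definition rho_flow ::
    "('m::topological_space, 'e::euclidean_space) chart set \<Rightarrow> ('m \<times> ('m, 'e) covector \<Rightarrow> real) \<Rightarrow>
     'm \<Rightarrow> 'm \<Rightarrow> ennreal" where
  "rho_flow S P = distance_of (\<lambda>T \<gamma>. subunit_piecewise_flow_curve S P 0 T \<gamma>)"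

text \<open>The topology induced by the extended distance function \<open>d\<close> is that of \<open>'m\<close>.\<close>

definition varietal :: "('m::topological_space \<Rightarrow> 'm \<Rightarrow> ennreal) \<Rightarrow> bool" where
  "varietal d \<longleftrightarrow> (\<forall>W. open W \<longleftrightarrow> (\<forall>x\<in>W. \<exists>r>0. \<forall>y. d x y < r \<longrightarrow> y \<in> W))"

definition curve_length ::
    "('m::topological_space, 'e::euclidean_space) chart set \<Rightarrow> ('m \<times> ('m, 'e) covector \<Rightarrow> real) \<Rightarrow>
     real \<Rightarrow> real \<Rightarrow> (real \<Rightarrow> 'm) \<Rightarrow> ennreal" where
  "curve_length S P a b \<gamma> =
     Sup {\<Sum>j=1..m. rho S P (\<gamma> (t (j - 1))) (\<gamma> (t j)) | (m::nat) t.
            t 0 = a \<and> t m = b \<and> (\<forall>j\<in>{1..m}. t (j - 1) \<le> t j)}"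


section \<open>The Lipschitz seminorm condition\<close>

definition unit_ball_atlas ::
    "('m::topological_space, 'e::euclidean_space) chart set \<Rightarrow> ('m, 'e) chart set \<Rightarrow> bool" where
  "unit_ball_atlas S A \<longleftrightarrow> A \<subseteq> S \<and> countable A \<and>
     (\<forall>x. \<exists>N. open N \<and> x \<in> N \<and> finite {c \<in> A. fst c \<inter> N \<noteq> {}}) \<and>
     (\<forall>c\<in>A. chart_image c = UNIV) \<and>
     (\<Union>c\<in>A. chart_inv c ` ball 0 1) = UNIV"

text \<open>The closure is taken in the topology of pointwise convergence, i.e. convergence in \<open>T\<^sub>xM\<close> is
  convergence of the coordinate representations in each chart around \<open>x\<close>.\<close>

definition lipschitz_seminorm_condition ::
    "('m::topological_space, 'e::euclidean_space) chart set \<Rightarrow> ('m, 'e) chart set \<Rightarrow>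
     ('m \<times> ('m, 'e) covector \<Rightarrow> real) \<Rightarrow> bool" where
  "lipschitz_seminorm_condition S A P \<longleftrightarrow>
     (\<forall>c\<in>A. \<exists>\<X> L. countable \<X> \<and> (\<forall>X\<in>\<X>. subunit_field S P (fst c) X) \<and>
        (\<forall>X\<in>\<X>. \<forall>u\<in>ball 0 1. \<forall>w\<in>ball 0 1.
           norm (X (chart_inv c u) c - X (chart_inv c w) c) \<le> L * norm (u - w)) \<and>
        (\<forall>x\<in>chart_inv c ` ball 0 1.
           top_of_set (tangent_space S x) closure_of {X x | X. X \<in> \<X>} =
             {v \<in> tangent_space S x. dual_norm S P x v \<le> 1}))"

end

theory Submission
  imports Defs
begin

text \<open>
  A subunit curve is differentiable off a null set, and there its velocity is approximated by the
  value of some field of the Lipschitz family. On a short interval around such a time the curve is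
  therefore followed, up to an error that is small relative to the length of the interval, by the
  flow of that field. A compactness argument cuts the time interval into finitely many such pieces
  and pieces inside an open set of small measure around the null set; on the latter the approximating
  path stands still, which costs little by absolute continuity. Since the fields are uniformly
  Lipschitz, a discrete Gronwall estimate shows that the piecewise flow curve ends close to the given
  curve and takes no more time. No measurable choice of controls is needed. Stopping shortly before
  \<open>y\<close> is reached for the first time provides end points different from \<open>y\<close>.

  Reparametrising flow curves and smooth subunit curves by a smooth transition of speed at most \<open>1\<close>
  that is constant near both ends costs arbitrarily little time and makes them concatenable, so that
  \<open>rho_smooth\<close> is a distance between \<open>rho\<close> and \<open>rho_flow\<close>. A varietal distance is continuous, which
  turns the inequality with the lower limit into the equalities.
\<close>

section \<open>Calculus of smooth maps\<close>

text \<open>The obstacle is that a field of the family approximates the velocity at a single time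
  only, and nothing controls how the chosen field varies from one time to another. What compensates
  is the common Lipschitz constant of the fields in a chart: the error growth on a piece has
  constants independent of the chosen field, while bounds that do depend on the field merely shorten
  the piece. The fields live on a chart domain, whereas \<open>rho_flow\<close> needs fields on all
  of the manifold. A cutoff equal to 1 on the unit ball closes this gap, because the approximating
  flows never leave that ball. To pass from chart to chart, approximation is phrased with
  neighbourhoods: every neighbourhood of the end point can be reached, within the time of the curve,
  from all points of some neighbourhood of the starting point. This property composes along the
  curve, unlike a numerical error measured in one chart. For smooth curves the velocity bound, known
  almost everywhere, is first extended to all times, again through the common Lipschitz constant;
  reparametrisation then never meets a null set.\<close>

lemma Ck_on_cong:
  assumes "open W" "\<And>x. x \<in> W \<Longrightarrow> f x = g x" "Ck_on k W f"
  shows "Ck_on k W g"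
  using assms(2,3)
proof (induction k arbitrary: f g)
  case 0
  then show ?case by (metis Ck_on.simps(1) continuous_on_cong)
next
  case (Suc k)
  have der: "(g has_derivative frechet_derivative f (at x)) (at x)" if "x \<in> W" for x
  proof -
    have "(f has_derivative frechet_derivative f (at x)) (at x)"
      using Suc.prems(2) that by (simp add: frechet_derivative_works)
    then show ?thesis
      by (rule has_derivative_transform_within_open[OF _ assms(1) that]) (use Suc.prems(1) in auto)
  qed
  then have "frechet_derivative g (at x) = frechet_derivative f (at x)" if "x \<in> W" for x
    using frechet_derivative_at that by metis
  then have "Ck_on k W (\<lambda>x. frechet_derivative g (at x) v)" for v
    using Suc.IH[of "\<lambda>x. frechet_derivative f (at x) v" "\<lambda>x. frechet_derivative g (at x) v"] Suc.prems(2)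
    by simp
  with der show ?case by (auto simp: differentiable_def)
qed

lemma Ck_on_SucI:
  assumes "open W" "\<And>x. x \<in> W \<Longrightarrow> (f has_derivative f' x) (at x)"
    "\<And>v. Ck_on k W (\<lambda>x. f' x v)"
  shows "Ck_on (Suc k) W f"
proof -
  have "frechet_derivative f (at x) = f' x" if "x \<in> W" for x
    using frechet_derivative_at assms(2) that by metis
  then have "Ck_on k W (\<lambda>x. frechet_derivative f (at x) v)" for v
    using Ck_on_cong[OF assms(1) _ assms(3)[of v], of "\<lambda>x. frechet_derivative f (at x) v"] by simp
  then show ?thesis using assms(2) by (auto simp: differentiable_def)
qed

lemma Ck_on_SucD: "Ck_on (Suc k) W f \<Longrightarrow> Ck_on k W f"
proof (induction k arbitrary: f)
  case 0
  then show ?case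
    by (auto intro!: continuous_at_imp_continuous_on differentiable_imp_continuous_within)
next
  case (Suc k)
  show ?case unfolding Ck_on.simps(2)[of k]
    using Suc.prems Suc.IH unfolding Ck_on.simps(2)[of "Suc k"] by blast
qed

lemma Ck_on_subset: "Ck_on k W f \<Longrightarrow> V \<subseteq> W \<Longrightarrow> Ck_on k V f"
  by (induction k arbitrary: f) (auto intro: continuous_on_subset)

text \<open>Derivatives are taken at a point of the full space and do not refer to \<open>W\<close>,
  so only the continuity at the bottom of the recursion has to be localised.\<close>

lemma Ck_on_local:
  assumes "\<And>x. x \<in> W \<Longrightarrow> \<exists>N. open N \<and> x \<in> N \<and> Ck_on k (W \<inter> N) f"
  shows "Ck_on k W f"
  using assms
proof (induction k arbitrary: f)
  case 0
  show ?case unfolding Ck_on.simps continuous_on_eq_continuous_within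
  proof
    fix x assume x: "x \<in> W"
    obtain N where N: "open N" "x \<in> N" "continuous_on (W \<inter> N) f" using 0[OF x] by auto
    have "at x within W = at x within (W \<inter> N)"
      using N by (intro at_within_nhd[of x N]) auto
    then show "continuous (at x within W) f"
      using N x by (simp add: continuous_on_eq_continuous_within)
  qed
next
  case (Suc k)
  have "f differentiable (at x)" if x: "x \<in> W" for x
  proof -
    obtain N where "x \<in> N" "Ck_on (Suc k) (W \<inter> N) f" using Suc.prems[OF x] by blast
    with x show ?thesis unfolding Ck_on.simps(2) by blast
  qed
  moreover have "Ck_on k W (\<lambda>x. frechet_derivative f (at x) v)" for v
  proof (rule Suc.IH)
    fix x assume "x \<in> W"
    from Suc.prems[OF this] show "\<exists>N. open N \<and> x \<in> N \<and> Ck_on k (W \<inter> N) (\<lambda>x. frechet_derivative f (at x) v)"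
      by auto
  qed
  ultimately show ?case by simp
qed

lemma Ck_on_const: "open W \<Longrightarrow> Ck_on k W (\<lambda>x. c)"
proof (induction k arbitrary: c)
  case (Suc k)
  then show ?case by (intro Ck_on_SucI[where f'="\<lambda>x v. 0"]) auto
qed simp

lemma Ck_on_bounded_linear: "open W \<Longrightarrow> bounded_linear f \<Longrightarrow> Ck_on k W f"
proof (cases k)
  case (Suc n)
  assume "open W" "bounded_linear f"
  then show ?thesis unfolding Suc
    by (intro Ck_on_SucI[where f'="\<lambda>x. f"] Ck_on_const) (auto intro: bounded_linear_imp_has_derivative)
qed (auto intro: linear_continuous_on)

lemma Ck_on_add:
  "open W \<Longrightarrow> Ck_on k W f \<Longrightarrow> Ck_on k W g \<Longrightarrow> Ck_on k W (\<lambda>x. f x + g x)"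
proof (induction k arbitrary: f g)
  case (Suc k)
  then show ?case
    by (intro Ck_on_SucI[where f'="\<lambda>x v. frechet_derivative f (at x) v + frechet_derivative g (at x) v"])
      (auto intro!: has_derivative_add simp: frechet_derivative_works)
qed (auto intro: continuous_on_add)

lemma Ck_on_scaleR:
  "open W \<Longrightarrow> Ck_on k W f \<Longrightarrow> Ck_on k W g \<Longrightarrow> Ck_on k W (\<lambda>x. f x *\<^sub>R g x)"
proof (induction k arbitrary: f g)
  case (Suc k)
  have "Ck_on k W f" "Ck_on k W g" using Suc.prems Ck_on_SucD by blast+
  then show ?case using Suc
    by (intro Ck_on_SucI[where f'="\<lambda>x v. f x *\<^sub>R frechet_derivative g (at x) v + frechet_derivative f (at x) v *\<^sub>R g x"])
      (auto intro!: has_derivative_scaleR Ck_on_add simp: frechet_derivative_works)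
qed (auto intro: continuous_on_scaleR)

lemma Ck_on_sum:
  assumes "open W" "\<And>i. i \<in> I \<Longrightarrow> Ck_on k W (f i)"
  shows "Ck_on k W (\<lambda>x. \<Sum>i\<in>I. f i x)"
  using assms(2)
proof (induction I rule: infinite_finite_induct)
  case (insert i I)
  then show ?case by (simp add: Ck_on_add[OF assms(1)])
qed (simp_all add: Ck_on_const[OF assms(1)])

text \<open>The chain rule evaluates the derivative of \<open>g\<close> in a direction that varies
  with the point, whereas \<open>Ck_on\<close> only speaks of fixed directions. Expanding the
  direction in the standard basis turns the derivative into a sum of products, to which the
  induction hypothesis applies.\<close>

lemma Ck_on_compose:
  fixes f :: "'a::real_normed_vector \<Rightarrow> 'b::euclidean_space" and g :: "'b \<Rightarrow> 'c::real_normed_vector"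
  assumes "open U" "Ck_on k U f" "Ck_on k V g" "f ` U \<subseteq> V"
  shows "Ck_on k U (\<lambda>x. g (f x))"
  using assms(2,3)
proof (induction k arbitrary: g)
  case 0
  then show ?case using assms(4) continuous_on_compose2 by auto
next
  case (Suc k)
  let ?D = "\<lambda>h x. frechet_derivative h (at x)"
  have f: "Ck_on k U f" using Suc.prems Ck_on_SucD by blast
  have dg: "(g has_derivative ?D g (f x)) (at (f x))" if "x \<in> U" for x
    using Suc.prems(2) that assms(4) by (auto simp: frechet_derivative_works)
  have df: "(f has_derivative ?D f x) (at x)" if "x \<in> U" for x
    using Suc.prems that by (auto simp: frechet_derivative_works)
  show ?case
  proof (rule Ck_on_SucI[OF assms(1), where f'="\<lambda>x v. \<Sum>b\<in>Basis. (?D f x v \<bullet> b) *\<^sub>R ?D g (f x) b"])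
    fix x assume x: "x \<in> U"
    have "((\<lambda>x. g (f x)) has_derivative (\<lambda>v. ?D g (f x) (?D f x v))) (at x)"
      by (rule has_derivative_compose[OF df[OF x] dg[OF x]])
    moreover have rep: "?D g (f x) w = (\<Sum>b\<in>Basis. (w \<bullet> b) *\<^sub>R ?D g (f x) b)" for w
    proof -
      have l: "linear (?D g (f x))" using dg[OF x] has_derivative_linear by blast
      have "?D g (f x) w = ?D g (f x) (\<Sum>b\<in>Basis. (w \<bullet> b) *\<^sub>R b)" by (simp add: euclidean_representation)
      also have "\<dots> = (\<Sum>b\<in>Basis. (w \<bullet> b) *\<^sub>R ?D g (f x) b)"
        by (simp add: linear_sum[OF l] linear_scale[OF l])
      finally show ?thesis .
    qed
    ultimately show "((\<lambda>x. g (f x)) has_derivative (\<lambda>v. \<Sum>b\<in>Basis. (?D f x v \<bullet> b) *\<^sub>R ?D g (f x) b)) (at x)"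
      by (subst ext[OF rep[of "?D f x _"], symmetric])
  next
    fix v
    have inner: "Ck_on k U (\<lambda>x. ?D f x v \<bullet> b)" for b
    proof (cases k)
      case 0 then show ?thesis using Suc.prems(1) by (simp add: continuous_on_inner)
    next
      case (Suc n)
      have "Ck_on k U (\<lambda>x. ?D f x v)" using Suc.prems(1) by simp
      moreover have "Ck_on j U (\<lambda>x. h x \<bullet> b)" if "Ck_on j U h" for j and h :: "'a \<Rightarrow> 'b"
        using that
      proof (induction j arbitrary: h)
        case 0 then show ?case by (simp add: continuous_on_inner)
      next
        case (Suc j)
        then show ?case
          by (intro Ck_on_SucI[where f'="\<lambda>x v. ?D h x v \<bullet> b"] assms(1))
            (auto intro!: has_derivative_inner_left simp: frechet_derivative_works)
      qed
      ultimately show ?thesis by blast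
    qed
    show "Ck_on k U (\<lambda>x. \<Sum>b\<in>Basis. (?D f x v \<bullet> b) *\<^sub>R ?D g (f x) b)"
      by (intro Ck_on_sum Ck_on_scaleR assms(1) inner, rule Suc.IH[OF f]) (use Suc.prems in auto)
  qed
qed

lemma Ck_on_vector_derivativeI:
  fixes f :: "real \<Rightarrow> 'a::real_normed_vector"
  assumes "open W" "\<And>x. x \<in> W \<Longrightarrow> (f has_vector_derivative f' x) (at x)" "Ck_on k W f'"
  shows "Ck_on (Suc k) W f"
proof (rule Ck_on_SucI[OF assms(1)])
  show "(f has_derivative (\<lambda>v. v *\<^sub>R f' x)) (at x)" if "x \<in> W" for x
    using assms(2)[OF that] by (simp add: has_vector_derivative_def)
  show "Ck_on k W (\<lambda>x. v *\<^sub>R f' x)" for v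
    by (rule Ck_on_scaleR[OF assms(1) Ck_on_const[OF assms(1)] assms(3)])
qed

lemma Ck_on_inverse: "Ck_on k (- {0}) (inverse :: real \<Rightarrow> real)"
proof (induction k)
  case 0 then show ?case by (simp add: continuous_on_inverse)
next
  case (Suc k)
  have "Ck_on k (- {0::real}) (\<lambda>x. (-1) *\<^sub>R (inverse x *\<^sub>R inverse x))"
    by (intro Ck_on_scaleR Ck_on_const Suc) auto
  then show ?case
    by (intro Ck_on_vector_derivativeI[where f'="\<lambda>x. - (inverse x * inverse x)"])
      (auto intro!: derivative_eq_intros simp flip: has_real_derivative_iff_has_vector_derivative)
qed

lemma smooth_onD: "smooth_on W f \<Longrightarrow> Ck_on k W f"
  by (simp add: smooth_on_def)

lemma smooth_on_subset: "smooth_on W f \<Longrightarrow> V \<subseteq> W \<Longrightarrow> smooth_on V f"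
  unfolding smooth_on_def by (blast intro: Ck_on_subset)

lemma smooth_on_cong:
  "open W \<Longrightarrow> (\<And>x. x \<in> W \<Longrightarrow> f x = g x) \<Longrightarrow> smooth_on W f \<Longrightarrow> smooth_on W g"
  unfolding smooth_on_def by (meson Ck_on_cong)

lemma smooth_on_local:
  assumes "\<And>x. x \<in> W \<Longrightarrow> \<exists>N. open N \<and> x \<in> N \<and> smooth_on (W \<inter> N) f"
  shows "smooth_on W f"
  unfolding smooth_on_def
proof
  fix k
  show "Ck_on k W f"
    by (rule Ck_on_local) (use assms in \<open>unfold smooth_on_def, blast\<close>)
qed

lemma smooth_on_const: "open W \<Longrightarrow> smooth_on W (\<lambda>x. c)"
  by (simp add: smooth_on_def Ck_on_const)

lemma smooth_on_bounded_linear: "open W \<Longrightarrow> bounded_linear f \<Longrightarrow> smooth_on W f"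
  by (simp add: smooth_on_def Ck_on_bounded_linear)

lemma smooth_on_add:
  "open W \<Longrightarrow> smooth_on W f \<Longrightarrow> smooth_on W g \<Longrightarrow> smooth_on W (\<lambda>x. f x + g x)"
  by (simp add: smooth_on_def Ck_on_add)

lemma smooth_on_scaleR:
  "open W \<Longrightarrow> smooth_on W f \<Longrightarrow> smooth_on W g \<Longrightarrow> smooth_on W (\<lambda>x. f x *\<^sub>R g x)"
  by (simp add: smooth_on_def Ck_on_scaleR)

lemma smooth_on_mult:
  fixes f g :: "'a::real_normed_vector \<Rightarrow> real"
  shows "open W \<Longrightarrow> smooth_on W f \<Longrightarrow> smooth_on W g \<Longrightarrow> smooth_on W (\<lambda>x. f x * g x)"
  using smooth_on_scaleR[of W f g] by simp

lemma smooth_on_sum: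
  "open W \<Longrightarrow> (\<And>i. i \<in> I \<Longrightarrow> smooth_on W (f i)) \<Longrightarrow> smooth_on W (\<lambda>x. \<Sum>i\<in>I. f i x)"
  by (simp add: smooth_on_def Ck_on_sum)

lemma smooth_on_compose:
  fixes f :: "'a::real_normed_vector \<Rightarrow> 'b::euclidean_space" and g :: "'b \<Rightarrow> 'c::real_normed_vector"
  shows "open U \<Longrightarrow> smooth_on U f \<Longrightarrow> smooth_on V g \<Longrightarrow> f ` U \<subseteq> V \<Longrightarrow> smooth_on U (\<lambda>x. g (f x))"
  unfolding smooth_on_def by (intro allI, rule Ck_on_compose[of U _ f V g]) auto

lemma smooth_on_affine: "open W \<Longrightarrow> smooth_on W (\<lambda>t::real. a + b * t)"
  by (intro smooth_on_add smooth_on_const smooth_on_bounded_linear bounded_linear_mult_right)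

lemma smooth_on_imp_differentiable: "smooth_on W f \<Longrightarrow> x \<in> W \<Longrightarrow> f differentiable (at x)"
  using smooth_onD[of W f "Suc 0"] by simp

lemma smooth_on_imp_continuous: "smooth_on W f \<Longrightarrow> continuous_on W f"
  using smooth_onD[of W f 0] by simp

section \<open>Cutoff functions\<close>

text \<open>The classical flat function exp(-1/t) together with its multiples by powers of 1/t. The
  whole family is considered because differentiation leads to linear combinations of its members, so
  that one induction on the order of smoothness treats all of them.\<close>

definition flat_exp :: "nat \<Rightarrow> real \<Rightarrow> real" where
  "flat_exp n t = (if t > 0 then exp (- inverse t) * inverse t ^ n else 0)"

lemma flat_exp_tendsto_0: "(flat_exp n \<longlongrightarrow> 0) (at 0)"
proof (rule filterlim_split_at_real)
  show "(flat_exp n \<longlongrightarrow> 0) (at_left 0)"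
    by (rule Lim_transform_eventually[OF tendsto_const])
      (auto simp: flat_exp_def eventually_at_filter)
  have "((\<lambda>t. inverse t ^ n / exp (inverse t)) \<longlongrightarrow> 0) (at_right (0::real))"
    by (rule filterlim_compose[OF tendsto_power_div_exp_0 filterlim_inverse_at_top_right])
  then show "(flat_exp n \<longlongrightarrow> 0) (at_right 0)"
    by (rule Lim_transform_eventually)
      (auto simp: flat_exp_def eventually_at_filter exp_minus field_simps)
qed

lemma flat_exp_deriv:
  "(flat_exp n has_real_derivative (flat_exp (n + 2) t - real n * flat_exp (n + 1) t)) (at t)"
proof -
  consider "t > 0" | "t < 0" | "t = 0" by linarith
  then show ?thesis
  proof cases
    case 1
    have "((\<lambda>t. exp (- inverse t) * inverse t ^ n) has_real_derivative
        (flat_exp (n + 2) t - real n * flat_exp (n + 1) t)) (at t)"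
    proof (cases n)
      case 0
      then show ?thesis using 1
        by (auto intro!: derivative_eq_intros simp: flat_exp_def power2_eq_square)
    next
      case (Suc m)
      have "((\<lambda>t. exp (- inverse t) * inverse t ^ n) has_real_derivative
          exp (- inverse t) * (inverse t * inverse t) * inverse t ^ n +
          real n * inverse t ^ m * (- (inverse t * inverse t)) * exp (- inverse t)) (at t)"
        unfolding Suc
        by (rule derivative_eq_intros refl DERIV_inverse DERIV_power_Suc | use 1 in force)+
      then show ?thesis using 1 by (simp add: Suc flat_exp_def algebra_simps)
    qed
    then show ?thesis
      by (rule has_field_derivative_transform_within_open[of _ _ _ "{0<..}"])
        (use 1 in \<open>auto simp: flat_exp_def\<close>)
  next
    case 2
    have "((\<lambda>t. 0) has_real_derivative (flat_exp (n + 2) t - real n * flat_exp (n + 1) t)) (at t)"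
      using 2 by (auto simp: flat_exp_def)
    then show ?thesis
      by (rule has_field_derivative_transform_within_open[of _ _ _ "{..<0}"])
        (use 2 in \<open>auto simp: flat_exp_def\<close>)
  next
    case 3
    \<comment> \<open>Since \<open>flat_exp n 0\<close> vanishes, the difference quotient at 0 is
      \<open>flat_exp (n + 1)\<close>, whose limit is known.\<close>
    have "((\<lambda>h. (flat_exp n h - flat_exp n 0) / (h - 0)) \<longlongrightarrow> 0) (at 0)"
      by (rule Lim_transform_eventually[OF flat_exp_tendsto_0[of "n + 1"]])
        (auto simp: flat_exp_def eventually_at_filter field_simps)
    then show ?thesis using 3
      by (simp add: has_field_derivative_iff flat_exp_def)
  qed
qed

lemma smooth_flat_exp: "smooth_on UNIV (flat_exp n)"
  unfolding smooth_on_def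
proof
  fix k show "Ck_on k UNIV (flat_exp n)"
  proof (induction k arbitrary: n)
    case 0
    show ?case using flat_exp_deriv[of n]
      by (auto intro!: continuous_at_imp_continuous_on DERIV_isCont)
  next
    case (Suc k)
    have "Ck_on k UNIV (\<lambda>t. flat_exp (n + 2) t + (- real n) *\<^sub>R flat_exp (n + 1) t)"
      by (intro Ck_on_add Ck_on_scaleR Ck_on_const open_UNIV Suc)
    then show ?case
      by (intro Ck_on_vector_derivativeI[where f'="\<lambda>t. flat_exp (n + 2) t - real n * flat_exp (n + 1) t"])
        (use flat_exp_deriv[of n] in \<open>auto simp flip: has_real_derivative_iff_has_vector_derivative\<close>)
  qed
qed

text \<open>The usual smooth transition from 0 on the negative axis to 1 beyond 1; the two summands
  of the denominator never vanish together.\<close>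

definition smooth_step :: "real \<Rightarrow> real" where
  "smooth_step t = flat_exp 0 t * inverse (flat_exp 0 t + flat_exp 0 (1 - t))"

lemma smooth_step_denominator_pos: "flat_exp 0 t + flat_exp 0 (1 - t) > 0"
  by (auto simp: flat_exp_def intro: add_pos_pos)

lemma smooth_smooth_step: "smooth_on UNIV smooth_step"
proof -
  have r: "smooth_on UNIV (\<lambda>t. flat_exp 0 (1 + (-1) * t))"
    by (rule smooth_on_compose[OF _ smooth_on_affine smooth_flat_exp]) auto
  have s: "smooth_on UNIV (\<lambda>t. flat_exp 0 t + flat_exp 0 (1 + (-1) * t))"
    by (intro smooth_on_add smooth_flat_exp r open_UNIV)
  have "smooth_on UNIV (\<lambda>t. inverse (flat_exp 0 t + flat_exp 0 (1 + (-1) * t)))"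
    by (rule smooth_on_compose[OF _ s, of "- {0}" inverse])
      (use smooth_step_denominator_pos in \<open>auto simp: smooth_on_def Ck_on_inverse less_le\<close>)
  then have "smooth_on UNIV (\<lambda>t. flat_exp 0 t * inverse (flat_exp 0 t + flat_exp 0 (1 + (-1) * t)))"
    by (intro smooth_on_mult smooth_flat_exp open_UNIV)
  then show ?thesis
    by (rule smooth_on_cong[rotated 2]) (auto simp: smooth_step_def)
qed

lemma smooth_step_0: "t \<le> 0 \<Longrightarrow> smooth_step t = 0"
  by (simp add: smooth_step_def flat_exp_def)

lemma smooth_step_1: "t \<ge> 1 \<Longrightarrow> smooth_step t = 1"
  by (simp add: smooth_step_def flat_exp_def)

lemma smooth_step_bounds: "0 \<le> smooth_step t" "smooth_step t \<le> 1"
proof -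
  have "flat_exp 0 t \<ge> 0" "flat_exp 0 (1 - t) \<ge> 0" by (auto simp: flat_exp_def)
  then show "0 \<le> smooth_step t" "smooth_step t \<le> 1" using smooth_step_denominator_pos[of t]
    by (auto simp: smooth_step_def divide_simps)
qed

text \<open>The squared norm is used because, unlike the norm, it is smooth at the origin. The
  values are 1 on the closed unit ball and 0 as soon as \<open>u \<bullet> u\<close> reaches
  2.\<close>

definition bump :: "'a::real_inner \<Rightarrow> real" where
  "bump u = smooth_step (2 - u \<bullet> u)"

lemma smooth_bump: "smooth_on UNIV (bump :: 'a::euclidean_space \<Rightarrow> real)"
proof -
  have "smooth_on UNIV (\<lambda>u::'a. 2 + (-1) * (\<Sum>b\<in>Basis. (u \<bullet> b) * (u \<bullet> b)))"
    by (intro smooth_on_add smooth_on_mult smooth_on_const smooth_on_sum open_UNIV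
        smooth_on_bounded_linear bounded_linear_inner_left)
  then have "smooth_on UNIV (\<lambda>u::'a. smooth_step (2 + (-1) * (\<Sum>b\<in>Basis. (u \<bullet> b) * (u \<bullet> b))))"
    by (rule smooth_on_compose[OF _ _ smooth_smooth_step, rotated]) auto
  then show ?thesis
  proof (rule smooth_on_cong[rotated 2])
    fix u :: 'a
    show "smooth_step (2 + (-1) * (\<Sum>b\<in>Basis. (u \<bullet> b) * (u \<bullet> b))) = bump u"
      unfolding bump_def by (subst euclidean_inner[of u u]) simp
  qed simp
qed

lemma bump_bounds: "0 \<le> bump u" "bump u \<le> 1"
  by (auto simp: bump_def smooth_step_bounds)

lemma bump_eq_1: "norm u \<le> 1 \<Longrightarrow> bump u = 1"
  using power_mono[of "norm u" 1 2] by (auto simp: bump_def power2_norm_eq_inner intro!: smooth_step_1)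

lemma bump_eq_0: "norm u \<ge> 2 \<Longrightarrow> bump u = 0"
  using power_mono[of 2 "norm u" 2] by (auto simp: bump_def power2_norm_eq_inner intro!: smooth_step_0)

text \<open>\<open>\<theta>\<close> is the normalised integral of a smooth plateau function.
  Travelling the distance \<open>T\<close> in the longer time \<open>T'\<close> leaves room to start
  and to stop smoothly without exceeding speed 1.\<close>

lemma smooth_slow_transition:
  fixes T T' :: real
  assumes "0 < T" "T < T'"
  obtains \<theta> \<theta>' where
    "smooth_on UNIV \<theta>" "smooth_on UNIV \<theta>'"
    "\<And>t. (\<theta> has_real_derivative \<theta>' t) (at t)" "\<And>t. 0 \<le> \<theta>' t" "\<And>t. \<theta>' t \<le> 1"
    "\<And>t. t \<le> 0 \<Longrightarrow> \<theta> t = 0" "\<And>t. t \<ge> T' \<Longrightarrow> \<theta> t = T" "\<And>t. 0 \<le> \<theta> t" "\<And>t. \<theta> t \<le> T"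
proof -
  \<comment> \<open>With this choice the plateau of \<open>b\<close>, from \<open>\<epsilon>\<close>
    to \<open>T' - \<epsilon>\<close>, has length exactly \<open>T\<close>. Hence the integral
    \<open>J\<close> of \<open>b\<close> is at least \<open>T\<close>, and the normalising factor
    \<open>T / J\<close> is at most 1.\<close>
  define \<epsilon> where "\<epsilon> = (T' - T) / 2"
  have \<epsilon>: "\<epsilon> > 0" using assms by (simp add: \<epsilon>_def)
  define b where "b t = smooth_step (t / \<epsilon>) * smooth_step ((T' - t) / \<epsilon>)" for t
  have b01: "0 \<le> b t" "b t \<le> 1" for t
    using smooth_step_bounds[of "t / \<epsilon>"] smooth_step_bounds[of "(T' - t) / \<epsilon>"]
    by (auto simp: b_def intro: mult_le_one)
  have b0: "b t = 0" if "t \<le> 0 \<or> t \<ge> T'" for t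
    using that \<epsilon> by (auto simp: b_def smooth_step_0 divide_nonpos_pos)
  have b1: "b t = 1" if "\<epsilon> \<le> t" "t \<le> T' - \<epsilon>" for t
    using that \<epsilon> by (simp add: b_def smooth_step_1)
  have smb: "smooth_on UNIV b"
  proof -
    have "smooth_on UNIV (\<lambda>t. smooth_step (0 + (1/\<epsilon>) * t) * smooth_step (T'/\<epsilon> + (-1/\<epsilon>) * t))"
      by (intro smooth_on_mult open_UNIV smooth_on_compose[OF _ smooth_on_affine smooth_smooth_step]) auto
    then show ?thesis
      by (rule smooth_on_cong[rotated 2]) (use \<epsilon> in \<open>auto simp: b_def diff_divide_distrib\<close>)
  qed
  have contb: "continuous_on X b" for X
    using smooth_on_imp_continuous[OF smb] continuous_on_subset by blast
  \<comment> \<open>Integrating from -1, where \<open>b\<close> still vanishes, makes every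
    \<open>t \<ge> 0\<close> an interior point of the interval, so the two-sided derivative is
    available at 0 as well.\<close>
  define B where "B t = integral {-1..t} b" for t
  have B0: "B t = 0" if "t \<le> 0" for t
    unfolding B_def using that by (subst integral_cong[of _ _ "\<lambda>_. 0"]) (auto simp: b0)
  have dB: "(B has_real_derivative b t) (at t)" for t
  proof (cases "t < 0")
    case True
    have "((\<lambda>t. 0) has_real_derivative b t) (at t)" using True by (simp add: b0)
    then show ?thesis
      by (rule has_field_derivative_transform_within_open[of _ _ _ "{..<0}"]) (use True B0 in auto)
  next
    case False
    have "(B has_vector_derivative b t) (at t within {-1..t+1})"
      unfolding B_def by (rule integral_has_vector_derivative) (use False contb in auto)
    moreover have "at t within {-1..t+1} = at t"
      using False by (intro at_within_interior) auto
    ultimately show ?thesis by (simp add: has_real_derivative_iff_has_vector_derivative)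
  qed
  have mono: "B s \<le> B t" if "s \<le> t" for s t
    by (rule DERIV_nonneg_imp_nondecreasing[OF that]) (use dB b01 in blast)
  define J where "J = B T'"
  have BJ: "B t = J" if "t \<ge> T'" for t
  proof -
    have "- B T' \<le> - B t"
    proof (rule DERIV_nonneg_imp_nondecreasing[OF that])
      fix s assume "T' \<le> s"
      then have "((\<lambda>s. - B s) has_real_derivative 0) (at s)"
        using DERIV_minus[OF dB[of s]] b0[of s] by simp
      then show "\<exists>y. ((\<lambda>s. - B s) has_real_derivative y) (at s) \<and> y \<ge> 0" by blast
    qed
    with mono[OF that] show ?thesis by (simp add: J_def)
  qed
  have JT: "J \<ge> T"
  proof -
    have "B \<epsilon> - \<epsilon> \<le> B (T' - \<epsilon>) - (T' - \<epsilon>)"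
    proof (rule DERIV_nonneg_imp_nondecreasing[where f="\<lambda>s. B s - s"])
      show "\<epsilon> \<le> T' - \<epsilon>" using assms by (simp add: \<epsilon>_def field_simps)
      fix s assume "\<epsilon> \<le> s" "s \<le> T' - \<epsilon>"
      then have "((\<lambda>s. B s - s) has_real_derivative 0) (at s)"
        using DERIV_diff[OF dB[of s] DERIV_ident] b1[of s] by simp
      then show "\<exists>y. ((\<lambda>s. B s - s) has_real_derivative y) (at s) \<and> y \<ge> 0" by blast
    qed
    moreover have "0 \<le> B \<epsilon>" using mono[of 0 \<epsilon>] B0[of 0] \<epsilon> by simp
    moreover have "B (T' - \<epsilon>) \<le> J" using mono[of "T' - \<epsilon>" T'] \<epsilon> by (simp add: J_def)
    moreover have "2 * \<epsilon> = T' - T" by (simp add: \<epsilon>_def)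
    ultimately show ?thesis by linarith
  qed
  have smB: "smooth_on UNIV B"
    unfolding smooth_on_def
  proof
    fix k show "Ck_on k UNIV B"
      by (rule Ck_on_SucD, rule Ck_on_vector_derivativeI[OF open_UNIV _ smooth_onD[OF smb]])
        (use dB in \<open>simp flip: has_real_derivative_iff_has_vector_derivative\<close>)
  qed
  have J0: "J > 0" using JT assms by linarith
  have BleJ: "B t \<le> J" for t
    using mono[of t T'] BJ[of t] by (cases "t \<le> T'") (auto simp: J_def)
  have Bnn: "0 \<le> B t" for t
    using mono[of 0 t] B0[of t] B0[of 0] by (cases "t \<le> 0") auto
  show ?thesis
  proof (rule that[of "\<lambda>t. (T / J) * B t" "\<lambda>t. (T / J) * b t"])
    show "smooth_on UNIV (\<lambda>t. (T / J) * B t)" "smooth_on UNIV (\<lambda>t. (T / J) * b t)"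
      by (intro smooth_on_mult smooth_on_const open_UNIV smB smb)+
    show "((\<lambda>t. (T / J) * B t) has_real_derivative (T / J) * b t) (at t)" for t
      by (rule DERIV_cmult[OF dB])
    show "0 \<le> (T / J) * b t" for t using J0 assms b01 by simp
    show "(T / J) * b t \<le> 1" for t
      by (rule mult_le_one) (use J0 JT b01 in auto)
    show "(T / J) * B t = 0" if "t \<le> 0" for t using B0 that by simp
    show "(T / J) * B t = T" if "t \<ge> T'" for t using BJ that J0 by simp
    show "0 \<le> (T / J) * B t" for t using Bnn J0 assms by simp
    show "(T / J) * B t \<le> T" for t
      using BleJ[of t] J0 assms by (simp add: field_simps)
  qed
qed

section \<open>Ordinary differential equations\<close>

lemma vector_derivative_bound:
  fixes f :: "real \<Rightarrow> 'a::real_normed_vector"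
  assumes "convex I" "\<And>t. t \<in> I \<Longrightarrow> (f has_vector_derivative f' t) (at t within I)"
    "\<And>t. t \<in> I \<Longrightarrow> norm (f' t) \<le> B" "x \<in> I" "y \<in> I"
  shows "norm (f x - f y) \<le> B * \<bar>x - y\<bar>"
proof -
  have "onorm (\<lambda>s. s *\<^sub>R f' t) \<le> B" if "t \<in> I" for t
    by (rule onorm_le) (use mult_left_mono[OF assms(3)[OF that] abs_ge_zero] in \<open>auto simp: mult.commute\<close>)
  then have "norm (f x - f y) \<le> B * norm (x - y)"
    by (intro differentiable_bound[OF assms(1), of f "\<lambda>t s. s *\<^sub>R f' t"])
      (use assms in \<open>auto simp: has_vector_derivative_def\<close>)
  then show ?thesis by simp
qed

text \<open>Picard iteration as a fixed point problem in the Banach space of bounded continuous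
  functions. The condition on \<open>L * h\<close> makes the integral operator a contraction with
  factor 1/2.\<close>

lemma ode_solution_lipschitz:
  fixes g :: "'e::euclidean_space \<Rightarrow> 'e"
  assumes lip: "\<And>u w. norm (g u - g w) \<le> L * norm (u - w)" and M: "\<And>u. norm (g u) \<le> M"
    and h: "0 \<le> h" and Lh: "L * h \<le> 1 / 2"
  obtains z where "z 0 = z0" "\<And>t. t \<in> {0..h} \<Longrightarrow> (z has_vector_derivative g (z t)) (at t within {0..h})"
proof -
  have L: "0 \<le> L"
  proof -
    obtain b :: 'e where b: "b \<in> Basis" using nonempty_Basis by blast
    show ?thesis using order_trans[OF norm_ge_zero lip[of b 0]] b by simp
  qed
  have contg: "continuous_on X g" for X
    by (rule lipschitz_on_continuous_on[of L]) (use lip L in \<open>auto simp: lipschitz_on_def dist_norm\<close>)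
  \<comment> \<open>Clamping time to \<open>{0..h}\<close> lets the operator act on functions on the
    whole real line and keeps its values bounded.\<close>
  define p where "p t = max 0 (min h t)" for t :: real
  have p: "p t \<in> {0..h}" "p t \<le> h" "0 \<le> p t" for t using h by (auto simp: p_def)
  have contp: "continuous_on X p" for X unfolding p_def by (intro continuous_intros)
  define F where "F \<phi> t = z0 + integral {0..p t} (\<lambda>s. g (apply_bcontfun \<phi> s))" for \<phi> :: "real \<Rightarrow>\<^sub>C 'e" and t
  have contgp: "continuous_on X (\<lambda>s. g (apply_bcontfun \<phi> s))" for X and \<phi> :: "real \<Rightarrow>\<^sub>C 'e"
    using continuous_on_compose2[OF contg[of UNIV] continuous_on_apply_bcontfun[of X \<phi>]] by blast
  have intg: "(\<lambda>s. g (apply_bcontfun \<phi> s)) integrable_on {a..b}"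
    for a b and \<phi> :: "real \<Rightarrow>\<^sub>C 'e"
    by (rule integrable_continuous_real[OF contgp])
  have M0: "0 \<le> M" using M[of 0] norm_ge_zero order_trans by blast
  have F: "F \<phi> \<in> bcontfun" for \<phi>
  proof (rule bcontfun_normI)
    have "continuous_on UNIV (\<lambda>t. integral {0..p t} (\<lambda>s. g (apply_bcontfun \<phi> s)))"
      by (rule continuous_on_compose2[OF indefinite_integral_continuous_1[OF intg[of _ 0 h]] contp])
        (use p in auto)
    then show "continuous_on UNIV (F \<phi>)" unfolding F_def by (intro continuous_intros)
    fix t
    have "norm (integral {0..p t} (\<lambda>s. g (apply_bcontfun \<phi> s))) \<le> M * (p t - 0)"
      by (rule integral_bound) (use p contgp M in auto)
    also have "\<dots> \<le> M * h" using M0 p by (simp add: mult_left_mono)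
    finally show "norm (F \<phi> t) \<le> norm z0 + M * h"
      unfolding F_def by (intro norm_triangle_mono) auto
  qed
  define T where "T \<phi> = Bcontfun (F \<phi>)" for \<phi>
  have T: "apply_bcontfun (T \<phi>) = F \<phi>" for \<phi>
    unfolding T_def using F by (simp add: Bcontfun_inverse)
  have "\<exists>!\<phi>. T \<phi> = \<phi>"
  proof (rule banach_fix_type[of "1/2"])
    show "\<forall>\<phi> \<psi>. dist (T \<phi>) (T \<psi>) \<le> 1 / 2 * dist \<phi> \<psi>"
    proof (intro allI dist_bound)
      fix \<phi> \<psi> :: "real \<Rightarrow>\<^sub>C 'e" and t
      have "dist (F \<phi> t) (F \<psi> t) =
          norm (integral {0..p t} (\<lambda>s. g (apply_bcontfun \<phi> s) - g (apply_bcontfun \<psi> s)))"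
        by (simp add: F_def dist_norm integral_diff[OF intg intg])
      also have "\<dots> \<le> (L * dist \<phi> \<psi>) * (p t - 0)"
      proof (rule integral_bound)
        fix s
        have "norm (g (apply_bcontfun \<phi> s) - g (apply_bcontfun \<psi> s)) \<le> L * dist (apply_bcontfun \<phi> s) (apply_bcontfun \<psi> s)"
          using lip by (simp add: dist_norm)
        also have "\<dots> \<le> L * dist \<phi> \<psi>" by (intro mult_left_mono dist_bounded L)
        finally show "norm (g (apply_bcontfun \<phi> s) - g (apply_bcontfun \<psi> s)) \<le> L * dist \<phi> \<psi>" .
      qed (use p contgp in \<open>auto intro: continuous_on_diff\<close>)
      also have "\<dots> \<le> (L * dist \<phi> \<psi>) * h" using L p by (simp add: mult_left_mono)
      also have "\<dots> = (L * h) * dist \<phi> \<psi>" by simp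
      also have "\<dots> \<le> 1 / 2 * dist \<phi> \<psi>" using Lh by (intro mult_right_mono) auto
      finally show "dist (apply_bcontfun (T \<phi>) t) (apply_bcontfun (T \<psi>) t) \<le> 1 / 2 * dist \<phi> \<psi>"
        by (simp add: T)
    qed
  qed auto
  then obtain \<phi> where \<phi>: "T \<phi> = \<phi>" by blast
  have eq: "apply_bcontfun \<phi> t = z0 + integral {0..t} (\<lambda>s. g (apply_bcontfun \<phi> s))" if "t \<in> {0..h}" for t
  proof -
    have "apply_bcontfun \<phi> t = F \<phi> t" using \<phi> T by metis
    moreover have "p t = t" using that by (auto simp: p_def)
    ultimately show ?thesis by (simp add: F_def)
  qed
  show ?thesis
  proof (rule that[of "apply_bcontfun \<phi>"])
    show "apply_bcontfun \<phi> 0 = z0" using eq[of 0] h by simp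
    fix t assume t: "t \<in> {0..h}"
    have "((\<lambda>t. z0 + integral {0..t} (\<lambda>s. g (apply_bcontfun \<phi> s))) has_vector_derivative 0 + g (apply_bcontfun \<phi> t)) (at t within {0..h})"
      by (intro has_vector_derivative_add has_vector_derivative_const integral_has_vector_derivative contgp t)
    then show "(apply_bcontfun \<phi> has_vector_derivative g (apply_bcontfun \<phi> t)) (at t within {0..h})"
      using has_vector_derivative_transform[OF t eq] by simp
  qed
qed

text \<open>Composing \<open>f\<close> with the nearest point projection onto the ball gives a
  globally Lipschitz and bounded field with the same constants. Since
  \<open>M * h \<le> \<rho>\<close>, the solution cannot leave the ball, where the projection is the
  identity.\<close>

lemma ode_solution_cball:
  fixes f :: "'e::euclidean_space \<Rightarrow> 'e"
  assumes lip: "\<And>u w. u \<in> cball z0 \<rho> \<Longrightarrow> w \<in> cball z0 \<rho> \<Longrightarrow> norm (f u - f w) \<le> L * norm (u - w)"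
    and M: "\<And>u. u \<in> cball z0 \<rho> \<Longrightarrow> norm (f u) \<le> M"
    and h: "0 \<le> h" and L: "0 \<le> L" and Lh: "L * h \<le> 1 / 2" and \<rho>: "0 \<le> \<rho>" and Mh: "M * h \<le> \<rho>"
  obtains z where "z 0 = z0" "\<And>t. t \<in> {0..h} \<Longrightarrow> z t \<in> cball z0 \<rho>"
    "\<And>t. t \<in> {0..h} \<Longrightarrow> (z has_vector_derivative f (z t)) (at t within {0..h})"
proof -
  let ?p = "closest_point (cball z0 \<rho>)"
  have p: "?p u \<in> cball z0 \<rho>" for u using \<rho> by (intro closest_point_in_set) auto
  have "norm (?p u - ?p w) \<le> norm (u - w)" for u w
    using closest_point_lipschitz[of "cball z0 \<rho>" u w] \<rho> by (simp add: dist_norm)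
  then have lip': "norm (f (?p u) - f (?p w)) \<le> L * norm (u - w)" for u w
    using lip[OF p p, of u w] L by (meson mult_left_mono order_trans)
  obtain z where z: "z 0 = z0" "\<And>t. t \<in> {0..h} \<Longrightarrow> (z has_vector_derivative f (?p (z t))) (at t within {0..h})"
    using ode_solution_lipschitz[of "\<lambda>u. f (?p u)" L M h z0] lip' M[OF p] h Lh by blast
  have M0: "0 \<le> M" using M[of z0] \<rho> norm_ge_zero order_trans by (metis centre_in_cball)
  have zin: "z t \<in> cball z0 \<rho>" if t: "t \<in> {0..h}" for t
  proof -
    have "norm (z t - z 0) \<le> M * \<bar>t - 0\<bar>"
      by (rule vector_derivative_bound[OF _ z(2)]) (use M[OF p] t h in auto)
    also have "\<dots> \<le> M * h" using t M0 by (auto intro: mult_left_mono)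
    finally show ?thesis using Mh z(1) by (simp add: dist_norm norm_minus_commute)
  qed
  show ?thesis
  proof (rule that[of z])
    show "z 0 = z0" "\<And>t. t \<in> {0..h} \<Longrightarrow> z t \<in> cball z0 \<rho>" using z(1) zin by auto
    fix t assume t: "t \<in> {0..h}"
    show "(z has_vector_derivative f (z t)) (at t within {0..h})"
      using z(2)[OF t] closest_point_self[OF zin[OF t]] by simp
  qed
qed

section \<open>Approximation by flows in Euclidean space\<close>

text \<open>The rule \<open>Bolzano\<close> requires a transitive predicate, which \<open>P\<close>
  need not be. The existence of a finite chain of subintervals satisfying \<open>P\<close> is
  transitive, and \<open>P\<close> itself provides chains of length one.\<close>

lemma Bolzano_partition:
  fixes a b :: real
  assumes "a \<le> b"
    and local: "\<And>\<tau>. a \<le> \<tau> \<Longrightarrow> \<tau> \<le> b \<Longrightarrow>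
      \<exists>d>0. \<forall>u v. a \<le> u \<and> u \<le> \<tau> \<and> \<tau> \<le> v \<and> v \<le> b \<and> v - u < d \<longrightarrow> P u v"
  obtains m :: nat and t where "t 0 = a" "t m = b" "\<And>i. i < m \<Longrightarrow> t i \<le> t (Suc i) \<and> P (t i) (t (Suc i))"
proof -
  define Q where "Q u v \<longleftrightarrow> (a \<le> u \<longrightarrow> v \<le> b \<longrightarrow> (\<exists>m (t :: nat \<Rightarrow> real). t 0 = u \<and> t m = v \<and>
    (\<forall>i<m. t i \<le> t (Suc i) \<and> P (t i) (t (Suc i)))))" for u v
  have "Q a b"
    using assms(1)
  proof (induction rule: Bolzano)
    case (trans u v w)
    show ?case unfolding Q_def
    proof (intro impI)
      assume uw: "a \<le> u" "w \<le> b"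
      obtain m t where t: "t 0 = u" "t m = v" "\<And>i. i < m \<Longrightarrow> t i \<le> t (Suc i) \<and> P (t i) (t (Suc i))"
        using trans uw unfolding Q_def by (metis order_trans)
      obtain n s where s: "s 0 = v" "s n = w" "\<And>i. i < n \<Longrightarrow> s i \<le> s (Suc i) \<and> P (s i) (s (Suc i))"
        using trans uw unfolding Q_def by (metis order_trans)
      let ?r = "\<lambda>i. if i \<le> m then t i else s (i - m)"
      have "?r i \<le> ?r (Suc i) \<and> P (?r i) (?r (Suc i))" if "i < m + n" for i
      proof (cases "i < m")
        case False
        then have "?r i = s (i - m)" using t s by (cases "i = m") auto
        then show ?thesis using False s(3)[of "i - m"] that by (simp add: Suc_diff_le)
      qed (use t(3) in auto)
      moreover have "?r (m + n) = w" using t s by (cases "n = 0") auto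
      ultimately show "\<exists>m (t :: nat \<Rightarrow> real). t 0 = u \<and> t m = w \<and>
          (\<forall>i<m. t i \<le> t (Suc i) \<and> P (t i) (t (Suc i)))"
        using t(1) by (intro exI[of _ "m + n"] exI[of _ ?r]) auto
    qed
  next
    case (local \<tau>)
    obtain d where d: "d > 0" "\<And>u v. a \<le> u \<and> u \<le> \<tau> \<and> \<tau> \<le> v \<and> v \<le> b \<and> v - u < d \<Longrightarrow> P u v"
      using assms(2)[OF local] by blast
    have "Q u v" if "u \<le> \<tau> \<and> \<tau> \<le> v \<and> v - u < d" for u v
      unfolding Q_def using d(2)[of u v] that
      by (intro impI exI[of _ 1] exI[of _ "\<lambda>i. if i = 0 then u else v"]) auto
    then show ?case using d(1) by blast
  qed
  then show ?thesis using that unfolding Q_def by blast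
qed

text \<open>Over a short interval around \<open>\<tau>\<close> both motions are nearly linear: the
  flow line from \<open>u\<close> moves by about \<open>h *\<^sub>R f (x \<tau>)\<close> and the
  curve by about \<open>h *\<^sub>R v\<close>. Replacing the field along the flow line by its value
  at \<open>x \<tau>\<close> costs the Lipschitz constant times the distance; this yields the factor
  \<open>1 + L * (b - a)\<close> and a part \<open>2 * L\<close> of the error. The remaining 2 comes
  from the error of differentiation and from the distance between \<open>f (x \<tau>)\<close> and
  \<open>v\<close>.\<close>

lemma flow_approximation_good_piece:
  fixes x :: "real \<Rightarrow> 'e::euclidean_space" and \<rho> :: "'e \<Rightarrow> 'e \<Rightarrow> ennreal"
  assumes L: "0 \<le> L" and lip: "\<And>u w. u \<in> ball 0 1 \<Longrightarrow> w \<in> ball 0 1 \<Longrightarrow> norm (f u - f w) \<le> L * norm (u - w)"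
    and \<rho>_refl: "\<And>u. \<rho> u u = 0"
    and \<rho>_flow: "\<And>h z. 0 < h \<Longrightarrow> (\<And>t. t \<in> {0..h} \<Longrightarrow> norm (z t) < 1 \<and>
        (z has_vector_derivative f (z t)) (at t within {0..h})) \<Longrightarrow> \<rho> (z 0) (z h) \<le> ennreal h"
    and xr: "\<And>\<sigma>. \<sigma> \<in> {s..t} \<Longrightarrow> norm (x \<sigma>) \<le> r" and \<eta>: "0 < \<eta>" "r + 2 * \<eta> < 1"
    and \<tau>: "\<tau> \<in> {s..t}" and v: "(x has_vector_derivative v) (at \<tau> within {s..t})"
    and \<epsilon>: "0 < \<epsilon>" and fv: "norm (f (x \<tau>) - v) < \<epsilon>"
  shows "\<exists>d>0. \<forall>a b. s \<le> a \<and> a \<le> \<tau> \<and> \<tau> \<le> b \<and> b \<le> t \<and> b - a < d \<longrightarrow>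
    (\<forall>u. norm (u - x a) \<le> \<eta> \<longrightarrow> (\<exists>w. \<rho> u w \<le> ennreal (b - a) \<and>
       norm (w - x b) \<le> (1 + L * (b - a)) * norm (u - x a) + (2 * L + 2) * \<epsilon> * (b - a)))"
proof -
  obtain d1 where d1: "d1 > 0" "\<And>y. y \<in> {s..t} \<Longrightarrow> \<bar>y - \<tau>\<bar> < d1 \<Longrightarrow>
      norm (x y - x \<tau> - (y - \<tau>) *\<^sub>R v) \<le> \<epsilon> * \<bar>y - \<tau>\<bar>"
    using v \<epsilon> unfolding has_vector_derivative_def has_derivative_within_alt real_norm_def by meson
  have "continuous (at \<tau> within {s..t}) x" using v has_vector_derivative_continuous by blast
  then obtain d2 where d2: "d2 > 0" "\<And>y. y \<in> {s..t} \<Longrightarrow> \<bar>y - \<tau>\<bar> < d2 \<Longrightarrow> norm (x y - x \<tau>) < \<epsilon>"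
    using \<epsilon> unfolding continuous_within_eps_delta dist_norm real_norm_def by meson
  define M where "M = norm (f (x \<tau>)) + 2 * L"
  have M0: "0 \<le> M" using L by (simp add: M_def)
  have x\<tau>: "norm (x \<tau>) < 1" using xr[OF \<tau>] \<eta> by linarith
  have M: "norm (f u) \<le> M" if "norm u < 1" for u
  proof -
    have "norm (f u - f (x \<tau>)) \<le> L * norm (u - x \<tau>)" using lip that x\<tau> by simp
    also have "norm (u - x \<tau>) \<le> 2" using norm_triangle_ineq4[of u "x \<tau>"] that x\<tau> by linarith
    finally have "norm (f u - f (x \<tau>)) \<le> L * 2" using L by (simp add: mult_left_mono)
    then show ?thesis using norm_triangle_sub[of "f u" "f (x \<tau>)"] unfolding M_def by linarith
  qed
  \<comment> \<open>The radius allowed to the flow line: at most \<open>\<epsilon>\<close> for the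
    error estimate, and at most \<open>\<eta>\<close> so that the flow line stays inside the unit
    ball.\<close>
  define \<mu> where "\<mu> = min \<epsilon> \<eta>"
  have \<mu>: "0 < \<mu>" "\<mu> \<le> \<epsilon>" "\<mu> \<le> \<eta>" using \<epsilon> \<eta> by (auto simp: \<mu>_def)
  \<comment> \<open>The four bounds serve, in this order, the differentiability of \<open>x\<close>
    at \<open>\<tau>\<close>, the continuity of \<open>x\<close> at \<open>\<tau>\<close>, the
    confinement of the flow line to radius \<open>\<mu>\<close>, and the contraction condition
    \<open>L * h \<le> 1 / 2\<close>. The bound \<open>M\<close>, and with it \<open>d\<close>, may
    depend on \<open>f\<close>.\<close>
  define d where "d = Min {d1, d2, \<mu> / (M + 1), 1 / (2 * L + 1)}"
  have d: "d > 0" "d \<le> d1" "d \<le> d2" "d \<le> \<mu> / (M + 1)" "d \<le> 1 / (2 * L + 1)"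
    using d1 d2 \<mu> M0 L by (auto simp: d_def)
  have "\<exists>w. \<rho> u w \<le> ennreal (b - a) \<and>
       norm (w - x b) \<le> (1 + L * (b - a)) * norm (u - x a) + (2 * L + 2) * \<epsilon> * (b - a)"
    if ab: "s \<le> a" "a \<le> \<tau>" "\<tau> \<le> b" "b \<le> t" "b - a < d" and u: "norm (u - x a) \<le> \<eta>" for a b u
  proof (cases "a = b")
    case True
    then show ?thesis using \<rho>_refl by (intro exI[of _ u]) auto
  next
    case False
    define h where "h = b - a"
    have h: "0 < h" "h < d" using ab False by (auto simp: h_def)
    have "h * (M + 1) \<le> \<mu>" "h * (2 * L + 1) \<le> 1"
      using h d M0 L by (simp_all add: pos_le_divide_eq[symmetric])
    then have Mh: "M * h \<le> \<mu>" and Lh: "L * h \<le> 1 / 2" using h by (auto simp: algebra_simps)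
    have "norm u \<le> norm (x a) + norm (u - x a)" by (metis norm_triangle_sub)
    then have un: "norm u \<le> r + \<eta>" using u xr[of a] ab by fastforce
    have cb: "norm w < 1" if "w \<in> cball u \<mu>" for w
      using that un \<mu> \<eta> norm_triangle_sub[of w u] by (simp add: dist_norm norm_minus_commute)
    obtain z where z: "z 0 = u" "\<And>\<sigma>. \<sigma> \<in> {0..h} \<Longrightarrow> z \<sigma> \<in> cball u \<mu>"
      "\<And>\<sigma>. \<sigma> \<in> {0..h} \<Longrightarrow> (z has_vector_derivative f (z \<sigma>)) (at \<sigma> within {0..h})"
    proof (rule ode_solution_cball[of u \<mu> f L M h])
      show "norm (f u' - f w) \<le> L * norm (u' - w)" if "u' \<in> cball u \<mu>" "w \<in> cball u \<mu>" for u' w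
        using lip cb[OF that(1)] cb[OF that(2)] by simp
    qed (use cb M h L Lh \<mu> Mh in auto)
    define e where "e = norm (u - x a)"
    have \<rho>z: "\<rho> u (z h) \<le> ennreal (b - a)"
      using \<rho>_flow[OF h(1), of z] z cb by (simp add: h_def)
    have fz: "norm (f (z \<sigma>) - f (x \<tau>)) \<le> L * (e + 2 * \<epsilon>)" if \<sigma>: "\<sigma> \<in> {0..h}" for \<sigma>
    proof -
      have "norm (f (z \<sigma>) - f (x \<tau>)) \<le> L * norm (z \<sigma> - x \<tau>)"
        using lip cb[OF z(2)[OF \<sigma>]] x\<tau> by simp
      also have "norm (z \<sigma> - x \<tau>) \<le> e + 2 * \<epsilon>"
      proof -
        have "norm (z \<sigma> - u) \<le> \<epsilon>" using z(2)[OF \<sigma>] \<mu> by (simp add: dist_norm norm_minus_commute)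
        moreover have "norm (x a - x \<tau>) < \<epsilon>" using d2(2)[of a] ab d h by (auto simp: h_def)
        moreover have "z \<sigma> - x \<tau> = (z \<sigma> - u) + (u - x a) + (x a - x \<tau>)" by simp
        ultimately show ?thesis unfolding e_def
          using norm_triangle_ineq[of "(z \<sigma> - u) + (u - x a)" "x a - x \<tau>"]
            norm_triangle_ineq[of "z \<sigma> - u" "u - x a"] by (smt (verit))
      qed
      finally show ?thesis using L by (simp add: mult_left_mono)
    qed
    have "norm ((z h - h *\<^sub>R f (x \<tau>)) - (z 0 - 0 *\<^sub>R f (x \<tau>))) \<le> L * (e + 2 * \<epsilon>) * \<bar>h - 0\<bar>"
      by (rule vector_derivative_bound[of "{0..h}" "\<lambda>\<sigma>. z \<sigma> - \<sigma> *\<^sub>R f (x \<tau>)" "\<lambda>\<sigma>. f (z \<sigma>) - f (x \<tau>)"])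
        (use h fz z(3) in \<open>auto intro!: derivative_eq_intros\<close>)
    then have 1: "norm (z h - u - h *\<^sub>R f (x \<tau>)) \<le> L * (e + 2 * \<epsilon>) * h"
      using z(1) h by (simp add: algebra_simps)
    \<comment> \<open>The time \<open>\<tau>\<close> lies anywhere between \<open>a\<close> and
      \<open>b\<close>, so the expansion at \<open>\<tau>\<close> is used at both ends. The two
      errors add up to \<open>\<epsilon> * h\<close> because the distances of the ends from
      \<open>\<tau>\<close> add up to \<open>h\<close>.\<close>
    have "norm (x b - x \<tau> - (b - \<tau>) *\<^sub>R v) \<le> \<epsilon> * \<bar>b - \<tau>\<bar>" "norm (x a - x \<tau> - (a - \<tau>) *\<^sub>R v) \<le> \<epsilon> * \<bar>a - \<tau>\<bar>"
      using d1(2)[of b] d1(2)[of a] ab d h by (auto simp: h_def)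
    moreover have "x b - x a - h *\<^sub>R v = (x b - x \<tau> - (b - \<tau>) *\<^sub>R v) - (x a - x \<tau> - (a - \<tau>) *\<^sub>R v)"
      by (simp add: h_def algebra_simps)
    moreover have "\<bar>b - \<tau>\<bar> + \<bar>a - \<tau>\<bar> = h" using ab by (simp add: h_def)
    ultimately have 2: "norm (x b - x a - h *\<^sub>R v) \<le> \<epsilon> * h"
      using norm_triangle_ineq4 by (smt (verit) distrib_left)
    have 3: "norm (h *\<^sub>R (f (x \<tau>) - v)) \<le> h * \<epsilon>"
      using fv h by (simp add: mult_left_mono)
    have "z h - x b = (z h - u - h *\<^sub>R f (x \<tau>)) + (u - x a) + h *\<^sub>R (f (x \<tau>) - v) - (x b - x a - h *\<^sub>R v)"
      by (simp add: algebra_simps)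
    also have "norm \<dots> \<le> L * (e + 2 * \<epsilon>) * h + e + h * \<epsilon> + \<epsilon> * h"
    proof -
      have "norm (p + q + r' - q') \<le> norm p + norm q + norm r' + norm q'" for p q r' q' :: 'e
        using norm_triangle_ineq4[of "p + q + r'" q'] norm_triangle_ineq[of "p + q" r'] norm_triangle_ineq[of p q]
        by linarith
      from this[of "z h - u - h *\<^sub>R f (x \<tau>)" "u - x a" "h *\<^sub>R (f (x \<tau>) - v)" "x b - x a - h *\<^sub>R v"]
      show ?thesis using 1 2 3 unfolding e_def by linarith
    qed
    also have "\<dots> = (1 + L * h) * e + (2 * L + 2) * \<epsilon> * h" by (simp add: algebra_simps)
    finally show ?thesis using \<rho>z by (intro exI[of _ "z h"]) (simp add: h_def e_def)
  qed
  then show ?thesis using d(1) by blast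
qed

lemma sum_disjoint_intervals_le_measure:
  fixes t :: "nat \<Rightarrow> real"
  assumes mono: "\<And>i. i < m \<Longrightarrow> t i \<le> t (Suc i)" and U: "U \<in> lmeasurable"
    and B: "B \<subseteq> {..<m}" "\<And>i. i \<in> B \<Longrightarrow> {t i<..<t (Suc i)} \<subseteq> U"
  shows "(\<Sum>i\<in>B. t (Suc i) - t i) \<le> measure lebesgue U"
    and "disjoint_family_on (\<lambda>i. {t i<..<t (Suc i)}) {..<m}"
proof -
  have le: "t i \<le> t j" if "i \<le> j" "j \<le> m" for i j
    using that by (induction rule: dec_induct) (use mono in \<open>auto intro: order_trans\<close>)
  have "{t i<..<t (Suc i)} \<inter> {t j<..<t (Suc j)} = {}" if "i < j" "j < m" for i j
    using le[of "Suc i" j] that by auto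
  then show dis: "disjoint_family_on (\<lambda>i. {t i<..<t (Suc i)}) {..<m}"
    unfolding disjoint_family_on_def by (metis Int_commute lessThan_iff linorder_neqE_nat)
  have fin: "finite B" using B(1) finite_subset by blast
  have "(\<Sum>i\<in>B. t (Suc i) - t i) = (\<Sum>i\<in>B. measure lebesgue {t i<..<t (Suc i)})"
    by (rule sum.cong) (use B(1) mono in auto)
  also have "\<dots> = measure lebesgue (\<Union>i\<in>B. {t i<..<t (Suc i)})"
    by (rule measure_finite_Union[symmetric])
      (use fin dis B(1) mono in \<open>auto simp: emeasure_lborel_Ioo intro: disjoint_family_on_mono\<close>)
  also have "\<dots> \<le> measure lebesgue U"
    by (rule measure_mono_fmeasurable) (use B U fin in \<open>auto intro!: sets.finite_UN\<close>)
  finally show "(\<Sum>i\<in>B. t (Suc i) - t i) \<le> measure lebesgue U" .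
qed

text \<open>The cost \<open>\<rho>\<close> is kept abstract; it will be the flow distance
  transported by a chart. The conclusion covers all starting points near \<open>x s\<close>, not
  just \<open>x s\<close> itself, because the approximation in the preceding chart ends only near
  that point.\<close>

lemma flow_approximation:
  fixes x :: "real \<Rightarrow> 'e::euclidean_space" and \<rho> :: "'e \<Rightarrow> 'e \<Rightarrow> ennreal"
  assumes st: "s \<le> t" and L: "0 \<le> L"
    and lip: "\<And>f u w. f \<in> F \<Longrightarrow> u \<in> ball 0 1 \<Longrightarrow> w \<in> ball 0 1 \<Longrightarrow> norm (f u - f w) \<le> L * norm (u - w)"
    and \<rho>_refl: "\<And>u. \<rho> u u = 0" and \<rho>_triangle: "\<And>u v w. \<rho> u w \<le> \<rho> u v + \<rho> v w"
    and \<rho>_flow: "\<And>f h z. f \<in> F \<Longrightarrow> 0 < h \<Longrightarrow> (\<And>t. t \<in> {0..h} \<Longrightarrow> norm (z t) < 1 \<and>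
        (z has_vector_derivative f (z t)) (at t within {0..h})) \<Longrightarrow> \<rho> (z 0) (z h) \<le> ennreal h"
    and ac: "abs_continuous_on s t x"
    and xr: "\<And>\<sigma>. \<sigma> \<in> {s..t} \<Longrightarrow> norm (x \<sigma>) \<le> r" and r: "r < 1"
    and N: "N \<in> null_sets lebesgue"
    and x': "\<And>\<tau>. \<tau> \<in> {s..t} - N \<Longrightarrow> \<exists>v. (x has_vector_derivative v) (at \<tau> within {s..t}) \<and>
        (\<forall>\<epsilon>>0. \<exists>f\<in>F. norm (f (x \<tau>) - v) < \<epsilon>)"
    and \<eta>: "0 < \<eta>"
  obtains \<delta> where "0 < \<delta>" "\<And>u. norm (u - x s) < \<delta> \<Longrightarrow>
      \<exists>w. norm w < 1 \<and> norm (w - x t) < \<eta> \<and> \<rho> u w \<le> ennreal (t - s)"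
proof -
  \<comment> \<open>The room between \<open>r\<close> and 1 must hold the deviation from the curve
    and the radius of a flow line, each at most \<open>\<eta>'\<close>.\<close>
  define \<eta>' where "\<eta>' = min (\<eta> / 2) ((1 - r) / 3)"
  have \<eta>': "0 < \<eta>'" "\<eta>' < \<eta>" "r + 2 * \<eta>' < 1" using \<eta> r by (auto simp: \<eta>'_def min_def field_simps)
  \<comment> \<open>\<open>K\<close> is the Gronwall factor. \<open>C * \<epsilon>\<close> bounds
    the sum of the local errors: \<open>(2 * L + 2) * \<epsilon>\<close> per unit of time on good
    pieces, and one further \<open>\<epsilon>\<close> for all bad pieces together. The values of
    \<open>\<epsilon>\<close> and \<open>\<delta>\<close> below split the admissible total
    \<open>\<eta>'\<close> evenly between the local errors and the initial deviation.\<close>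
  define K where "K = exp (L * (t - s))"
  define C where "C = (2 * L + 2) * (t - s) + 1"
  have K: "K > 0" by (simp add: K_def)
  have C: "C > 0" unfolding C_def using L st by (simp add: add_nonneg_pos)
  define \<epsilon> where "\<epsilon> = \<eta>' / (2 * K * C)"
  define \<delta> where "\<delta> = \<eta>' / (2 * K)"
  have \<epsilon>: "0 < \<epsilon>" and \<delta>: "0 < \<delta>" using \<eta>' K C by (auto simp: \<epsilon>_def \<delta>_def)
  have tot: "K * (\<delta> + C * \<epsilon>) = \<eta>'" using K C by (simp add: \<epsilon>_def \<delta>_def field_simps)
  obtain \<kappa> where \<kappa>: "\<kappa> > 0" and ac': "\<And>(n::nat) l r.
        (\<forall>i<n. s \<le> l i \<and> l i \<le> r i \<and> r i \<le> t) \<and>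
        disjoint_family_on (\<lambda>i. {l i<..<r i}) {..<n} \<and>
        (\<Sum>i<n. r i - l i) < \<kappa> \<Longrightarrow> (\<Sum>i<n. norm (x (r i) - x (l i))) < \<epsilon>"
    using ac \<epsilon> unfolding abs_continuous_on_def by meson
  have Nl: "N \<in> sets lebesgue" using N by auto
  \<comment> \<open>The measure of the cover is prescribed by the \<open>\<kappa>\<close> that
    absolute continuity assigns to \<open>\<epsilon>\<close>, so the curve moves by less than
    \<open>\<epsilon>\<close> in total on the pieces inside \<open>U\<close>.\<close>
  obtain U where U: "open U" "N \<subseteq> U" "(U - N) \<in> lmeasurable" "emeasure lebesgue (U - N) < ennreal \<kappa>"
    using sets_lebesgue_outer_open[OF Nl \<kappa>] by blast
  have "emeasure lebesgue U = emeasure lebesgue (U - N)"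
    using N U by (intro emeasure_Diff_null_set[symmetric]) auto
  then have lt: "emeasure lebesgue U < ennreal \<kappa>" using U by simp
  then have Ul: "U \<in> lmeasurable"
    using U(1) order_less_trans[OF lt ennreal_less_top] by (auto intro!: fmeasurableI)
  have Um: "measure lebesgue U < \<kappa>"
    using lt unfolding emeasure_eq_measure2[OF Ul] by (simp add: ennreal_less_iff)
  define good where "good a b \<longleftrightarrow> (\<forall>u. norm (u - x a) \<le> \<eta>' \<longrightarrow> (\<exists>w. \<rho> u w \<le> ennreal (b - a) \<and>
       norm (w - x b) \<le> (1 + L * (b - a)) * norm (u - x a) + (2 * L + 2) * \<epsilon> * (b - a)))" for a b
  obtain m T where T: "T 0 = s" "T m = t"
    "\<And>i. i < m \<Longrightarrow> T i \<le> T (Suc i) \<and> (good (T i) (T (Suc i)) \<or> {T i..T (Suc i)} \<subseteq> U)"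
  proof (rule Bolzano_partition[OF st, of "\<lambda>a b. good a b \<or> {a..b} \<subseteq> U"])
    fix \<tau> assume \<tau>: "s \<le> \<tau>" "\<tau> \<le> t"
    show "\<exists>d>0. \<forall>a b. s \<le> a \<and> a \<le> \<tau> \<and> \<tau> \<le> b \<and> b \<le> t \<and> b - a < d \<longrightarrow> good a b \<or> {a..b} \<subseteq> U"
    proof (cases "\<tau> \<in> N")
      case True
      then obtain d where d: "d > 0" "ball \<tau> d \<subseteq> U" using U open_contains_ball by blast
      have "{a..b} \<subseteq> U" if "a \<le> \<tau>" "\<tau> \<le> b" "b - a < d" for a b
        using that by (intro order_trans[OF _ d(2)]) (auto simp: dist_real_def)
      then show ?thesis using d(1) by blast
    next
      case False
      then obtain v f where v: "(x has_vector_derivative v) (at \<tau> within {s..t})"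
        and f: "f \<in> F" "norm (f (x \<tau>) - v) < \<epsilon>"
        using x'[of \<tau>] \<tau> \<epsilon> by auto
      have "\<exists>d>0. \<forall>a b. s \<le> a \<and> a \<le> \<tau> \<and> \<tau> \<le> b \<and> b \<le> t \<and> b - a < d \<longrightarrow> good a b"
        unfolding good_def
        by (rule flow_approximation_good_piece[where f=f and v=v and r=r])
          (use L \<rho>_refl \<eta>' \<tau> v \<epsilon> f lip \<rho>_flow[OF f(1)] xr in auto)
      then show ?thesis by blast
    qed
  qed blast
  have Tle: "T i \<le> T j" if "i \<le> j" "j \<le> m" for i j
    using that by (induction rule: dec_induct) (use T(3) in \<open>auto intro: order_trans\<close>)
  have Tst: "T i \<in> {s..t}" if "i \<le> m" for i using Tle[of 0 i] Tle[of i m] that T by auto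
  define B where "B = {i. i < m \<and> \<not> good (T i) (T (Suc i))}"
  have BU: "{T i<..<T (Suc i)} \<subseteq> U" if "i \<in> B" for i
    using that T(3)[of i] greaterThanLessThan_subseteq_atLeastAtMost_iff by (fastforce simp: B_def)
  define \<beta> where "\<beta> j = (if j \<in> B then norm (x (T (Suc j)) - x (T j)) else (2 * L + 2) * \<epsilon> * (T (Suc j) - T j))" for j
  have \<beta>0: "0 \<le> \<beta> j" if "j < m" for j using T(3)[OF that] L \<epsilon> by (simp add: \<beta>_def)
  have bad: "(\<Sum>j\<in>B. norm (x (T (Suc j)) - x (T j))) < \<epsilon>"
  proof -
    \<comment> \<open>Collapsing every good piece to a point lets the definition of absolute
      continuity, which runs over all indices below \<open>m\<close>, be applied without renumbering
      the bad pieces.\<close>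
    let ?r = "\<lambda>i. if i \<in> B then T (Suc i) else T i"
    have Bm: "B \<subseteq> {..<m}" by (auto simp: B_def)
    have s1: "(\<Sum>i<m. ?r i - T i) = (\<Sum>i\<in>B. T (Suc i) - T i)"
      using Bm by (intro sum.mono_neutral_cong_right) auto
    have s2: "(\<Sum>i<m. norm (x (?r i) - x (T i))) = (\<Sum>i\<in>B. norm (x (T (Suc i)) - x (T i)))"
      using Bm by (intro sum.mono_neutral_cong_right) auto
    note sd = sum_disjoint_intervals_le_measure[of m T U B, OF T(3)[THEN conjunct1] Ul Bm BU]
    have "(\<Sum>i<m. norm (x (?r i) - x (T i))) < \<epsilon>"
    proof (rule ac', intro conjI allI impI)
      fix i assume i: "i < m"
      show "s \<le> T i" "T i \<le> ?r i" "?r i \<le> t" using Tst[of i] Tst[of "Suc i"] T(3)[OF i] i by auto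
    next
      show "disjoint_family_on (\<lambda>i. {T i<..<?r i}) {..<m}"
        using sd(2) by (auto simp: disjoint_family_on_def)
      show "(\<Sum>i<m. ?r i - T i) < \<kappa>" using s1 sd(1) Um by linarith
    qed
    then show ?thesis using s2 by simp
  qed
  have sum\<beta>: "(\<Sum>j<m. \<beta> j) \<le> C * \<epsilon>"
  proof -
    have "\<beta> j \<le> (2 * L + 2) * \<epsilon> * (T (Suc j) - T j) + (if j \<in> B then norm (x (T (Suc j)) - x (T j)) else 0)"
      if "j < m" for j using T(3)[OF that] L \<epsilon> by (simp add: \<beta>_def)
    then have "(\<Sum>j<m. \<beta> j) \<le> (\<Sum>j<m. (2 * L + 2) * \<epsilon> * (T (Suc j) - T j) +
        (if j \<in> B then norm (x (T (Suc j)) - x (T j)) else 0))"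
      by (intro sum_mono) auto
    also have "\<dots> = (2 * L + 2) * \<epsilon> * (\<Sum>j<m. T (Suc j) - T j) + (\<Sum>j<m. if j \<in> B then norm (x (T (Suc j)) - x (T j)) else 0)"
      by (simp add: sum.distrib sum_distrib_left)
    also have "(\<Sum>j<m. T (Suc j) - T j) = t - s" using sum_lessThan_telescope[of T m] T by simp
    also have "(\<Sum>j<m. if j \<in> B then norm (x (T (Suc j)) - x (T j)) else 0) = (\<Sum>j\<in>B. norm (x (T (Suc j)) - x (T j)))"
      by (intro sum.mono_neutral_cong_right) (auto simp: B_def)
    finally show ?thesis using bad by (simp add: C_def algebra_simps)
  qed
  show ?thesis
  proof (rule that[OF \<delta>])
    fix u assume u: "norm (u - x s) < \<delta>"
    \<comment> \<open>Discrete Gronwall bound: the factors \<open>1 + L * h\<close> of the pieces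
      are dominated by \<open>exp (L * h)\<close> and multiply to the exponential of the elapsed
      time, while each local error \<open>\<beta> j\<close> is amplified by at most the full
      exponential.\<close>
    define E where "E i = exp (L * (T i - s)) * (norm (u - x s) + (\<Sum>j<i. \<beta> j))" for i
    have E\<eta>: "E i \<le> \<eta>'" if i: "i \<le> m" for i
    proof -
      have "(\<Sum>j<i. \<beta> j) \<le> (\<Sum>j<m. \<beta> j)" using i \<beta>0 by (intro sum_mono2) auto
      moreover have "0 \<le> (\<Sum>j<i. \<beta> j)" using i \<beta>0 by (intro sum_nonneg) auto
      moreover have "exp (L * (T i - s)) \<le> K"
        unfolding K_def using L Tst[OF i] by (auto intro!: mult_left_mono)
      ultimately have "E i \<le> K * (\<delta> + C * \<epsilon>)"
        unfolding E_def using u sum\<beta> K by (intro mult_mono) auto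
      then show ?thesis using tot by simp
    qed
    have "\<exists>w. \<rho> u w \<le> ennreal (T i - s) \<and> norm (w - x (T i)) \<le> E i" if "i \<le> m" for i
      using that
    proof (induction i)
      case 0
      show ?case using \<rho>_refl T by (intro exI[of _ u]) (simp add: E_def)
    next
      case (Suc i)
      then obtain w where w: "\<rho> u w \<le> ennreal (T i - s)" "norm (w - x (T i)) \<le> E i" by auto
      define h where "h = T (Suc i) - T i"
      have i: "i < m" and h: "0 \<le> h" using Suc.prems T(3)[of i] by (auto simp: h_def)
      have Ts: "s \<le> T i" using Tst[of i] i by auto
      have E0: "0 \<le> E i" using w(2) norm_ge_zero order_trans by blast
      have "E (Suc i) = exp (L * (T i - s)) * exp (L * h) * (norm (u - x s) + (\<Sum>j<i. \<beta> j)) + exp (L * (T (Suc i) - s)) * \<beta> i"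
        by (simp add: E_def h_def algebra_simps flip: exp_add)
      moreover have "1 * \<beta> i \<le> exp (L * (T (Suc i) - s)) * \<beta> i"
        using L Tst[of "Suc i"] Suc.prems \<beta>0[OF i] by (intro mult_right_mono) auto
      ultimately have ES: "exp (L * h) * E i + \<beta> i \<le> E (Suc i)" by (simp add: E_def mult_ac)
      have eh: "1 + L * h \<le> exp (L * h)" by (rule exp_ge_add_one_self)
      show ?case
      proof (cases "i \<in> B")
        case True
        have "norm (w - x (T (Suc i))) \<le> norm (w - x (T i)) + norm (x (T (Suc i)) - x (T i))"
          using norm_triangle_ineq4[of "w - x (T i)" "x (T (Suc i)) - x (T i)"] by simp
        also have "\<dots> \<le> exp (L * h) * E i + \<beta> i"
        proof (rule add_mono)
          have "1 * E i \<le> exp (L * h) * E i" using L h E0 by (intro mult_right_mono) auto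
          then show "norm (w - x (T i)) \<le> exp (L * h) * E i" using w by simp
        qed (use True in \<open>simp add: \<beta>_def\<close>)
        finally have "norm (w - x (T (Suc i))) \<le> E (Suc i)" using ES by linarith
        moreover have "\<rho> u w \<le> ennreal (T (Suc i) - s)"
          using w(1) h by (elim order_trans) (auto simp: h_def intro!: ennreal_leI)
        ultimately show ?thesis by blast
      next
        case False
        then have "good (T i) (T (Suc i))" using i by (simp add: B_def)
        moreover have "norm (w - x (T i)) \<le> \<eta>'" using w(2) E\<eta>[of i] i by simp
        ultimately obtain w' where w': "\<rho> w w' \<le> ennreal h"
          "norm (w' - x (T (Suc i))) \<le> (1 + L * h) * norm (w - x (T i)) + (2 * L + 2) * \<epsilon> * h"
          unfolding good_def h_def by blast
        have "(1 + L * h) * norm (w - x (T i)) \<le> exp (L * h) * E i"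
          using eh w(2) by (intro mult_mono) auto
        then have "norm (w' - x (T (Suc i))) \<le> E (Suc i)"
          using w'(2) ES False by (simp add: \<beta>_def h_def)
        moreover have "\<rho> u w' \<le> ennreal (T i - s) + ennreal h"
          using \<rho>_triangle[of u w' w] add_mono[OF w(1) w'(1)] by (rule order_trans)
        then have "\<rho> u w' \<le> ennreal (T (Suc i) - s)"
          using h Ts by (simp add: h_def flip: ennreal_plus)
        ultimately show ?thesis by blast
      qed
    qed
    from this[of m] obtain w where w: "\<rho> u w \<le> ennreal (t - s)" "norm (w - x t) \<le> E m"
      using T by auto
    have "norm (w - x t) \<le> \<eta>'" using w(2) E\<eta>[of m] by simp
    moreover have "norm w \<le> norm (x t) + norm (w - x t)" by (metis norm_triangle_sub)
    ultimately have "norm w < 1" "norm (w - x t) < \<eta>" using xr[of t] st \<eta>' by auto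
    then show "\<exists>w. norm w < 1 \<and> norm (w - x t) < \<eta> \<and> \<rho> u w \<le> ennreal (t - s)" using w by blast
  qed
qed

section \<open>Tangent vectors and velocities in charts\<close>

locale manifold =
  fixes S :: "('m::t2_space, 'e::euclidean_space) chart set"
  assumes smooth_manifold: "smooth_manifold S"
begin

lemma chart:
  assumes "c \<in> S"
  shows open_chart_domain: "open (fst c)"
    and open_chart_image: "open (chart_image c)"
    and continuous_on_chart: "continuous_on (fst c) (snd c)"
    and continuous_on_chart_inv: "continuous_on (chart_image c) (chart_inv c)"
    and chart_inv_chart: "x \<in> fst c \<Longrightarrow> chart_inv c (snd c x) = x"
    and chart_chart_inv: "u \<in> chart_image c \<Longrightarrow> snd c (chart_inv c u) = u"
    and chart_inv_in: "u \<in> chart_image c \<Longrightarrow> chart_inv c u \<in> fst c"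
proof -
  have "is_chart c" using smooth_manifold assms by (simp add: smooth_manifold_def)
  then have "open (fst c)" "open (chart_image c)"
    and h: "homeomorphism (fst c) (chart_image c) (snd c) (chart_inv c)"
    by (auto simp: is_chart_def)
  then show "open (fst c)" "open (chart_image c)" by blast+
  show "continuous_on (fst c) (snd c)" "continuous_on (chart_image c) (chart_inv c)"
    "x \<in> fst c \<Longrightarrow> chart_inv c (snd c x) = x"
    "u \<in> chart_image c \<Longrightarrow> snd c (chart_inv c u) = u"
    "u \<in> chart_image c \<Longrightarrow> chart_inv c u \<in> fst c"
    using h by (auto simp: homeomorphism_def)
qed

lemma chart_image_Int:
  assumes "c \<in> S" shows "snd c ` (fst c \<inter> W) = chart_image c \<inter> chart_inv c -` W"
  using chart_inv_chart[OF assms] chart_chart_inv[OF assms] chart_inv_in[OF assms]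
  by (force simp: chart_image_def)

lemma open_chart_image_Int:
  assumes "c \<in> S" "open W" shows "open (snd c ` (fst c \<inter> W))"
  unfolding chart_image_Int[OF assms(1)]
  by (rule continuous_open_preimage) (use assms chart in auto)

lemma open_chart_inv_image:
  assumes "c \<in> S" "open U" "U \<subseteq> chart_image c" shows "open (chart_inv c ` U)"
proof -
  have "chart_inv c ` U = fst c \<inter> snd c -` U"
    using chart_inv_chart[OF assms(1)] chart_chart_inv[OF assms(1)] chart_inv_in[OF assms(1)] assms(3)
    by force
  then show ?thesis
    using continuous_open_preimage[OF continuous_on_chart[OF assms(1)] open_chart_domain[OF assms(1)] assms(2)]
    by simp
qed

lemma transition_smooth:
  assumes "c \<in> S" "d \<in> S"
  shows "smooth_on (snd c ` (fst c \<inter> fst d)) (snd d \<circ> chart_inv c)"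
  using smooth_manifold assms by (auto simp: smooth_manifold_def smoothly_compatible_def)

definition transition_deriv :: "('m, 'e) chart \<Rightarrow> ('m, 'e) chart \<Rightarrow> 'm \<Rightarrow> 'e \<Rightarrow> 'e" where
  "transition_deriv c d x = frechet_derivative (snd d \<circ> chart_inv c) (at (snd c x))"

lemma transition_has_derivative:
  assumes "c \<in> charts_at S x" "d \<in> charts_at S x"
  shows "((snd d \<circ> chart_inv c) has_derivative transition_deriv c d x) (at (snd c x))"
  using assms smooth_on_imp_differentiable[OF transition_smooth[of c d], of "snd c x"]
  by (auto simp: transition_deriv_def charts_at_def frechet_derivative_works)

lemma transition_deriv_self:
  assumes "c \<in> charts_at S x" shows "transition_deriv c c x w = w"
proof -
  have c: "c \<in> S" "x \<in> fst c" using assms by (auto simp: charts_at_def)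
  have "((\<lambda>u. u) has_derivative transition_deriv c c x) (at (snd c x))"
    by (rule has_derivative_transform_within_open[OF transition_has_derivative[OF assms assms]
          open_chart_image[OF c(1)]])
      (use c chart_chart_inv[OF c(1)] in \<open>auto simp: chart_image_def\<close>)
  then show ?thesis using has_derivative_unique has_derivative_ident by metis
qed

text \<open>The cocycle identity, by the chain rule on the overlap of the domains. It ensures that a
  vector prescribed in one chart has compatible representations in all others.\<close>

lemma transition_deriv_comp:
  assumes "c \<in> charts_at S x" "d \<in> charts_at S x" "e \<in> charts_at S x"
  shows "transition_deriv d e x (transition_deriv c d x w) = transition_deriv c e x w"
proof -
  have m: "c \<in> S" "x \<in> fst c" "d \<in> S" "x \<in> fst d" "e \<in> S" "x \<in> fst e"
    using assms by (auto simp: charts_at_def)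
  have x: "(snd d \<circ> chart_inv c) (snd c x) = snd d x" using m chart_inv_chart by simp
  have "((snd e \<circ> chart_inv d) \<circ> (snd d \<circ> chart_inv c) has_derivative
      transition_deriv d e x \<circ> transition_deriv c d x) (at (snd c x))"
    using diff_chain_at[OF transition_has_derivative[OF assms(1,2)]] transition_has_derivative[OF assms(2,3)] x
    by simp
  then have "((snd e \<circ> chart_inv c) has_derivative transition_deriv d e x \<circ> transition_deriv c d x) (at (snd c x))"
    by (rule has_derivative_transform_within_open[OF _ open_chart_image_Int[OF m(1) open_chart_domain[OF m(3)]]])
      (use m chart_inv_chart in \<open>auto simp: chart_inv_chart\<close>)
  then have "transition_deriv d e x \<circ> transition_deriv c d x = transition_deriv c e x"
    using has_derivative_unique transition_has_derivative[OF assms(1,3)] by blast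
  then show ?thesis by (metis comp_apply)
qed

lemma tangent_space_iff:
  "v \<in> tangent_space S x \<longleftrightarrow>
     (\<forall>c\<in>charts_at S x. \<forall>d\<in>charts_at S x. v d = transition_deriv c d x (v c)) \<and>
     (\<forall>c. c \<notin> charts_at S x \<longrightarrow> v c = 0)"
  by (simp add: tangent_space_def transition_deriv_def)

lemma tangent_vector_transition:
  "v \<in> tangent_space S x \<Longrightarrow> c \<in> charts_at S x \<Longrightarrow> d \<in> charts_at S x \<Longrightarrow>
    v d = transition_deriv c d x (v c)"
  using tangent_space_iff by blast

lemma tangent_vector_outside: "v \<in> tangent_space S x \<Longrightarrow> c \<notin> charts_at S x \<Longrightarrow> v c = 0"
  using tangent_space_iff by blast

text \<open>The inverse of the coordinate isomorphism that takes a tangent vector \<open>v\<close>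
  to \<open>v c\<close>.\<close>

definition tangent_lift :: "('m, 'e) chart \<Rightarrow> 'm \<Rightarrow> 'e \<Rightarrow> ('m, 'e) tangent_vector" where
  "tangent_lift c x w = (\<lambda>d. if d \<in> charts_at S x then transition_deriv c d x w else 0)"

lemma tangent_lift_in:
  "c \<in> charts_at S x \<Longrightarrow> tangent_lift c x w \<in> tangent_space S x"
  by (simp add: tangent_space_iff tangent_lift_def transition_deriv_comp)

lemma tangent_lift_self:
  "c \<in> charts_at S x \<Longrightarrow> tangent_lift c x w c = w"
  by (simp add: tangent_lift_def transition_deriv_self)

lemma tangent_lift_eq:
  "c \<in> charts_at S x \<Longrightarrow> v \<in> tangent_space S x \<Longrightarrow> tangent_lift c x (v c) = v"
  by (rule ext) (simp add: tangent_lift_def tangent_vector_transition[symmetric] tangent_vector_outside)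

lemma linear_transition_deriv:
  "c \<in> charts_at S x \<Longrightarrow> d \<in> charts_at S x \<Longrightarrow> linear (transition_deriv c d x)"
  using has_derivative_linear transition_has_derivative by blast

lemma tangent_space_scaleR:
  "v \<in> tangent_space S x \<Longrightarrow> (\<lambda>c. r *\<^sub>R v c) \<in> tangent_space S x"
  unfolding tangent_space_iff
  by (metis (no_types, lifting) linear_scale[OF linear_transition_deriv] scaleR_zero_right)

lemma tangent_space_zero: "(\<lambda>c. 0) \<in> tangent_space S x"
  unfolding tangent_space_iff by (auto simp: linear_0[OF linear_transition_deriv])

lemma dual_norm_scaleR_le:
  assumes "v \<in> tangent_space S x" "dual_norm S P x v \<le> 1" "\<bar>r\<bar> \<le> 1"
  shows "dual_norm S P x (\<lambda>c. r *\<^sub>R v c) \<le> 1"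
  unfolding dual_norm_def
proof (rule SUP_least)
  fix \<xi> assume \<xi>: "\<xi> \<in> {\<xi> \<in> cotangent_space S x. P (x, \<xi>) \<le> 1}"
  have "ennreal \<bar>\<xi> v\<bar> \<le> 1"
    using assms(2) SUP_upper[OF \<xi>, of "\<lambda>\<xi>. ennreal \<bar>\<xi> v\<bar>"] unfolding dual_norm_def by order
  then have "\<bar>\<xi> v\<bar> \<le> 1" by simp
  moreover have "\<xi> (\<lambda>c. r *\<^sub>R v c) = r * \<xi> v" using \<xi> assms(1) by (auto simp: cotangent_space_def)
  ultimately show "ennreal \<bar>\<xi> (\<lambda>c. r *\<^sub>R v c)\<bar> \<le> 1"
    using assms(3) by (auto simp: abs_mult intro: mult_le_one)
qed

lemma dual_norm_zero: "dual_norm S P x (\<lambda>c. 0) \<le> 1"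
  unfolding dual_norm_def
proof (rule SUP_least)
  fix \<xi> assume \<xi>: "\<xi> \<in> {\<xi> \<in> cotangent_space S x. P (x, \<xi>) \<le> 1}"
  then have "\<forall>r. \<xi> (\<lambda>c. r *\<^sub>R 0) = r * \<xi> (\<lambda>c. 0)"
    using tangent_space_zero[of x] unfolding cotangent_space_def by fastforce
  from this[rule_format, of 0] show "ennreal \<bar>\<xi> (\<lambda>c. 0)\<bar> \<le> 1" by simp
qed

text \<open>One chart suffices: in any other chart the derivative follows from the chain rule for
  the transition map. Continuity of the curve is what keeps it in the domain of \<open>c\<close> for
  nearby times, so that passing through \<open>c\<close> does not change it there.\<close>

lemma has_velocityI:
  assumes c: "c \<in> charts_at S (\<gamma> t)" and t: "t \<in> I" and v: "v \<in> tangent_space S (\<gamma> t)"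
    and cont: "continuous (at t within I) \<gamma>"
    and d: "((snd c \<circ> \<gamma>) has_vector_derivative v c) (at t within I)"
  shows "has_velocity S \<gamma> v t I"
  unfolding has_velocity_def
proof (intro conjI v cont ballI)
  fix d assume d': "d \<in> charts_at S (\<gamma> t)"
  have m: "c \<in> S" "\<gamma> t \<in> fst c" "d \<in> S" "\<gamma> t \<in> fst d"
    using c d' by (auto simp: charts_at_def)
  have "(((snd d \<circ> chart_inv c) \<circ> (snd c \<circ> \<gamma>)) has_derivative
      (transition_deriv c d (\<gamma> t) \<circ> (\<lambda>s. s *\<^sub>R v c))) (at t within I)"
    by (rule diff_chain_within[OF d[unfolded has_vector_derivative_def]])
      (use has_derivative_at_withinI[OF transition_has_derivative[OF c d']] in simp)
  moreover have "transition_deriv c d (\<gamma> t) \<circ> (\<lambda>s. s *\<^sub>R v c) = (\<lambda>s. s *\<^sub>R v d)"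
    using tangent_vector_transition[OF v c d'] by (auto simp: linear_scale[OF linear_transition_deriv[OF c d']])
  ultimately have "(((snd d \<circ> chart_inv c) \<circ> (snd c \<circ> \<gamma>)) has_derivative (\<lambda>s. s *\<^sub>R v d)) (at t within I)"
    by simp
  then show "((snd d \<circ> \<gamma>) has_vector_derivative v d) (at t within I)"
    unfolding has_vector_derivative_def
  proof (rule has_derivative_transform_eventually)
    have "eventually (\<lambda>s. \<gamma> s \<in> fst c) (at t within I)"
      by (rule topological_tendstoD[OF cont[unfolded continuous_within]])
        (use m open_chart_domain in auto)
    then show "\<forall>\<^sub>F s in at t within I. (snd d \<circ> chart_inv c \<circ> (snd c \<circ> \<gamma>)) s = (snd d \<circ> \<gamma>) s"
      by eventually_elim (simp add: chart_inv_chart[OF m(1)])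
  qed (use m t chart_inv_chart in auto)
qed

lemma has_velocity_cong:
  assumes "has_velocity S \<gamma> v t I" "t \<in> I" "\<And>s. s \<in> I \<Longrightarrow> \<gamma> s = \<beta> s"
  shows "has_velocity S \<beta> v t I"
proof -
  have "continuous (at t within I) \<beta>"
    using assms unfolding has_velocity_def continuous_within
    by (metis (mono_tags, lifting) Lim_cong_within)
  moreover have "((snd c \<circ> \<beta>) has_vector_derivative v c) (at t within I)"
    if "c \<in> charts_at S (\<gamma> t)" for c
    by (rule has_vector_derivative_transform[of t I _ "snd c \<circ> \<gamma>"])
      (use assms that in \<open>auto simp: has_velocity_def\<close>)
  ultimately show ?thesis using assms by (auto simp: has_velocity_def)
qed

lemma has_velocity_subset:
  assumes "has_velocity S \<gamma> v t I" "J \<subseteq> I"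
  shows "has_velocity S \<gamma> v t J"
  using assms unfolding has_velocity_def
  by (auto intro: continuous_within_subset has_vector_derivative_within_subset)

lemma has_velocity_reparam:
  assumes v: "has_velocity S \<gamma> v (\<theta> t) I" and "t \<in> J" "\<theta> ` J \<subseteq> I"
    and \<theta>: "(\<theta> has_real_derivative r) (at t within J)"
  shows "has_velocity S (\<lambda>t. \<gamma> (\<theta> t)) (\<lambda>c. r *\<^sub>R v c) t J"
proof -
  have cont: "continuous (at t within J) \<theta>"
    using \<theta> DERIV_continuous by blast
  have "continuous (at t within J) (\<gamma> \<circ> \<theta>)"
    by (rule continuous_within_compose[OF cont])
      (use v assms(3) in \<open>auto simp: has_velocity_def intro: continuous_within_subset\<close>)
  moreover have "((snd c \<circ> (\<lambda>t. \<gamma> (\<theta> t))) has_vector_derivative r *\<^sub>R v c) (at t within J)"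
    if "c \<in> charts_at S (\<gamma> (\<theta> t))" for c
  proof -
    have "((snd c \<circ> \<gamma>) has_vector_derivative v c) (at (\<theta> t) within \<theta> ` J)"
      using v that assms(3) has_vector_derivative_within_subset unfolding has_velocity_def by blast
    then have "(((snd c \<circ> \<gamma>) \<circ> \<theta>) has_vector_derivative r *\<^sub>R v c) (at t within J)"
      using vector_diff_chain_within \<theta> has_real_derivative_iff_has_vector_derivative by blast
    then show ?thesis by (simp add: o_def)
  qed
  ultimately show ?thesis
    using v tangent_space_scaleR by (auto simp: has_velocity_def o_def)
qed

end

section \<open>Flow curves\<close>

text \<open>Abstracts the triangle inequality of distances defined by infima of times. The slack
  \<open>e\<close> allows for concatenations that cost extra time, as for smooth curves.\<close>

lemma Inf_ennreal_triangle:
  fixes A B C :: "ennreal set"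
  assumes "\<And>b c e. b \<in> B \<Longrightarrow> c \<in> C \<Longrightarrow> 0 < e \<Longrightarrow> \<exists>a\<in>A. a \<le> b + c + ennreal e"
  shows "Inf A \<le> Inf B + Inf C"
proof (rule ennreal_le_epsilon)
  fix e :: real assume fin: "Inf B + Inf C < top" and e: "0 < e"
  have "Inf B < top" "Inf C < top" using fin by simp_all
  have less: "a < a + ennreal (e/3)" if "a < top" for a using that e by simp
  have "Inf B < Inf B + ennreal (e/3)" "Inf C < Inf C + ennreal (e/3)"
    by (rule less; fact)+
  then obtain b c where bc: "b \<in> B" "b < Inf B + ennreal (e/3)" "c \<in> C" "c < Inf C + ennreal (e/3)"
    unfolding Inf_less_iff by blast
  obtain a where "a \<in> A" "a \<le> b + c + ennreal (e/3)"
    using assms[OF bc(1,3), of "e/3"] e by auto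
  then have "Inf A \<le> b + c + ennreal (e/3)" by (meson Inf_lower order_trans)
  also have "\<dots> \<le> (Inf B + ennreal (e/3)) + (Inf C + ennreal (e/3)) + ennreal (e/3)"
    using bc by (intro add_mono) auto
  also have "\<dots> = Inf B + Inf C + (ennreal (e/3) + ennreal (e/3) + ennreal (e/3))"
    by (simp add: ac_simps)
  also have "ennreal (e/3) + ennreal (e/3) + ennreal (e/3) = ennreal e"
    using e by (simp flip: ennreal_plus)
  finally show "Inf A \<le> Inf B + Inf C + ennreal e" .
qed

context manifold
begin

section \<open>Subunit fields on the whole manifold\<close>

definition cutoff_field ::
    "('m, 'e) chart \<Rightarrow> ('m \<Rightarrow> ('m, 'e) tangent_vector) \<Rightarrow> 'm \<Rightarrow> ('m, 'e) tangent_vector" where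
  "cutoff_field c X x = (\<lambda>d. if x \<in> fst c then bump (snd c x) *\<^sub>R X x d else 0)"

text \<open>Since the chart maps onto the whole space, the coordinate ball of radius 2 gives a
  compact set, which is closed because the manifold is Hausdorff. Its complement is thus an open set
  on which the field vanishes and which contains all points outside the chart. Factors between 0 and
  1 preserve the subunit bound.\<close>

lemma subunit_cutoff_field:
  assumes c: "c \<in> S" "chart_image c = UNIV" and X: "subunit_field S P (fst c) X"
  shows "subunit_field S P UNIV (cutoff_field c X)"
proof -
  have Xt: "X x \<in> tangent_space S x" "dual_norm S P x (X x) \<le> 1" if "x \<in> fst c" for x
    using X that by (auto simp: subunit_field_def smooth_vector_field_def)
  have in_ts: "cutoff_field c X x \<in> tangent_space S x" for x
    using tangent_space_scaleR[OF Xt(1)] tangent_space_zero by (cases "x \<in> fst c") (auto simp: cutoff_field_def)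
  have unit: "dual_norm S P x (cutoff_field c X x) \<le> 1" for x
  proof (cases "x \<in> fst c")
    case True
    then show ?thesis
      using dual_norm_scaleR_le[OF Xt[OF True], of "bump (snd c x)"] bump_bounds[of "snd c x"]
      by (simp add: cutoff_field_def)
  qed (simp add: cutoff_field_def dual_norm_zero)
  let ?K = "chart_inv c ` cball 0 2"
  have "compact ?K"
    by (rule compact_continuous_image[OF continuous_on_subset[OF continuous_on_chart_inv[OF c(1)]]])
      (use c in auto)
  then have K: "closed ?K" by (rule compact_imp_closed)
  have "smooth_on (snd d ` (fst d \<inter> UNIV)) (\<lambda>u. cutoff_field c X (chart_inv d u) d)" if d: "d \<in> S" for d
  proof (rule smooth_on_local)
    fix u assume "u \<in> snd d ` (fst d \<inter> UNIV)"
    then obtain x where x: "x \<in> fst d" "u = snd d x" by auto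
    let ?W = "snd d ` (fst d \<inter> UNIV)"
    show "\<exists>N. open N \<and> u \<in> N \<and> smooth_on (?W \<inter> N) (\<lambda>u. cutoff_field c X (chart_inv d u) d)"
    proof (cases "x \<in> fst c")
      case True
      let ?N = "snd d ` (fst d \<inter> fst c)"
      have N: "open ?N" by (rule open_chart_image_Int[OF d open_chart_domain[OF c(1)]])
      have "smooth_on ?N (\<lambda>u. bump ((snd c \<circ> chart_inv d) u))"
        by (rule smooth_on_compose[OF N transition_smooth[OF d c(1)] smooth_bump]) auto
      moreover have "smooth_on ?N (\<lambda>u. X (chart_inv d u) d)"
        using X d by (auto simp: subunit_field_def smooth_vector_field_def)
      ultimately have "smooth_on ?N (\<lambda>u. bump ((snd c \<circ> chart_inv d) u) *\<^sub>R X (chart_inv d u) d)"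
        by (rule smooth_on_scaleR[OF N])
      then have "smooth_on ?N (\<lambda>u. cutoff_field c X (chart_inv d u) d)"
        by (rule smooth_on_cong[OF N, rotated]) (auto simp: cutoff_field_def chart_inv_chart[OF d])
      then have "smooth_on (?W \<inter> ?N) (\<lambda>u. cutoff_field c X (chart_inv d u) d)"
        by (rule smooth_on_subset) auto
      then show ?thesis using N x True by blast
    next
      case False
      let ?N = "snd d ` (fst d \<inter> (- ?K))"
      have N: "open ?N" by (rule open_chart_image_Int[OF d]) (use K in auto)
      have xK: "x \<notin> ?K" using False chart_inv_in[OF c(1)] c(2) by auto
      have "cutoff_field c X y d = 0" if "y \<notin> ?K" for y
      proof (cases "y \<in> fst c")
        case True
        then have "snd c y \<notin> cball 0 2"
          using that chart_inv_chart[OF c(1) True] by (metis imageI)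
        then show ?thesis by (simp add: cutoff_field_def bump_eq_0)
      qed (simp add: cutoff_field_def)
      then have "smooth_on ?N (\<lambda>u. cutoff_field c X (chart_inv d u) d)"
        by (intro smooth_on_cong[OF N _ smooth_on_const[OF N, of 0]]) (auto simp: chart_inv_chart[OF d])
      then have "smooth_on (?W \<inter> ?N) (\<lambda>u. cutoff_field c X (chart_inv d u) d)"
        by (rule smooth_on_subset) auto
      then show ?thesis using N x xK by blast
    qed
  qed
  then show ?thesis
    using in_ts unit by (auto simp: subunit_field_def smooth_vector_field_def)
qed

lemma subunit_field_uminus:
  assumes "subunit_field S P UNIV X"
  shows "subunit_field S P UNIV (\<lambda>x c. (-1) *\<^sub>R X x c)"
  unfolding subunit_field_def smooth_vector_field_def
proof (intro conjI ballI)
  fix x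
  have X: "X x \<in> tangent_space S x" "dual_norm S P x (X x) \<le> 1"
    using assms by (auto simp: subunit_field_def smooth_vector_field_def)
  show "(\<lambda>c. (-1) *\<^sub>R X x c) \<in> tangent_space S x" by (rule tangent_space_scaleR[OF X(1)])
  show "dual_norm S P x (\<lambda>c. (-1) *\<^sub>R X x c) \<le> 1" by (rule dual_norm_scaleR_le[OF X]) simp
next
  fix d assume d: "d \<in> S"
  have o: "open (snd d ` (fst d \<inter> UNIV))" by (rule open_chart_image_Int[OF d]) simp
  show "smooth_on (snd d ` (fst d \<inter> UNIV)) (\<lambda>u. (-1) *\<^sub>R X (chart_inv d u) d)"
    by (rule smooth_on_scaleR[OF o smooth_on_const[OF o]])
      (use assms d in \<open>auto simp: subunit_field_def smooth_vector_field_def\<close>)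
qed

lemma subunit_field_zero: "subunit_field S P UNIV (\<lambda>x c. 0)"
  unfolding subunit_field_def smooth_vector_field_def
proof (intro conjI ballI)
  fix d assume d: "d \<in> S"
  show "smooth_on (snd d ` (fst d \<inter> UNIV)) (\<lambda>u. 0)"
    by (intro smooth_on_const open_chart_image_Int[OF d]) simp
qed (simp_all add: tangent_space_zero dual_norm_zero)

section \<open>Chains of flow steps in place of piecewise flow curves\<close>

definition flow_step :: "('m \<times> ('m, 'e) covector \<Rightarrow> real) \<Rightarrow> real \<Rightarrow> 'm \<Rightarrow> 'm \<Rightarrow> bool" where
  "flow_step P h x y \<longleftrightarrow> 0 < h \<and> (\<exists>X a \<gamma>. subunit_field S P UNIV X \<and>
     flow_curve S X a (a + h) \<gamma> \<and> \<gamma> a = x \<and> \<gamma> (a + h) = y)"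

inductive flow_chain :: "('m \<times> ('m, 'e) covector \<Rightarrow> real) \<Rightarrow> real \<Rightarrow> 'm \<Rightarrow> 'm \<Rightarrow> bool" for P where
  refl: "flow_chain P 0 x x"
| step: "flow_chain P T x y \<Longrightarrow> flow_step P h y z \<Longrightarrow> flow_chain P (T + h) x z"

lemma flow_step_const: "0 < h \<Longrightarrow> flow_step P h x x"
  unfolding flow_step_def
  by (intro conjI exI[of _ "\<lambda>x c. 0"] exI[of _ 0] exI[of _ "\<lambda>t. x"] subunit_field_zero)
    (auto simp: flow_curve_def has_velocity_def tangent_space_zero o_def)

text \<open>Running time backwards gives a flow curve of the negated field, which is again subunit
  because the dual norm is even.\<close>

lemma flow_step_sym:
  assumes "flow_step P h x y" shows "flow_step P h y x"
proof -
  obtain X a \<gamma> where h: "0 < h" and X: "subunit_field S P UNIV X"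
    and \<gamma>: "flow_curve S X a (a + h) \<gamma>" "\<gamma> a = x" "\<gamma> (a + h) = y"
    using assms by (auto simp: flow_step_def)
  let ?\<theta> = "\<lambda>t. a + h - t"
  have "has_velocity S (\<lambda>t. \<gamma> (?\<theta> t)) (\<lambda>c. (-1) *\<^sub>R X (\<gamma> (?\<theta> t)) c) t {0..0+h}"
    if "t \<in> {0..0+h}" for t
    by (rule has_velocity_reparam[where I="{a..a+h}"])
      (use that \<gamma> in \<open>auto simp: flow_curve_def intro!: derivative_eq_intros\<close>)
  then have "flow_curve S (\<lambda>x c. (-1) *\<^sub>R X x c) 0 (0 + h) (\<lambda>t. \<gamma> (?\<theta> t))"
    by (simp add: flow_curve_def)
  then show ?thesis unfolding flow_step_def using h subunit_field_uminus[OF X] \<gamma>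
    by (intro conjI exI[of _ "\<lambda>x c. (-1) *\<^sub>R X x c"] exI[of _ 0] exI[of _ "\<lambda>t. \<gamma> (?\<theta> t)"]) auto
qed

lemma flow_chain_nonneg: "flow_chain P T x y \<Longrightarrow> 0 \<le> T"
  by (induction rule: flow_chain.induct) (auto simp: flow_step_def)

lemma flow_chain_trans: "flow_chain P T' y z \<Longrightarrow> flow_chain P T x y \<Longrightarrow> flow_chain P (T + T') x z"
proof (induction rule: flow_chain.induct)
  case (step T' y z h w)
  then have "flow_chain P (T + T' + h) x w" by (blast intro: flow_chain.step)
  then show ?case by (simp add: add.assoc)
qed simp

lemma flow_step_imp_chain: "flow_step P h x y \<Longrightarrow> flow_chain P h x y"
  using flow_chain.step[OF flow_chain.refl, of P h x y] by simp

lemma flow_chain_sym: "flow_chain P T x y \<Longrightarrow> flow_chain P T y x"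
proof (induction rule: flow_chain.induct)
  case (step T x y h z)
  show ?case
    using flow_chain_trans[OF step.IH flow_step_imp_chain[OF flow_step_sym[OF step.hyps(2)]]]
    by (simp add: add.commute)
qed (rule flow_chain.refl)

lemma piecewise_flow_imp_chain:
  assumes "subunit_piecewise_flow_curve S P a b \<gamma>"
  shows "flow_chain P (b - a) (\<gamma> a) (\<gamma> b)"
proof -
  obtain m s where s: "s 0 = a" "s m = b" and
    st: "\<And>i. i < m \<Longrightarrow> s i < s (Suc i) \<and>
      (\<exists>X. subunit_field S P UNIV X \<and> flow_curve S X (s i) (s (Suc i)) \<gamma>)"
    using assms unfolding subunit_piecewise_flow_curve_def by blast
  have "flow_chain P (s i - a) (\<gamma> a) (\<gamma> (s i))" if "i \<le> m" for i
    using that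
  proof (induction i)
    case 0 then show ?case using s flow_chain.refl by simp
  next
    case (Suc i)
    obtain X where X: "s i < s (Suc i)" "subunit_field S P UNIV X" "flow_curve S X (s i) (s (Suc i)) \<gamma>"
      using st[of i] Suc.prems by auto
    then have "flow_step P (s (Suc i) - s i) (\<gamma> (s i)) (\<gamma> (s (Suc i)))"
      unfolding flow_step_def by (intro conjI exI[of _ X] exI[of _ "s i"] exI[of _ \<gamma>]) auto
    from flow_chain.step[OF _ this, of "s i - a"] show ?case using Suc by simp
  qed
  from this[of m] s show ?thesis by simp
qed

text \<open>The velocity of each piece is taken within its own subinterval, hence one-sided at the
  break points. Gluing therefore only requires that the end points match; at time \<open>T\<close>
  both branches give \<open>y\<close>.\<close>

lemma flow_chain_imp_piecewise:
  "flow_chain P T x y \<Longrightarrow> \<exists>\<gamma>. subunit_piecewise_flow_curve S P 0 T \<gamma> \<and> \<gamma> 0 = x \<and> \<gamma> T = y"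
proof (induction rule: flow_chain.induct)
  case (refl x)
  show ?case unfolding subunit_piecewise_flow_curve_def
    by (intro exI[of _ "\<lambda>t. x"] conjI exI[of _ 0] exI[of _ "\<lambda>i. 0"]) auto
next
  case (step T x y h z)
  obtain \<gamma> where \<gamma>: "subunit_piecewise_flow_curve S P 0 T \<gamma>" "\<gamma> 0 = x" "\<gamma> T = y"
    using step.IH by blast
  obtain m s where s: "s 0 = 0" "s m = T" and
    st: "\<And>i. i < m \<Longrightarrow> s i < s (Suc i) \<and>
      (\<exists>X. subunit_field S P UNIV X \<and> flow_curve S X (s i) (s (Suc i)) \<gamma>)"
    using \<gamma>(1) unfolding subunit_piecewise_flow_curve_def by blast
  obtain X a \<delta> where h: "0 < h" and X: "subunit_field S P UNIV X"
    and \<delta>: "flow_curve S X a (a + h) \<delta>" "\<delta> a = y" "\<delta> (a + h) = z"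
    using step.hyps(2) by (auto simp: flow_step_def)
  let ?\<beta> = "\<lambda>t. if t \<le> T then \<gamma> t else \<delta> (a - T + t)"
  let ?s = "s(Suc m := T + h)"
  have le: "s i \<le> T" if "i \<le> m" for i
    using that
  proof (induction rule: inc_induct)
    case (step n)
    then show ?case using st[of n] by simp
  qed (use s in simp)
  have "?s i < ?s (Suc i) \<and> (\<exists>X. subunit_field S P UNIV X \<and> flow_curve S X (?s i) (?s (Suc i)) ?\<beta>)"
    if i: "i < Suc m" for i
  proof (cases "i = m")
    case False
    then have im: "i < m" using i by simp
    obtain Y where Y: "s i < s (Suc i)" "subunit_field S P UNIV Y" "flow_curve S Y (s i) (s (Suc i)) \<gamma>"
      using st[OF im] by blast
    have "has_velocity S ?\<beta> (Y (?\<beta> t)) t {s i..s (Suc i)}" if t: "t \<in> {s i..s (Suc i)}" for t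
    proof (rule has_velocity_cong[of \<gamma>])
      show "\<gamma> r = ?\<beta> r" if "r \<in> {s i..s (Suc i)}" for r
        using that le[of "Suc i"] im by auto
      from this[OF t] show "has_velocity S \<gamma> (Y (?\<beta> t)) t {s i..s (Suc i)}"
        using Y t by (auto simp: flow_curve_def)
    qed (rule t)
    then have "flow_curve S Y (s i) (s (Suc i)) ?\<beta>" by (simp add: flow_curve_def)
    then show ?thesis using Y im by auto
  next
    case True
    have eq: "?\<beta> t = \<delta> (a - T + t)" if "t \<ge> T" for t
      using that \<gamma>(3) \<delta>(2) by auto
    have "has_velocity S ?\<beta> (X (?\<beta> t)) t {T..T + h}" if t: "t \<in> {T..T + h}" for t
    proof (rule has_velocity_cong)
      have "has_velocity S (\<lambda>t. \<delta> (a - T + t)) (\<lambda>c. 1 *\<^sub>R X (\<delta> (a - T + t)) c) t {T..T + h}"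
        by (rule has_velocity_reparam[where I="{a..a+h}"])
          (use t \<delta>(1) in \<open>auto simp: flow_curve_def intro!: derivative_eq_intros\<close>)
      then show "has_velocity S (\<lambda>t. \<delta> (a - T + t)) (X (?\<beta> t)) t {T..T + h}"
        unfolding eq[of t, OF atLeastAtMost_iff[THEN iffD1, OF t, THEN conjunct1]] by simp
    qed (use eq t \<gamma>(3) \<delta>(2) in auto)
    then have "flow_curve S X T (T + h) ?\<beta>" by (simp add: flow_curve_def)
    then show ?thesis using X h s True by auto
  qed
  moreover have "0 \<le> T" using le[of 0] s by simp
  ultimately show ?case unfolding subunit_piecewise_flow_curve_def
    using \<gamma> \<delta> h s
    by (intro exI[of _ ?\<beta>] conjI exI[of _ "Suc m"] exI[of _ ?s]) auto
qed

section \<open>The flow distance\<close>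

lemma rho_flow_eq: "rho_flow S P x y = Inf {ennreal T | T. T > 0 \<and> flow_chain P T x y}"
proof -
  have "(\<exists>\<gamma>. subunit_piecewise_flow_curve S P 0 T \<gamma> \<and> \<gamma> 0 = x \<and> \<gamma> T = y) \<longleftrightarrow> flow_chain P T x y" for T
    using flow_chain_imp_piecewise[of P T x y] piecewise_flow_imp_chain[of P 0 T] by auto
  then show ?thesis by (simp add: rho_flow_def distance_of_def)
qed

text \<open>The infimum runs over positive durations, while a chain may have duration 0; resting for
  an arbitrarily short time \<open>e\<close> covers this case.\<close>

lemma rho_flow_le:
  assumes "flow_chain P T x y" shows "rho_flow S P x y \<le> ennreal T"
proof (rule ennreal_le_epsilon)
  fix e :: real assume e: "0 < e"
  have T: "0 \<le> T" using flow_chain_nonneg[OF assms] .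
  have "flow_chain P (T + e) x y" using flow_chain.step[OF assms flow_step_const[OF e]] .
  then have "rho_flow S P x y \<le> ennreal (T + e)"
    unfolding rho_flow_eq using T e by (intro Inf_lower CollectI exI[of _ "T + e"]) auto
  then show "rho_flow S P x y \<le> ennreal T + ennreal e" using T e by simp
qed

lemma rho_flow_refl: "rho_flow S P x x = 0"
  using rho_flow_le[OF flow_chain.refl, of P x] by simp

lemma rho_flow_sym: "rho_flow S P x y = rho_flow S P y x"
  unfolding rho_flow_eq using flow_chain_sym by metis

lemma rho_flow_triangle: "rho_flow S P x z \<le> rho_flow S P x y + rho_flow S P y z"
  unfolding rho_flow_eq
proof (rule Inf_ennreal_triangle)
  fix b c :: ennreal and e :: real
  assume "b \<in> {ennreal T |T. 0 < T \<and> flow_chain P T x y}" "c \<in> {ennreal T |T. 0 < T \<and> flow_chain P T y z}"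
  then obtain T T' where T: "0 < T" "flow_chain P T x y" "b = ennreal T" "0 < T'" "flow_chain P T' y z" "c = ennreal T'"
    by auto
  then have "flow_chain P (T + T') x z" using flow_chain_trans by blast
  then show "\<exists>a\<in>{ennreal T |T. 0 < T \<and> flow_chain P T x z}. a \<le> b + c + ennreal e"
    using T by (intro bexI[of _ "ennreal (T + T')"] CollectI exI[of _ "T + T'"]) auto
qed

text \<open>As long as the coordinate solution stays in the closed unit ball, the cutoff factor is
  1, so the solution is also a flow curve of the globally defined field.\<close>

lemma flow_step_in_chart:
  assumes c: "c \<in> S" "chart_image c = UNIV" and X: "subunit_field S P (fst c) X" and h: "0 < h"
    and z: "\<And>t. t \<in> {0..h} \<Longrightarrow> norm (z t) \<le> 1"
      "\<And>t. t \<in> {0..h} \<Longrightarrow> (z has_vector_derivative X (chart_inv c (z t)) c) (at t within {0..h})"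
  shows "flow_step P h (chart_inv c (z 0)) (chart_inv c (z h))"
proof -
  let ?Y = "cutoff_field c X" and ?\<gamma> = "\<lambda>t. chart_inv c (z t)"
  have "has_velocity S ?\<gamma> (?Y (?\<gamma> t)) t {0..0+h}" if t: "t \<in> {0..0+h}" for t
  proof (rule has_velocityI[where c=c])
    have m: "chart_inv c (z t) \<in> fst c" "snd c (chart_inv c (z t)) = z t" for t
      using chart_inv_in[OF c(1)] chart_chart_inv[OF c(1)] c(2) by auto
    show "c \<in> charts_at S (?\<gamma> t)" using c m by (auto simp: charts_at_def)
    show "?Y (?\<gamma> t) \<in> tangent_space S (?\<gamma> t)"
      using subunit_cutoff_field[OF c X] by (auto simp: subunit_field_def smooth_vector_field_def)
    have "continuous (at t within {0..0+h}) z"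
      using z(2)[of t] t has_vector_derivative_continuous by auto
    moreover have "isCont (chart_inv c) (z t)"
      using continuous_on_chart_inv[OF c(1)] c(2) by (simp add: continuous_on_eq_continuous_at)
    ultimately show "continuous (at t within {0..0+h}) ?\<gamma>"
      using continuous_within_compose3 by fastforce
    have "?Y (?\<gamma> t) c = X (?\<gamma> t) c"
      using m[of t] z(1)[of t] t by (simp add: cutoff_field_def bump_eq_1)
    then show "((snd c \<circ> ?\<gamma>) has_vector_derivative ?Y (?\<gamma> t) c) (at t within {0..0+h})"
      using z(2)[of t] t m(2) by (simp add: o_def)
  qed (rule t)
  then show ?thesis unfolding flow_step_def using h subunit_cutoff_field[OF c X]
    by (intro conjI exI[of _ ?Y] exI[of _ 0] exI[of _ ?\<gamma>]) (auto simp: flow_curve_def)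
qed

end

section \<open>Approximation of subunit curves by flows\<close>

locale lipschitz_seminorm_manifold = manifold S
  for S :: "('m::t2_space, 'e::euclidean_space) chart set" +
  fixes A :: "('m, 'e) chart set" and P :: "'m \<times> ('m, 'e) covector \<Rightarrow> real"
  assumes atlas: "unit_ball_atlas S A" and lipschitz: "lipschitz_seminorm_condition S A P"
begin

lemma atlas_chart: "c \<in> A \<Longrightarrow> c \<in> S" "c \<in> A \<Longrightarrow> chart_image c = UNIV"
  using atlas by (auto simp: unit_ball_atlas_def)

lemma atlas_cover:
  obtains c u where "c \<in> A" "norm u < 1" "x = chart_inv c u"
proof -
  have "x \<in> (\<Union>c\<in>A. chart_inv c ` ball 0 1)" using atlas by (simp add: unit_ball_atlas_def)
  then show ?thesis using that by auto
qed

lemma continuous_tangent_lift: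
  assumes "c \<in> charts_at S x" shows "continuous_on UNIV (tangent_lift c x)"
proof (rule continuous_on_coordinatewise_then_product)
  fix d show "continuous_on UNIV (\<lambda>w. tangent_lift c x w d)"
  proof (cases "d \<in> charts_at S x")
    case True
    have "continuous_on UNIV (transition_deriv c d x)"
      by (rule linear_continuous_on[OF linear_conv_bounded_linear[THEN iffD1]])
        (rule linear_transition_deriv[OF assms True])
    then show ?thesis using True by (simp add: tangent_lift_def)
  qed (simp add: tangent_lift_def)
qed

text \<open>The Lipschitz condition at one chart, with the closure expressed by approximation in the
  coordinates of that chart. Both directions of the equivalence matter: one approximates velocities
  of subunit curves, the other shows that limits of such approximations are subunit.\<close>

definition lipschitz_frame ::
    "('m, 'e) chart \<Rightarrow> ('m \<Rightarrow> ('m, 'e) tangent_vector) set \<Rightarrow> real \<Rightarrow> bool" where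
  "lipschitz_frame c \<X> L \<longleftrightarrow> 0 \<le> L \<and> (\<forall>X\<in>\<X>. subunit_field S P (fst c) X) \<and>
    (\<forall>X\<in>\<X>. \<forall>u w. norm u < 1 \<longrightarrow> norm w < 1 \<longrightarrow>
      norm (X (chart_inv c u) c - X (chart_inv c w) c) \<le> L * norm (u - w)) \<and>
    (\<forall>u v. norm u < 1 \<longrightarrow> v \<in> tangent_space S (chart_inv c u) \<longrightarrow>
      (dual_norm S P (chart_inv c u) v \<le> 1 \<longleftrightarrow>
        (\<forall>\<epsilon>>0. \<exists>X\<in>\<X>. norm (X (chart_inv c u) c - v c) < \<epsilon>)))"

lemma lipschitz_frameD:
  assumes "lipschitz_frame c \<X> L"
  shows "0 \<le> L" and "X \<in> \<X> \<Longrightarrow> subunit_field S P (fst c) X"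
    and "X \<in> \<X> \<Longrightarrow> norm u < 1 \<Longrightarrow> norm w < 1 \<Longrightarrow>
      norm (X (chart_inv c u) c - X (chart_inv c w) c) \<le> L * norm (u - w)"
    and "norm u < 1 \<Longrightarrow> v \<in> tangent_space S (chart_inv c u) \<Longrightarrow>
      dual_norm S P (chart_inv c u) v \<le> 1 \<longleftrightarrow> (\<forall>\<epsilon>>0. \<exists>X\<in>\<X>. norm (X (chart_inv c u) c - v c) < \<epsilon>)"
proof -
  note f = assms[unfolded lipschitz_frame_def]
  show "0 \<le> L" by (rule f[THEN conjunct1])
  show "X \<in> \<X> \<Longrightarrow> subunit_field S P (fst c) X"
    by (rule f[THEN conjunct2, THEN conjunct1, rule_format])
  show "X \<in> \<X> \<Longrightarrow> norm u < 1 \<Longrightarrow> norm w < 1 \<Longrightarrow>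
      norm (X (chart_inv c u) c - X (chart_inv c w) c) \<le> L * norm (u - w)"
    by (rule f[THEN conjunct2, THEN conjunct2, THEN conjunct1, rule_format])
  assume uv: "norm u < 1" "v \<in> tangent_space S (chart_inv c u)"
  show "dual_norm S P (chart_inv c u) v \<le> 1 \<longleftrightarrow> (\<forall>\<epsilon>>0. \<exists>X\<in>\<X>. norm (X (chart_inv c u) c - v c) < \<epsilon>)"
    using f[THEN conjunct2, THEN conjunct2, THEN conjunct2, THEN spec, THEN spec, THEN mp, OF uv(1), THEN mp, OF uv(2)] .
qed

text \<open>Pointwise convergence in all charts reduces to convergence in the chart
  \<open>c\<close>: evaluation at \<open>c\<close> is continuous on the tangent space and
  \<open>tangent_lift c\<close> is its continuous inverse. Passing to the absolute value of
  \<open>L\<close> secures the sign.\<close>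

lemma lipschitz_frame_exists:
  assumes c: "c \<in> A"
  obtains \<X> L where "lipschitz_frame c \<X> L"
proof -
  obtain \<X> L where *: "countable \<X> \<and> (\<forall>X\<in>\<X>. subunit_field S P (fst c) X) \<and>
        (\<forall>X\<in>\<X>. \<forall>u\<in>ball 0 1. \<forall>w\<in>ball 0 1.
           norm (X (chart_inv c u) c - X (chart_inv c w) c) \<le> L * norm (u - w)) \<and>
        (\<forall>x\<in>chart_inv c ` ball 0 1.
           top_of_set (tangent_space S x) closure_of {X x | X. X \<in> \<X>} =
             {v \<in> tangent_space S x. dual_norm S P x v \<le> 1})"
    using bspec[OF lipschitz[unfolded lipschitz_seminorm_condition_def] c]
    by (elim exE) (rule that)
  note X = bspec[OF *[THEN conjunct2, THEN conjunct1]]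
    and L = *[THEN conjunct2, THEN conjunct2, THEN conjunct1, rule_format]
    and cl = bspec[OF *[THEN conjunct2, THEN conjunct2, THEN conjunct2]]
  have "lipschitz_frame c \<X> \<bar>L\<bar>"
    unfolding lipschitz_frame_def
  proof (intro conjI ballI allI impI)
    show "subunit_field S P (fst c) X" if "X \<in> \<X>" for X using X that .
    show "norm (X (chart_inv c u) c - X (chart_inv c w) c) \<le> \<bar>L\<bar> * norm (u - w)"
      if "X \<in> \<X>" "norm u < 1" "norm w < 1" for X u w
    proof -
      have "L * norm (u - w) \<le> \<bar>L\<bar> * norm (u - w)" by (intro mult_right_mono) auto
      then show ?thesis using L[of X u w] that by simp
    qed
  next
    fix u v assume u: "norm u < 1" and v: "v \<in> tangent_space S (chart_inv c u)"
    let ?x = "chart_inv c u" and ?T = "tangent_space S (chart_inv c u)"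
    have x: "c \<in> charts_at S ?x" using atlas_chart[OF c] chart_inv_in by (auto simp: charts_at_def)
    have XT: "X ?x \<in> ?T" if "X \<in> \<X>" for X
      using X[OF that] x by (auto simp: subunit_field_def smooth_vector_field_def charts_at_def)
    have "dual_norm S P ?x v \<le> 1 \<longleftrightarrow> v \<in> top_of_set ?T closure_of {X ?x | X. X \<in> \<X>}"
      using cl[of ?x] u v by auto
    also have "\<dots> \<longleftrightarrow> (\<forall>\<epsilon>>0. \<exists>X\<in>\<X>. norm (X ?x c - v c) < \<epsilon>)"
    proof (intro iffI allI impI)
      fix \<epsilon> :: real assume cl: "v \<in> top_of_set ?T closure_of {X ?x | X. X \<in> \<X>}" and \<epsilon>: "0 < \<epsilon>"
      have "continuous_on ?T (\<lambda>w. w c)"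
        by (rule continuous_on_subset[OF continuous_on_product_coordinates]) simp
      then have o: "openin (top_of_set ?T) (?T \<inter> (\<lambda>w. w c) -` ball (v c) \<epsilon>)"
        by (rule continuous_openin_preimage_gen) simp
      have v': "v \<in> ?T \<inter> (\<lambda>w. w c) -` ball (v c) \<epsilon>"
        by (intro IntI v vimageI2) (simp add: \<epsilon>)
      have "\<exists>y. y \<in> {X ?x | X. X \<in> \<X>} \<and> y \<in> ?T \<inter> (\<lambda>w. w c) -` ball (v c) \<epsilon>"
        by (rule cl[unfolded in_closure_of, THEN conjunct2, rule_format, OF conjI[OF v' o]])
      then obtain X where "X \<in> \<X>" "X ?x c \<in> ball (v c) \<epsilon>" by blast
      then show "\<exists>X\<in>\<X>. norm (X ?x c - v c) < \<epsilon>"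
        by (auto simp: dist_norm norm_minus_commute)
    next
      assume *: "\<forall>\<epsilon>>0. \<exists>X\<in>\<X>. norm (X ?x c - v c) < \<epsilon>"
      show "v \<in> top_of_set ?T closure_of {X ?x | X. X \<in> \<X>}"
        unfolding in_closure_of
      proof (intro conjI allI impI)
        fix W assume W: "v \<in> W \<and> openin (top_of_set ?T) W"
        then obtain Q where Q: "open Q" "W = ?T \<inter> Q" by (auto simp: openin_open)
        have "open (tangent_lift c ?x -` Q)"
          using open_vimage[OF Q(1) continuous_tangent_lift[OF x]] .
        moreover have "v c \<in> tangent_lift c ?x -` Q" using tangent_lift_eq[OF x v] W Q by simp
        ultimately obtain \<epsilon> where \<epsilon>: "\<epsilon> > 0" "ball (v c) \<epsilon> \<subseteq> tangent_lift c ?x -` Q"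
          using open_contains_ball by blast
        obtain X where X: "X \<in> \<X>" "norm (X ?x c - v c) < \<epsilon>" using * \<epsilon>(1) by blast
        then have "X ?x c \<in> ball (v c) \<epsilon>" by (simp add: dist_norm norm_minus_commute)
        then have "tangent_lift c ?x (X ?x c) \<in> Q" using \<epsilon>(2) by blast
        then have "X ?x \<in> W" using tangent_lift_eq[OF x XT[OF X(1)]] XT[OF X(1)] Q by simp
        then show "\<exists>y. y \<in> {X ?x | X. X \<in> \<X>} \<and> y \<in> W" using X(1) by blast
      qed (use v in simp)
    qed
    finally show "dual_norm S P ?x v \<le> 1 \<longleftrightarrow> (\<forall>\<epsilon>>0. \<exists>X\<in>\<X>. norm (X ?x c - v c) < \<epsilon>)" .
  qed simp
  then show ?thesis by (rule that)
qed

text \<open>Phrased with neighbourhoods so that pieces in different charts compose: the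
  \<open>W0\<close> obtained for one piece serves as the target \<open>W\<close> of the preceding
  piece.\<close>

lemma flow_approximation_in_chart:
  assumes c: "c \<in> A" and \<gamma>: "subunit_curve S P 0 T \<gamma>" and st: "0 \<le> s" "s \<le> t" "t \<le> T"
    and sub: "\<gamma> ` {s..t} \<subseteq> chart_inv c ` ball 0 1" and W: "open W" "\<gamma> t \<in> W"
  shows "\<exists>W0. open W0 \<and> \<gamma> s \<in> W0 \<and> (\<forall>y\<in>W0. \<exists>z\<in>W. rho_flow S P y z \<le> ennreal (t - s))"
proof -
  note cS = atlas_chart[OF c]
  obtain \<X> L where frame: "lipschitz_frame c \<X> L" by (rule lipschitz_frame_exists[OF c])
  note L = lipschitz_frameD(1)[OF frame] and X = lipschitz_frameD(2)[OF frame]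
    and lip = lipschitz_frameD(3)[OF frame] and unit = lipschitz_frameD(4)[OF frame]
  let ?x = "snd c \<circ> \<gamma>"
  have x: "chart_inv c (?x \<sigma>) = \<gamma> \<sigma>" "norm (?x \<sigma>) < 1" "\<gamma> \<sigma> \<in> fst c" if "\<sigma> \<in> {s..t}" for \<sigma>
  proof -
    have "\<gamma> \<sigma> \<in> chart_inv c ` ball 0 1" by (rule subsetD[OF sub imageI[OF that]])
    then obtain u where u: "norm u < 1" "\<gamma> \<sigma> = chart_inv c u" by auto
    have "u \<in> chart_image c" using cS(2) by simp
    then show "chart_inv c (?x \<sigma>) = \<gamma> \<sigma>" "norm (?x \<sigma>) < 1" "\<gamma> \<sigma> \<in> fst c"
      using chart_chart_inv[OF cS(1), of u] chart_inv_in[OF cS(1), of u] u by simp_all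
  qed
  have sub': "\<gamma> ` {s..t} \<subseteq> fst c" by (rule image_subsetI) (rule x(3))
  have ac\<gamma>: "abs_continuous_curve S 0 T \<gamma>" using \<gamma> by (simp add: subunit_curve_def)
  have cont: "continuous_on {s..t} \<gamma>"
    by (rule continuous_on_subset[OF ac\<gamma>[unfolded abs_continuous_curve_def, THEN conjunct1]]) (use st in simp)
  have "continuous_on {s..t} ?x"
    by (rule continuous_on_compose[OF cont continuous_on_subset[OF continuous_on_chart[OF cS(1)] sub']])
  \<comment> \<open>Compactness provides a bound on the coordinates that is strictly below 1, the
    \<open>r\<close> of the Euclidean approximation.\<close>
  then have "\<exists>\<sigma>\<in>{s..t}. \<forall>\<tau>\<in>{s..t}. norm (?x \<tau>) \<le> norm (?x \<sigma>)"
    by (intro continuous_attains_sup continuous_on_norm) (use st in simp_all)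
  then obtain \<sigma> where \<sigma>: "\<sigma> \<in> {s..t}" "\<And>\<tau>. \<tau> \<in> {s..t} \<Longrightarrow> norm (?x \<tau>) \<le> norm (?x \<sigma>)"
    by blast
  have ac: "abs_continuous_on s t ?x"
    by (rule ac\<gamma>[unfolded abs_continuous_curve_def, THEN conjunct2, rule_format, OF cS(1)])
      (use st sub' in simp)
  let ?Q = "\<lambda>\<tau>. \<tau> \<in> {0..T} \<longrightarrow> (\<exists>v. has_velocity S \<gamma> v \<tau> {0..T} \<and> dual_norm S P (\<gamma> \<tau>) v \<le> 1)"
  have "AE \<tau> in lebesgue. ?Q \<tau>" using \<gamma> by (simp add: subunit_curve_def)
  then obtain N where N: "{\<tau> \<in> space lebesgue. \<not> ?Q \<tau>} \<subseteq> N" "emeasure lebesgue N = 0" "N \<in> sets lebesgue"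
    by (rule AE_E)
  have vel: "\<exists>v. (?x has_vector_derivative v) (at \<tau> within {s..t}) \<and>
      (\<forall>\<epsilon>>0. \<exists>f\<in>(\<lambda>X u. X (chart_inv c u) c) ` \<X>. norm (f (?x \<tau>) - v) < \<epsilon>)" if \<tau>: "\<tau> \<in> {s..t} - N" for \<tau>
  proof -
    obtain v where v: "has_velocity S \<gamma> v \<tau> {0..T}" "dual_norm S P (\<gamma> \<tau>) v \<le> 1"
    proof -
      have "?Q \<tau>" using N(1) \<tau> by auto
      moreover have "\<tau> \<in> {0..T}" using \<tau> st by auto
      ultimately show ?thesis using that by blast
    qed
    have "has_velocity S \<gamma> v \<tau> {s..t}" by (rule has_velocity_subset[OF v(1)]) (use st in auto)
    moreover have "c \<in> charts_at S (\<gamma> \<tau>)" using x(3)[of \<tau>] \<tau> cS(1) by (simp add: charts_at_def)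
    ultimately have "(?x has_vector_derivative v c) (at \<tau> within {s..t})" "v \<in> tangent_space S (\<gamma> \<tau>)"
      unfolding has_velocity_def by (blast, blast)
    moreover have "\<exists>X\<in>\<X>. norm (X (chart_inv c (?x \<tau>)) c - v c) < \<epsilon>" if "0 < \<epsilon>" for \<epsilon>
      using unit[of "?x \<tau>" v] x[of \<tau>] \<tau> v(2) that calculation(2) by simp
    ultimately show ?thesis by (intro exI[of _ "v c"]) simp
  qed
  have "open (chart_inv c -` W)"
    by (rule open_vimage[OF W(1)]) (use continuous_on_chart_inv[OF cS(1)] cS(2) in simp)
  moreover have "?x t \<in> chart_inv c -` W" using x(1)[of t] st W by simp
  ultimately obtain \<eta> where \<eta>: "\<eta> > 0" "ball (?x t) \<eta> \<subseteq> chart_inv c -` W"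
    using open_contains_ball by blast
  have "\<exists>\<delta>>0. \<forall>u. norm (u - ?x s) < \<delta> \<longrightarrow> (\<exists>w. norm w < 1 \<and> norm (w - ?x t) < \<eta> \<and>
      rho_flow S P (chart_inv c u) (chart_inv c w) \<le> ennreal (t - s))"
  proof (rule flow_approximation[of s t L "(\<lambda>X u. X (chart_inv c u) c) ` \<X>"
        "\<lambda>u w. rho_flow S P (chart_inv c u) (chart_inv c w)" ?x "norm (?x \<sigma>)" N \<eta>])
    fix f h z assume f: "f \<in> (\<lambda>X u. X (chart_inv c u) c) ` \<X>" and h: "0 < h"
      and z: "\<And>t. t \<in> {0..h} \<Longrightarrow> norm (z t) < 1 \<and> (z has_vector_derivative f (z t)) (at t within {0..h})"
    obtain Y where Y: "Y \<in> \<X>" "f = (\<lambda>u. Y (chart_inv c u) c)" using f by blast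
    have "flow_step P h (chart_inv c (z 0)) (chart_inv c (z h))"
      by (rule flow_step_in_chart[OF cS X[OF Y(1)] h]) (use z Y(2) in \<open>auto intro: less_imp_le\<close>)
    then show "rho_flow S P (chart_inv c (z 0)) (chart_inv c (z h)) \<le> ennreal h"
      by (rule rho_flow_le[OF flow_step_imp_chain])
  next
    show "norm (f u - f w) \<le> L * norm (u - w)"
      if "f \<in> (\<lambda>X u. X (chart_inv c u) c) ` \<X>" "u \<in> ball 0 1" "w \<in> ball 0 1" for f u w
      using that lip by force
    show "N \<in> null_sets lebesgue" using N by auto
    show "\<exists>v. (?x has_vector_derivative v) (at \<tau> within {s..t}) \<and>
        (\<forall>\<epsilon>>0. \<exists>f\<in>(\<lambda>X u. X (chart_inv c u) c) ` \<X>. norm (f (?x \<tau>) - v) < \<epsilon>)"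
      if "\<tau> \<in> {s..t} - N" for \<tau> by (rule vel[OF that])
    show "rho_flow S P (chart_inv c u) (chart_inv c u) = 0" for u by (rule rho_flow_refl)
    show "rho_flow S P (chart_inv c u) (chart_inv c w) \<le>
        rho_flow S P (chart_inv c u) (chart_inv c v) + rho_flow S P (chart_inv c v) (chart_inv c w)" for u v w
      by (rule rho_flow_triangle)
    show "norm (?x \<tau>) \<le> norm (?x \<sigma>)" if "\<tau> \<in> {s..t}" for \<tau> by (rule \<sigma>(2)[OF that])
  next
    fix \<delta> :: real
    assume "0 < \<delta>" "\<And>u. norm (u - ?x s) < \<delta> \<Longrightarrow> \<exists>w. norm w < 1 \<and> norm (w - ?x t) < \<eta> \<and>
      rho_flow S P (chart_inv c u) (chart_inv c w) \<le> ennreal (t - s)"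
    then show "\<exists>\<delta>>0. \<forall>u. norm (u - ?x s) < \<delta> \<longrightarrow> (\<exists>w. norm w < 1 \<and> norm (w - ?x t) < \<eta> \<and>
        rho_flow S P (chart_inv c u) (chart_inv c w) \<le> ennreal (t - s))" by blast
  qed (fact st(2) L ac x(2)[OF \<sigma>(1)] \<eta>(1))+
  then obtain \<delta> where \<delta>: "0 < \<delta>" "\<And>u. norm (u - ?x s) < \<delta> \<Longrightarrow>
      \<exists>w. norm w < 1 \<and> norm (w - ?x t) < \<eta> \<and> rho_flow S P (chart_inv c u) (chart_inv c w) \<le> ennreal (t - s)"
    by blast
  show ?thesis
  proof (intro exI[of _ "chart_inv c ` ball (?x s) \<delta>"] conjI ballI)
    show "open (chart_inv c ` ball (?x s) \<delta>)"
      by (rule open_chart_inv_image[OF cS(1)]) (use cS(2) in auto)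
    show "\<gamma> s \<in> chart_inv c ` ball (?x s) \<delta>"
      using x(1)[of s] st \<delta>(1) by (intro image_eqI[of _ _ "?x s"]) auto
    fix y assume "y \<in> chart_inv c ` ball (?x s) \<delta>"
    then obtain u where u: "y = chart_inv c u" "norm (u - ?x s) < \<delta>"
      by (auto simp: dist_norm norm_minus_commute)
    obtain w where w: "norm (w - ?x t) < \<eta>" "rho_flow S P (chart_inv c u) (chart_inv c w) \<le> ennreal (t - s)"
      using \<delta>(2)[OF u(2)] by blast
    then have "w \<in> ball (?x t) \<eta>" by (simp add: dist_norm norm_minus_commute)
    then have "chart_inv c w \<in> W" using \<eta>(2) by blast
    then show "\<exists>z\<in>W. rho_flow S P y z \<le> ennreal (t - s)" using w(2) u(1) by blast
  qed
qed

text \<open>Interval induction on the composable neighbourhood property. Locally it holds because,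
  by continuity, a short piece of the curve stays in one coordinate unit ball of the atlas.\<close>

lemma flow_approximation_of_subunit_curve:
  assumes \<gamma>: "subunit_curve S P 0 T \<gamma>" and t: "0 \<le> t" "t \<le> T" and W: "open W" "\<gamma> t \<in> W"
  shows "\<exists>z\<in>W. rho_flow S P (\<gamma> 0) z \<le> ennreal t"
proof -
  \<comment> \<open>The range restrictions are premises inside \<open>Q\<close>, since the local
    case of \<open>Bolzano\<close> quantifies over all intervals around a time, including those that
    leave \<open>{0..T}\<close>.\<close>
  define Q where "Q a b \<longleftrightarrow> (0 \<le> a \<longrightarrow> a \<le> b \<longrightarrow> b \<le> T \<longrightarrow> (\<forall>W. open W \<and> \<gamma> b \<in> W \<longrightarrow>
    (\<exists>W0. open W0 \<and> \<gamma> a \<in> W0 \<and> (\<forall>y\<in>W0. \<exists>z\<in>W. rho_flow S P y z \<le> ennreal (b - a)))))" for a b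
  have "Q 0 t"
    using t(1)
  proof (induction rule: Bolzano)
    case (trans a b c)
    show ?case unfolding Q_def
    proof (intro impI allI)
      fix W assume ac: "0 \<le> a" "a \<le> c" "c \<le> T" and W: "open W \<and> \<gamma> c \<in> W"
      obtain W1 where W1: "open W1" "\<gamma> b \<in> W1" "\<forall>y\<in>W1. \<exists>z\<in>W. rho_flow S P y z \<le> ennreal (c - b)"
        using trans(2) trans(3,4) ac W unfolding Q_def by (meson order_trans)
      obtain W0 where W0: "open W0" "\<gamma> a \<in> W0" "\<forall>y\<in>W0. \<exists>z\<in>W1. rho_flow S P y z \<le> ennreal (b - a)"
        using trans(1) trans(3,4) ac W1 unfolding Q_def by (meson order_trans)
      have "\<exists>z\<in>W. rho_flow S P y z \<le> ennreal (c - a)" if "y \<in> W0" for y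
      proof -
        obtain y' where y': "y' \<in> W1" "rho_flow S P y y' \<le> ennreal (b - a)" using W0 \<open>y \<in> W0\<close> by blast
        obtain z where z: "z \<in> W" "rho_flow S P y' z \<le> ennreal (c - b)" using W1 y' by blast
        have "rho_flow S P y z \<le> ennreal (b - a) + ennreal (c - b)"
          using rho_flow_triangle add_mono[OF y'(2) z(2)] by (rule order_trans)
        also have "\<dots> = ennreal (c - a)" using trans(3,4) by (simp flip: ennreal_plus)
        finally show ?thesis using z(1) by blast
      qed
      then show "\<exists>W0. open W0 \<and> \<gamma> a \<in> W0 \<and> (\<forall>y\<in>W0. \<exists>z\<in>W. rho_flow S P y z \<le> ennreal (c - a))"
        using W0 by blast
    qed
  next
    case (local \<tau>)
    obtain c u where c: "c \<in> A" "norm u < 1" "\<gamma> \<tau> = chart_inv c u" by (rule atlas_cover)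
    have "continuous_on {0..T} \<gamma>" using \<gamma> by (simp add: subunit_curve_def abs_continuous_curve_def)
    then have "(\<gamma> \<longlongrightarrow> \<gamma> \<tau>) (at \<tau> within {0..T})" using local t by (simp add: continuous_on_def)
    moreover have "open (chart_inv c ` ball 0 1)"
      by (rule open_chart_inv_image[OF atlas_chart(1)[OF c(1)]]) (use atlas_chart(2)[OF c(1)] in auto)
    moreover have \<gamma>\<tau>: "\<gamma> \<tau> \<in> chart_inv c ` ball 0 1" using c by auto
    ultimately have "eventually (\<lambda>\<sigma>. \<gamma> \<sigma> \<in> chart_inv c ` ball 0 1) (at \<tau> within {0..T})"
      by (rule topological_tendstoD)
    then obtain d where d: "d > 0" "\<And>\<sigma>. \<sigma> \<in> {0..T} \<Longrightarrow> \<sigma> \<noteq> \<tau> \<Longrightarrow> \<bar>\<sigma> - \<tau>\<bar> < d \<Longrightarrow> \<gamma> \<sigma> \<in> chart_inv c ` ball 0 1"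
      unfolding eventually_at dist_real_def by blast
    have "Q a b" if "a \<le> \<tau> \<and> \<tau> \<le> b \<and> b - a < d" for a b
      unfolding Q_def
    proof (intro impI allI)
      fix W assume ab: "0 \<le> a" "a \<le> b" "b \<le> T" and W: "open W \<and> \<gamma> b \<in> W"
      have "\<gamma> \<sigma> \<in> chart_inv c ` ball 0 1" if "\<sigma> \<in> {a..b}" for \<sigma>
        by (cases "\<sigma> = \<tau>") (use \<gamma>\<tau> d(2)[of \<sigma>] that ab \<open>a \<le> \<tau> \<and> \<tau> \<le> b \<and> b - a < d\<close> in auto)
      then show "\<exists>W0. open W0 \<and> \<gamma> a \<in> W0 \<and> (\<forall>y\<in>W0. \<exists>z\<in>W. rho_flow S P y z \<le> ennreal (b - a))"
        by (intro flow_approximation_in_chart[OF c(1) \<gamma> ab]) (use W in auto)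
    qed
    then show ?case using d(1) by blast
  qed
  then show ?thesis using t W unfolding Q_def by fastforce
qed

lemma Liminf_rho_flow_le_rho:
  assumes xy: "x \<noteq> y" shows "Liminf (at y) (\<lambda>z. rho_flow S P x z) \<le> rho S P x y"
  unfolding rho_def distance_of_def
proof (rule Inf_greatest)
  fix r assume "r \<in> {ennreal T |T. 0 < T \<and> (\<exists>\<gamma>. subunit_curve S P 0 T \<gamma> \<and> \<gamma> 0 = x \<and> \<gamma> T = y)}"
  then obtain T \<gamma> where r: "r = ennreal T" and T: "0 < T" and \<gamma>: "subunit_curve S P 0 T \<gamma>" "\<gamma> 0 = x" "\<gamma> T = y"
    by blast
  have cont: "continuous_on {0..T} \<gamma>" using \<gamma> by (simp add: subunit_curve_def abs_continuous_curve_def)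
  define K where "K = {t \<in> {0..T}. \<gamma> t = y}"
  have "closed K"
    unfolding K_def using continuous_closed_preimage[OF cont, of "{y}"] by (simp add: vimage_def Int_def)
  then have "compact K" by (metis (no_types, lifting) K_def bounded_closed_interval bounded_subset compact_eq_bounded_closed mem_Collect_eq subsetI)
  moreover have "T \<in> K" using T \<gamma> by (simp add: K_def)
  ultimately obtain t0 where t0: "t0 \<in> K" "\<And>t. t \<in> K \<Longrightarrow> t0 \<le> t"
    using compact_attains_inf[of K] by blast
  have t0': "0 < t0" "t0 \<le> T" "\<gamma> t0 = y" using t0(1) \<gamma>(2) xy by (auto simp: K_def less_le)
  have "\<exists>z\<in>W. z \<noteq> y \<and> rho_flow S P x z \<le> ennreal T" if W: "open W" "y \<in> W" for W
  proof -
    have "(\<gamma> \<longlongrightarrow> \<gamma> t0) (at t0 within {0..T})"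
      using cont t0'(1,2) unfolding continuous_on_def by (intro bspec[of _ _ t0]) auto
    then have "eventually (\<lambda>t. \<gamma> t \<in> W) (at t0 within {0..T})"
      using W t0'(3) topological_tendstoD by fastforce
    then obtain d where d: "d > 0" "\<And>t. t \<in> {0..T} \<Longrightarrow> t \<noteq> t0 \<Longrightarrow> \<bar>t - t0\<bar> < d \<Longrightarrow> \<gamma> t \<in> W"
      unfolding eventually_at dist_real_def by blast
    \<comment> \<open>A time just before the first arrival at \<open>y\<close>. The maximum keeps it
      in the domain, and it is still smaller than \<open>t0\<close> because
      \<open>x \<noteq> y\<close> forces \<open>t0\<close> to be positive.\<close>
    define t where "t = max 0 (t0 - d / 2)"
    have t: "t \<in> {0..T}" "t < t0" "\<bar>t - t0\<bar> < d" using t0' d(1) by (auto simp: t_def)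
    have "\<gamma> t \<noteq> y" using t0(2)[of t] t by (auto simp: K_def)
    \<comment> \<open>Removing the point \<open>y\<close> leaves an open neighbourhood of
      \<open>\<gamma> t\<close>, so the approximating end point avoids \<open>y\<close> as
      well.\<close>
    then have "\<exists>z\<in>W - {y}. rho_flow S P (\<gamma> 0) z \<le> ennreal t"
      using t d(2)[of t] W by (intro flow_approximation_of_subunit_curve[OF \<gamma>(1)]) auto
    moreover have "ennreal t \<le> ennreal T" using t by (intro ennreal_leI) simp
    ultimately show ?thesis unfolding \<gamma>(2) by (auto intro: order_trans)
  qed
  note near = this
  show "Liminf (at y) (\<lambda>z. rho_flow S P x z) \<le> r"
    unfolding Liminf_def
  proof (rule SUP_least)
    fix Q assume "Q \<in> {Q. eventually Q (at y)}"
    then obtain W where W: "open W" "y \<in> W" "\<And>z. z \<in> W \<Longrightarrow> z \<noteq> y \<Longrightarrow> Q z"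
      by (auto simp: eventually_at_topological)
    obtain z where z: "z \<in> W" "z \<noteq> y" "rho_flow S P x z \<le> ennreal T" using near[OF W(1,2)] by blast
    then have "Q z" using W(3) by blast
    then have "Inf (rho_flow S P x ` Collect Q) \<le> rho_flow S P x z" by (intro INF_lower) simp
    then show "Inf (rho_flow S P x ` Collect Q) \<le> r" using z(3) r by simp
  qed
qed

end

section \<open>Smooth subunit curves\<close>

lemma smooth_on_has_vector_derivative:
  fixes f :: "real \<Rightarrow> 'a::real_normed_vector"
  assumes "smooth_on W f" "x \<in> W"
  shows "(f has_vector_derivative frechet_derivative f (at x) 1) (at x)"
proof -
  have d: "(f has_derivative frechet_derivative f (at x)) (at x)"
    using smooth_on_imp_differentiable[OF assms] by (simp add: frechet_derivative_works)
  have "frechet_derivative f (at x) r = r *\<^sub>R frechet_derivative f (at x) 1" for r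
    using linear_scale[OF has_derivative_linear[OF d], of r 1] by simp
  then have "frechet_derivative f (at x) = (\<lambda>r. r *\<^sub>R frechet_derivative f (at x) 1)" by (rule ext)
  with d show ?thesis unfolding has_vector_derivative_def by metis
qed

lemma smooth_on_imp_abs_continuous_on:
  fixes f :: "real \<Rightarrow> 'a::euclidean_space"
  assumes f: "smooth_on W f" "{s..t} \<subseteq> W"
  shows "abs_continuous_on s t f"
proof -
  let ?f' = "\<lambda>x. frechet_derivative f (at x) 1"
  have d: "(f has_vector_derivative ?f' x) (at x within {s..t})" if "x \<in> {s..t}" for x
    by (rule has_vector_derivative_at_within[OF smooth_on_has_vector_derivative[OF f(1) subsetD[OF f(2) that]]])
  have "continuous_on {s..t} ?f'"
    by (rule continuous_on_subset[OF _ f(2)]) (use smooth_onD[OF f(1), of "Suc 0"] in simp)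
  then have "bounded (?f' ` {s..t})" by (intro compact_imp_bounded compact_continuous_image) auto
  then obtain B where B: "0 < B" "\<And>x. x \<in> {s..t} \<Longrightarrow> norm (?f' x) \<le> B"
    unfolding bounded_pos by blast
  have lip: "norm (f r - f l) \<le> B * (r - l)" if "s \<le> l" "l \<le> r" "r \<le> t" for l r
    using vector_derivative_bound[of "{s..t}" f ?f' B r l] d B(2) that by auto
  show ?thesis unfolding abs_continuous_on_def
  proof (intro allI impI)
    fix \<epsilon> :: real assume \<epsilon>: "0 < \<epsilon>"
    show "\<exists>\<delta>>0. \<forall>(n::nat) l r. (\<forall>i<n. s \<le> l i \<and> l i \<le> r i \<and> r i \<le> t) \<and>
        disjoint_family_on (\<lambda>i. {l i<..<r i}) {..<n} \<and> (\<Sum>i<n. r i - l i) < \<delta> \<longrightarrow>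
        (\<Sum>i<n. norm (f (r i) - f (l i))) < \<epsilon>"
    proof (intro exI[of _ "\<epsilon> / B"] conjI allI impI)
      show "0 < \<epsilon> / B" using \<epsilon> B by simp
      fix n :: nat and l r :: "nat \<Rightarrow> real"
      assume *: "(\<forall>i<n. s \<le> l i \<and> l i \<le> r i \<and> r i \<le> t) \<and>
        disjoint_family_on (\<lambda>i. {l i<..<r i}) {..<n} \<and> (\<Sum>i<n. r i - l i) < \<epsilon> / B"
      have "(\<Sum>i<n. norm (f (r i) - f (l i))) \<le> (\<Sum>i<n. B * (r i - l i))"
        by (intro sum_mono lip) (use * in auto)
      also have "\<dots> = B * (\<Sum>i<n. r i - l i)" by (simp add: sum_distrib_left)
      also have "\<dots> < B * (\<epsilon> / B)" using * B(1) by (intro mult_strict_left_mono) auto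
      also have "\<dots> = \<epsilon>" using B(1) by simp
      finally show "(\<Sum>i<n. norm (f (r i) - f (l i))) < \<epsilon>" .
    qed
  qed
qed

context manifold
begin

text \<open>The curve is defined on the whole line and the velocity bound holds at every time, so
  reparametrising and gluing involve neither end points nor exceptional sets.\<close>

definition smooth_subunit ::
    "('m \<times> ('m, 'e) covector \<Rightarrow> real) \<Rightarrow> (real \<Rightarrow> 'm) \<Rightarrow> bool" where
  "smooth_subunit P \<beta> \<longleftrightarrow> continuous_on UNIV \<beta> \<and>
     (\<forall>c\<in>S. smooth_on (\<beta> -` fst c) (snd c \<circ> \<beta>)) \<and>
     (\<forall>t. \<exists>v. has_velocity S \<beta> v t UNIV \<and> dual_norm S P (\<beta> t) v \<le> 1)"

definition smooth_link ::
    "('m \<times> ('m, 'e) covector \<Rightarrow> real) \<Rightarrow> real \<Rightarrow> 'm \<Rightarrow> 'm \<Rightarrow> bool" where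
  "smooth_link P T x y \<longleftrightarrow> 0 < T \<and> (\<exists>\<beta>. smooth_subunit P \<beta> \<and> (\<forall>t\<le>0. \<beta> t = x) \<and> (\<forall>t\<ge>T. \<beta> t = y))"

lemma smooth_subunit_affine:
  assumes "smooth_subunit P \<beta>" "\<bar>b\<bar> \<le> 1"
  shows "smooth_subunit P (\<lambda>t. \<beta> (a + b * t))"
  unfolding smooth_subunit_def
proof (intro conjI ballI allI)
  have cont: "continuous_on UNIV \<beta>" using assms by (simp add: smooth_subunit_def)
  then show cont': "continuous_on UNIV (\<lambda>t. \<beta> (a + b * t))"
    by (rule continuous_on_compose2) (auto intro!: continuous_intros)
  fix c assume c: "c \<in> S"
  have "open ((\<lambda>t. \<beta> (a + b * t)) -` fst c)" by (rule open_vimage[OF open_chart_domain[OF c] cont'])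
  then show "smooth_on ((\<lambda>t. \<beta> (a + b * t)) -` fst c) (snd c \<circ> (\<lambda>t. \<beta> (a + b * t)))"
    using smooth_on_compose[OF _ smooth_on_affine, of _ "\<beta> -` fst c" "snd c \<circ> \<beta>" a b] assms(1) c
    by (auto simp: smooth_subunit_def o_def)
next
  fix t
  obtain v where v: "has_velocity S \<beta> v (a + b * t) UNIV" "dual_norm S P (\<beta> (a + b * t)) v \<le> 1"
    using assms(1) unfolding smooth_subunit_def by blast
  have "has_velocity S (\<lambda>t. \<beta> (a + b * t)) (\<lambda>c. b *\<^sub>R v c) t UNIV"
    by (rule has_velocity_reparam[where \<theta>="\<lambda>t. a + b * t" and I=UNIV])
      (use v(1) in \<open>auto intro!: derivative_eq_intros\<close>)
  moreover have "dual_norm S P (\<beta> (a + b * t)) (\<lambda>c. b *\<^sub>R v c) \<le> 1"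
    by (rule dual_norm_scaleR_le[OF _ v(2) assms(2)]) (use v(1) in \<open>simp add: has_velocity_def\<close>)
  ultimately show "\<exists>v. has_velocity S (\<lambda>t. \<beta> (a + b * t)) v t UNIV \<and> dual_norm S P (\<beta> (a + b * t)) v \<le> 1"
    by blast
qed

lemma smooth_subunit_const: "smooth_subunit P (\<lambda>t. x)"
  unfolding smooth_subunit_def
proof (intro conjI ballI allI)
  fix c
  show "smooth_on ((\<lambda>t. x) -` fst c) (snd c \<circ> (\<lambda>t::real. x))"
    by (cases "x \<in> fst c") (auto simp: o_def intro!: smooth_on_const)
next
  fix t show "\<exists>v. has_velocity S (\<lambda>t. x) v t UNIV \<and> dual_norm S P x v \<le> 1"
    by (intro exI[of _ "\<lambda>c. 0"]) (auto simp: has_velocity_def tangent_space_zero dual_norm_zero o_def)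
qed simp

lemma smooth_subunit_local:
  assumes "\<And>t. \<exists>N \<beta>'. open N \<and> t \<in> N \<and> smooth_subunit P \<beta>' \<and> (\<forall>s\<in>N. \<beta>' s = \<beta> s)"
  shows "smooth_subunit P \<beta>"
proof -
  have vel: "\<exists>v. has_velocity S \<beta> v t UNIV \<and> dual_norm S P (\<beta> t) v \<le> 1" for t
  proof -
    obtain N \<beta>' where N: "open N" "t \<in> N" "smooth_subunit P \<beta>'" "\<And>s. s \<in> N \<Longrightarrow> \<beta>' s = \<beta> s"
      using assms by metis
    then obtain v where v: "has_velocity S \<beta>' v t UNIV" "dual_norm S P (\<beta>' t) v \<le> 1"
      unfolding smooth_subunit_def by blast
    have "has_velocity S \<beta> v t N"
      by (rule has_velocity_cong[OF has_velocity_subset[OF v(1)] N(2)]) (use N(4) in auto)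
    then have "has_velocity S \<beta> v t UNIV"
      using at_within_open[OF N(2,1)] by (simp add: has_velocity_def)
    then show ?thesis using v(2) N(2,4) by auto
  qed
  then have cont: "continuous_on UNIV \<beta>"
    by (auto simp: has_velocity_def continuous_on_eq_continuous_within)
  have "smooth_on (\<beta> -` fst c) (snd c \<circ> \<beta>)" if c: "c \<in> S" for c
  proof (rule smooth_on_local)
    fix t assume t: "t \<in> \<beta> -` fst c"
    obtain N \<beta>' where N: "open N" "t \<in> N" "smooth_subunit P \<beta>'" "\<And>s. s \<in> N \<Longrightarrow> \<beta>' s = \<beta> s"
      using assms by metis
    have o: "open (\<beta> -` fst c \<inter> N)"
      by (intro open_Int open_vimage[OF open_chart_domain[OF c] cont] N(1))
    have "smooth_on (\<beta> -` fst c \<inter> N) (snd c \<circ> \<beta>')"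
      by (rule smooth_on_subset[of "\<beta>' -` fst c"]) (use N(3,4) c in \<open>auto simp: smooth_subunit_def\<close>)
    then have "smooth_on (\<beta> -` fst c \<inter> N) (snd c \<circ> \<beta>)"
      by (rule smooth_on_cong[OF o, rotated]) (use N(4) in auto)
    then show "\<exists>N. open N \<and> t \<in> N \<and> smooth_on (\<beta> -` fst c \<inter> N) (snd c \<circ> \<beta>)"
      using N(1,2) by blast
  qed
  then show ?thesis using cont vel by (simp add: smooth_subunit_def)
qed

lemma smooth_subunit_imp_smooth_curve: "smooth_subunit P \<beta> \<Longrightarrow> smooth_curve S a b \<beta>"
  unfolding smooth_curve_def smooth_subunit_def
  by (intro exI[of _ 1] conjI exI[of _ \<beta>]) (auto intro: continuous_on_subset smooth_on_subset)

lemma smooth_subunit_imp_subunit_curve: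
  assumes "smooth_subunit P \<beta>" shows "subunit_curve S P a b \<beta>"
  unfolding subunit_curve_def abs_continuous_curve_def
proof (intro conjI ballI allI impI AE_I2)
  show "continuous_on {a..b} \<beta>"
    using assms continuous_on_subset unfolding smooth_subunit_def by blast
  fix c s t assume "c \<in> S" "a \<le> s \<and> s \<le> t \<and> t \<le> b \<and> \<beta> ` {s..t} \<subseteq> fst c"
  then show "abs_continuous_on s t (snd c \<circ> \<beta>)"
    using assms by (intro smooth_on_imp_abs_continuous_on[of "\<beta> -` fst c"]) (auto simp: smooth_subunit_def)
next
  fix t assume "t \<in> {a..b}"
  obtain v where "has_velocity S \<beta> v t UNIV" "dual_norm S P (\<beta> t) v \<le> 1"
    using assms unfolding smooth_subunit_def by blast
  then show "\<exists>v. has_velocity S \<beta> v t {a..b} \<and> dual_norm S P (\<beta> t) v \<le> 1"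
    using has_velocity_subset by blast
qed

lemma rho_smooth_le:
  assumes "smooth_subunit P \<beta>" "s < t"
  shows "rho_smooth S P (\<beta> s) (\<beta> t) \<le> ennreal (t - s)"
proof -
  let ?\<gamma> = "\<lambda>r. \<beta> (s + 1 * r)"
  have \<gamma>: "smooth_subunit P ?\<gamma>" by (rule smooth_subunit_affine[OF assms(1)]) simp
  have "(smooth_curve S 0 (t - s) ?\<gamma> \<and> subunit_curve S P 0 (t - s) ?\<gamma>) \<and> ?\<gamma> 0 = \<beta> s \<and> ?\<gamma> (t - s) = \<beta> t"
    using smooth_subunit_imp_smooth_curve[OF \<gamma>] smooth_subunit_imp_subunit_curve[OF \<gamma>] by simp
  then show ?thesis unfolding rho_smooth_def distance_of_def
    using assms(2) by (intro Inf_lower CollectI exI[of _ "t - s"]) auto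
qed

lemma rho_smooth_refl: "rho_smooth S P x x = 0"
proof -
  have "rho_smooth S P x x \<le> 0 + ennreal e" if "0 < e" for e
    using rho_smooth_le[OF smooth_subunit_const that, of P x] by simp
  then have "rho_smooth S P x x \<le> 0" by (rule ennreal_le_epsilon)
  then show ?thesis by simp
qed

lemma rho_le_rho_smooth: "rho S P x y \<le> rho_smooth S P x y"
  unfolding rho_def rho_smooth_def distance_of_def by (rule Inf_superset_mono) blast

lemma smooth_link_sym:
  assumes "smooth_link P T x y" shows "smooth_link P T y x"
proof -
  obtain \<beta> where T: "0 < T" and \<beta>: "smooth_subunit P \<beta>" "\<And>t. t \<le> 0 \<Longrightarrow> \<beta> t = x" "\<And>t. t \<ge> T \<Longrightarrow> \<beta> t = y"
    using assms unfolding smooth_link_def by blast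
  show ?thesis unfolding smooth_link_def
    using T \<beta>(2,3) smooth_subunit_affine[OF \<beta>(1), of "-1" T]
    by (intro conjI exI[of _ "\<lambda>t. \<beta> (T + (-1) * t)"]) auto
qed

text \<open>The gap \<open>e\<close> in time makes the two curves constant on a common open interval, so that they
  are glued smoothly.\<close>

lemma smooth_link_trans:
  assumes "smooth_link P T x y" "smooth_link P T' y z" "0 < e"
  shows "smooth_link P (T + T' + e) x z"
proof -
  obtain \<beta> where T: "0 < T" and \<beta>: "smooth_subunit P \<beta>" "\<And>t. t \<le> 0 \<Longrightarrow> \<beta> t = x" "\<And>t. t \<ge> T \<Longrightarrow> \<beta> t = y"
    using assms(1) unfolding smooth_link_def by blast
  obtain \<delta> where T': "0 < T'" and \<delta>: "smooth_subunit P \<delta>" "\<And>t. t \<le> 0 \<Longrightarrow> \<delta> t = y" "\<And>t. t \<ge> T' \<Longrightarrow> \<delta> t = z"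
    using assms(2) unfolding smooth_link_def by blast
  let ?\<delta> = "\<lambda>t. \<delta> (- (T + e) + 1 * t)"
  let ?\<gamma> = "\<lambda>t. if t < T + e then \<beta> t else ?\<delta> t"
  have \<delta>': "smooth_subunit P ?\<delta>" by (rule smooth_subunit_affine[OF \<delta>(1)]) simp
  have "smooth_subunit P ?\<gamma>"
  proof (rule smooth_subunit_local)
    fix t
    show "\<exists>N \<beta>'. open N \<and> t \<in> N \<and> smooth_subunit P \<beta>' \<and> (\<forall>s\<in>N. \<beta>' s = ?\<gamma> s)"
    proof (cases "t < T + e")
      case True
      then show ?thesis using \<beta>(1) by (intro exI[of _ "{..<T + e}"] exI[of _ \<beta>]) auto
    next
      case False
      then show ?thesis using \<delta>' \<beta>(3) \<delta>(2) assms(3)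
        by (intro exI[of _ "{T<..}"] exI[of _ ?\<delta>]) auto
    qed
  qed
  then show ?thesis unfolding smooth_link_def using T T' assms(3) \<beta>(2) \<delta>(3)
    by (intro conjI exI[of _ ?\<gamma>]) auto
qed

text \<open>The part common to flow curves and smooth curves; they differ in the proof of
  smoothness, which is left as an assumption. Since \<open>\<theta>\<close> maps the whole line into
  \<open>{0..T}\<close>, velocities that are one-sided at the ends become two-sided after
  composition.\<close>

lemma smooth_link_reparam:
  assumes vel: "\<And>t. t \<in> {0..T} \<Longrightarrow> \<exists>v. has_velocity S \<gamma> v t {0..T} \<and> dual_norm S P (\<gamma> t) v \<le> 1"
    and T': "0 < T'"
    and \<theta>: "\<And>t. (\<theta> has_real_derivative \<theta>' t) (at t)" "\<And>t. 0 \<le> \<theta>' t" "\<And>t. \<theta>' t \<le> 1"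
      "\<And>t. t \<le> 0 \<Longrightarrow> \<theta> t = 0" "\<And>t. t \<ge> T' \<Longrightarrow> \<theta> t = T" "\<And>t. 0 \<le> \<theta> t" "\<And>t. \<theta> t \<le> T"
    and smooth: "\<And>c. c \<in> S \<Longrightarrow> open ((\<lambda>t. \<gamma> (\<theta> t)) -` fst c) \<Longrightarrow>
      smooth_on ((\<lambda>t. \<gamma> (\<theta> t)) -` fst c) (snd c \<circ> (\<lambda>t. \<gamma> (\<theta> t)))"
  shows "smooth_link P T' (\<gamma> 0) (\<gamma> T)"
proof -
  have v: "\<exists>v. has_velocity S (\<lambda>t. \<gamma> (\<theta> t)) v t UNIV \<and> dual_norm S P (\<gamma> (\<theta> t)) v \<le> 1" for t
  proof -
    obtain v where v: "has_velocity S \<gamma> v (\<theta> t) {0..T}" "dual_norm S P (\<gamma> (\<theta> t)) v \<le> 1"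
      using vel[of "\<theta> t"] \<theta>(6,7) by auto
    have "has_velocity S (\<lambda>t. \<gamma> (\<theta> t)) (\<lambda>c. \<theta>' t *\<^sub>R v c) t UNIV"
      by (rule has_velocity_reparam[where \<theta>=\<theta> and I="{0..T}"]) (use v(1) \<theta> in auto)
    moreover have "dual_norm S P (\<gamma> (\<theta> t)) (\<lambda>c. \<theta>' t *\<^sub>R v c) \<le> 1"
      by (rule dual_norm_scaleR_le[OF _ v(2)]) (use v(1) \<theta>(2,3)[of t] in \<open>auto simp: has_velocity_def\<close>)
    ultimately show ?thesis by blast
  qed
  have cont: "continuous_on UNIV (\<lambda>t. \<gamma> (\<theta> t))"
    unfolding continuous_on_eq_continuous_within
  proof
    fix t show "continuous (at t) (\<lambda>t. \<gamma> (\<theta> t))" using v[of t] unfolding has_velocity_def by blast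
  qed
  have "smooth_subunit P (\<lambda>t. \<gamma> (\<theta> t))"
    unfolding smooth_subunit_def
  proof (intro conjI cont ballI allI v)
    fix c assume c: "c \<in> S"
    show "smooth_on ((\<lambda>t. \<gamma> (\<theta> t)) -` fst c) (snd c \<circ> (\<lambda>t. \<gamma> (\<theta> t)))"
      by (rule smooth[OF c open_vimage[OF open_chart_domain[OF c] cont]])
  qed
  then show ?thesis unfolding smooth_link_def using T' \<theta>(4,5)
    by (intro conjI exI[of _ "\<lambda>t. \<gamma> (\<theta> t)"]) auto
qed

text \<open>A flow curve is only known to have the right velocity at each time; its smoothness is
  obtained by bootstrapping. In coordinates the derivative of the reparametrised curve is a smooth
  function of time and position, so if the curve is of class C^k, then so is its derivative.\<close>

lemma flow_step_imp_smooth_link: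
  assumes "flow_step P h x y" "h < T'" shows "smooth_link P T' x y"
proof -
  obtain X a \<gamma> where h: "0 < h" and X: "subunit_field S P UNIV X"
    and \<gamma>: "flow_curve S X a (a + h) \<gamma>" "\<gamma> a = x" "\<gamma> (a + h) = y"
    using assms(1) by (auto simp: flow_step_def)
  have vel: "has_velocity S (\<lambda>t. \<gamma> (a + t)) (X (\<gamma> (a + t))) t {0..h}" if "t \<in> {0..h}" for t
  proof -
    have "has_velocity S (\<lambda>t. \<gamma> (a + t)) (\<lambda>c. 1 *\<^sub>R X (\<gamma> (a + t)) c) t {0..h}"
      by (rule has_velocity_reparam[where I="{a..a+h}"])
        (use that \<gamma>(1) in \<open>auto simp: flow_curve_def intro!: derivative_eq_intros\<close>)
    then show ?thesis by simp
  qed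
  obtain \<theta> \<theta>' where \<theta>s: "smooth_on UNIV \<theta>" "smooth_on UNIV \<theta>'"
    and \<theta>: "\<And>t. (\<theta> has_real_derivative \<theta>' t) (at t)" "\<And>t. 0 \<le> \<theta>' t" "\<And>t. \<theta>' t \<le> 1"
      "\<And>t. t \<le> 0 \<Longrightarrow> \<theta> t = 0" "\<And>t. t \<ge> T' \<Longrightarrow> \<theta> t = h" "\<And>t. 0 \<le> \<theta> t" "\<And>t. \<theta> t \<le> h"
    by (rule smooth_slow_transition[OF h assms(2)]) blast
  let ?\<beta> = "\<lambda>t. \<gamma> (a + \<theta> t)"
  have vel\<beta>: "has_velocity S ?\<beta> (\<lambda>c. \<theta>' t *\<^sub>R X (?\<beta> t) c) t UNIV" for t
    by (rule has_velocity_reparam[where \<gamma>="\<lambda>t. \<gamma> (a + t)" and \<theta>=\<theta> and I="{0..h}"])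
      (use vel[of "\<theta> t"] \<theta> in auto)
  have "smooth_link P T' (\<gamma> (a + 0)) (\<gamma> (a + h))"
  proof (rule smooth_link_reparam[of h "\<lambda>t. \<gamma> (a + t)" P T' \<theta> \<theta>'])
    fix t assume t: "t \<in> {0..h}"
    show "\<exists>v. has_velocity S (\<lambda>t. \<gamma> (a + t)) v t {0..h} \<and> dual_norm S P (\<gamma> (a + t)) v \<le> 1"
      using vel[OF t] X by (auto simp: subunit_field_def)
  next
    fix c assume c: "c \<in> S" and W: "open (?\<beta> -` fst c)"
    let ?W = "?\<beta> -` fst c" and ?w = "snd c \<circ> ?\<beta>" and ?f = "\<lambda>u. X (chart_inv c u) c"
    have f: "smooth_on (snd c ` (fst c \<inter> UNIV)) ?f"
      using X c by (auto simp: subunit_field_def smooth_vector_field_def)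
    have der: "(?w has_vector_derivative \<theta>' t *\<^sub>R ?f (?w t)) (at t)" if "t \<in> ?W" for t
    proof -
      have "c \<in> charts_at S (?\<beta> t)" using that c by (simp add: charts_at_def)
      then have "(?w has_vector_derivative \<theta>' t *\<^sub>R X (?\<beta> t) c) (at t)"
        using vel\<beta>[of t] unfolding has_velocity_def by blast
      then show ?thesis using chart_inv_chart[OF c, of "?\<beta> t"] that by simp
    qed
    have "Ck_on k ?W ?w" for k
    proof (induction k)
      case 0
      show ?case unfolding Ck_on.simps
        by (intro continuous_at_imp_continuous_on ballI has_vector_derivative_continuous[OF der])
    next
      case (Suc k)
      have "Ck_on k ?W (\<lambda>t. ?f (?w t))"
        by (rule Ck_on_compose[OF W Suc smooth_onD[OF f]]) auto
      then have "Ck_on k ?W (\<lambda>t. \<theta>' t *\<^sub>R ?f (?w t))"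
        by (intro Ck_on_scaleR[OF W] Ck_on_subset[OF smooth_onD[OF \<theta>s(2)]]) auto
      then show ?case by (rule Ck_on_vector_derivativeI[OF W der, rotated])
    qed
    then show "smooth_on ?W ?w" by (simp add: smooth_on_def)
  qed (use h assms(2) \<theta> in auto)
  then show ?thesis using \<gamma> by simp
qed

end

context lipschitz_seminorm_manifold
begin

text \<open>Times with the subunit bound lie arbitrarily close to \<open>t0\<close>, and the
  velocity is continuous in coordinates. A field approximating the velocity at such a time also
  approximates it at \<open>t0\<close>, because the common Lipschitz constant controls its change
  whatever field was chosen. The frame then turns approximability into the bound at
  \<open>t0\<close>.\<close>

lemma smooth_subunit_curve_velocity:
  assumes sm: "smooth_curve S 0 T \<gamma>" and su: "subunit_curve S P 0 T \<gamma>" and T: "0 < T" and t0: "t0 \<in> {0..T}"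
  shows "\<exists>v. has_velocity S \<gamma> v t0 {0..T} \<and> dual_norm S P (\<gamma> t0) v \<le> 1"
proof -
  obtain e \<beta> where e: "0 < e" and \<beta>\<gamma>: "\<And>t. t \<in> {0..T} \<Longrightarrow> \<beta> t = \<gamma> t"
    and cont: "continuous_on {0-e<..<T+e} \<beta>"
    and smooth: "\<And>c. c \<in> S \<Longrightarrow> smooth_on ({0-e<..<T+e} \<inter> \<beta> -` fst c) (snd c \<circ> \<beta>)"
    using sm unfolding smooth_curve_def by blast
  let ?I = "{0-e<..<T+e}"
  obtain c u where c: "c \<in> A" and u: "norm u < 1" "\<gamma> t0 = chart_inv c u" by (rule atlas_cover)
  note cS = atlas_chart[OF c]
  obtain \<X> L where frame: "lipschitz_frame c \<X> L" by (rule lipschitz_frame_exists[OF c])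
  let ?B = "chart_inv c ` ball 0 1"
  have oB: "open ?B" by (rule open_chart_inv_image[OF cS(1)]) (use cS(2) in auto)
  have B: "x \<in> fst c" "norm (snd c x) < 1" "chart_inv c (snd c x) = x" if "x \<in> ?B" for x
    using that chart_chart_inv[OF cS(1)] chart_inv_in[OF cS(1)] cS(2) by auto
  define J where "J = ?I \<inter> \<beta> -` ?B"
  have J: "open J" unfolding J_def by (rule continuous_open_preimage[OF cont _ oB]) simp
  have t0J: "t0 \<in> J" using t0 e u \<beta>\<gamma>[OF t0] by (auto simp: J_def)
  let ?f = "snd c \<circ> \<beta>" and ?f' = "\<lambda>t. frechet_derivative (snd c \<circ> \<beta>) (at t) 1"
  have fJ: "smooth_on J ?f"
    by (rule smooth_on_subset[OF smooth[OF cS(1)]]) (use B(1) in \<open>auto simp: J_def\<close>)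
  have der: "(?f has_vector_derivative ?f' t) (at t)" if "t \<in> J" for t
    by (rule smooth_on_has_vector_derivative[OF fJ that])
  define v where "v t = tangent_lift c (\<beta> t) (?f' t)" for t
  have ch: "c \<in> charts_at S (\<beta> t)" if "t \<in> J" for t
    using that B(1) cS(1) by (auto simp: charts_at_def J_def)
  have vel: "has_velocity S \<gamma> (v t) t {0..T}" if "t \<in> J" "t \<in> {0..T}" for t
  proof (rule has_velocity_cong[OF has_velocity_subset[of \<beta> _ _ UNIV]])
    show "has_velocity S \<beta> (v t) t UNIV"
    proof (rule has_velocityI[where c=c])
      show "c \<in> charts_at S (\<beta> t)" by (rule ch[OF that(1)])
      show "v t \<in> tangent_space S (\<beta> t)" unfolding v_def by (rule tangent_lift_in[OF ch[OF that(1)]])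
      show "isCont \<beta> t" using cont that(1) by (auto simp: J_def continuous_on_eq_continuous_at)
      show "(?f has_vector_derivative v t c) (at t)"
        using der[OF that(1)] tangent_lift_self[OF ch[OF that(1)]] by (simp add: v_def)
    qed simp
  qed (use that \<beta>\<gamma> in auto)
  let ?Q = "\<lambda>\<tau>. \<tau> \<in> {0..T} \<longrightarrow> (\<exists>v. has_velocity S \<gamma> v \<tau> {0..T} \<and> dual_norm S P (\<gamma> \<tau>) v \<le> 1)"
  have "AE \<tau> in lebesgue. ?Q \<tau>" using su by (simp add: subunit_curve_def)
  then obtain N where N: "{\<tau> \<in> space lebesgue. \<not> ?Q \<tau>} \<subseteq> N" "emeasure lebesgue N = 0" "N \<in> sets lebesgue"
    by (rule AE_E)
  have good: "\<exists>X\<in>\<X>. norm (X (\<beta> t) c - ?f' t) < \<epsilon>" if t: "t \<in> J" "t \<in> {0..T}" "t \<notin> N" "0 < \<epsilon>" for t \<epsilon>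
  proof -
    have "?Q t" using N(1) t(3) by auto
    then obtain w where w: "has_velocity S \<gamma> w t {0..T}" "dual_norm S P (\<gamma> t) w \<le> 1" using t(2) by blast
    have ch': "c \<in> charts_at S (\<gamma> t)" using ch[OF t(1)] \<beta>\<gamma>[OF t(2)] by simp
    \<comment> \<open>The velocity from the almost everywhere statement and the one computed from
      the smooth extension are both derivatives within a nondegenerate interval, hence equal even at
      its end points.\<close>
    have "w c = v t c"
    proof (rule vector_derivative_unique_within)
      show "(snd c \<circ> \<gamma> has_vector_derivative w c) (at t within {0..T})"
        using w(1) ch' unfolding has_velocity_def by blast
      show "(snd c \<circ> \<gamma> has_vector_derivative v t c) (at t within {0..T})"
        using vel[OF t(1,2)] ch' unfolding has_velocity_def by blast
      show "at t within {0..T} \<noteq> bot" using t(2) T by (simp add: trivial_limit_within islimpt_Icc)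
    qed
    then have wc: "w c = ?f' t" using tangent_lift_self[OF ch[OF t(1)]] by (simp add: v_def)
    have \<beta>t: "\<beta> t \<in> ?B" using t(1) by (simp add: J_def)
    have "w \<in> tangent_space S (\<gamma> t)" using w(1) by (simp add: has_velocity_def)
    then have "w \<in> tangent_space S (chart_inv c (?f t))" "dual_norm S P (chart_inv c (?f t)) w \<le> 1"
      using B(3)[OF \<beta>t] \<beta>\<gamma>[OF t(2)] w(2) by simp_all
    then show ?thesis
      using lipschitz_frameD(4)[OF frame, of "?f t" w] B(2,3)[OF \<beta>t] t(4) wc by simp
  qed
  have "\<exists>X\<in>\<X>. norm (X (chart_inv c (?f t0)) c - v t0 c) < \<epsilon>" if \<epsilon>: "0 < \<epsilon>" for \<epsilon>
  proof -
    have L: "0 \<le> L" by (rule lipschitz_frameD(1)[OF frame])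
    have "continuous_on J ?f'" using smooth_onD[OF fJ, of "Suc 0"] by simp
    then have "isCont ?f' t0" using J t0J by (simp add: continuous_on_eq_continuous_at)
    then obtain d1 where d1: "0 < d1" "\<And>t. \<bar>t - t0\<bar> < d1 \<Longrightarrow> norm (?f' t - ?f' t0) < \<epsilon> / 3"
      using \<epsilon> unfolding continuous_at_eps_delta dist_norm real_norm_def by (metis zero_less_divide_iff zero_less_numeral)
    have "isCont ?f t0"
      by (rule bspec[OF iffD1[OF continuous_on_eq_continuous_at[OF J] smooth_on_imp_continuous[OF fJ]] t0J])
    \<comment> \<open>Using \<open>L + 1\<close> instead of \<open>L\<close> avoids a case
      distinction for \<open>L = 0\<close>.\<close>
    moreover have "0 < \<epsilon> / (3 * (L + 1))" using \<epsilon> L by simp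
    ultimately obtain d2 where d2: "0 < d2" "\<And>t. \<bar>t - t0\<bar> < d2 \<Longrightarrow> norm (?f t - ?f t0) < \<epsilon> / (3 * (L + 1))"
      unfolding continuous_at_eps_delta dist_norm real_norm_def by meson
    obtain d3 where d3: "0 < d3" "ball t0 d3 \<subseteq> J" using J t0J open_contains_ball by blast
    define d where "d = Min {d1, d2, d3}"
    have d: "0 < d" "d \<le> d1" "d \<le> d2" "d \<le> d3" using d1(1) d2(1) d3(1) by (auto simp: d_def)
    \<comment> \<open>A nondegenerate interval inside \<open>{0..T}\<close> close to
      \<open>t0\<close>; having positive measure, it is not contained in the null set
      \<open>N\<close>.\<close>
    let ?K = "{max 0 (t0 - d)<..<min T (t0 + d)}"
    have Kne: "max 0 (t0 - d) < min T (t0 + d)" using t0 T d(1) by auto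
    have "\<not> ?K \<subseteq> N"
    proof
      assume "?K \<subseteq> N"
      then have "emeasure lebesgue ?K \<le> 0" using emeasure_mono[OF _ N(3)] N(2) by metis
      then show False using Kne by (simp add: emeasure_lborel_Ioo less_imp_le)
    qed
    then obtain t where t: "t \<in> ?K" "t \<notin> N" by blast
    then have tT: "t \<in> {0..T}" and td: "\<bar>t - t0\<bar> < d" by auto
    have tJ: "t \<in> J" using d3(2) td d(4) by (auto simp: dist_real_def)
    obtain X where X: "X \<in> \<X>" "norm (X (\<beta> t) c - ?f' t) < \<epsilon> / 3" using good[OF tJ tT t(2), of "\<epsilon> / 3"] \<epsilon> by auto
    have \<beta>t: "\<beta> t \<in> ?B" "\<beta> t0 \<in> ?B" using tJ t0J by (auto simp: J_def)
    have "norm (X (chart_inv c (?f t0)) c - X (chart_inv c (?f t)) c) \<le> L * norm (?f t0 - ?f t)"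
      by (rule lipschitz_frameD(3)[OF frame X(1)]) (use B(2) \<beta>t in auto)
    also have "\<dots> \<le> (L + 1) * (\<epsilon> / (3 * (L + 1)))"
      by (rule mult_mono) (use d2(2)[of t] td d(3) L in \<open>auto simp: norm_minus_commute\<close>)
    also have "\<dots> = \<epsilon> / 3" using L by (simp add: field_simps)
    finally have "norm (X (chart_inv c (?f t0)) c - X (\<beta> t) c) \<le> \<epsilon> / 3" using B(3)[OF \<beta>t(1)] by simp
    moreover have "norm (?f' t - ?f' t0) < \<epsilon> / 3" using d1(2)[of t] td d(2) by simp
    moreover have "norm (p + q + r) < \<epsilon>"
      if "norm p \<le> \<epsilon> / 3" "norm q < \<epsilon> / 3" "norm r < \<epsilon> / 3" for p q r :: 'e
      using norm_triangle_ineq[of "p + q" r] norm_triangle_ineq[of p q] that by linarith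
    ultimately have "norm ((X (chart_inv c (?f t0)) c - X (\<beta> t) c) + (X (\<beta> t) c - ?f' t) + (?f' t - ?f' t0)) < \<epsilon>"
      using X(2) by blast
    then have "norm (X (chart_inv c (?f t0)) c - ?f' t0) < \<epsilon>" by simp
    then show ?thesis using X(1) tangent_lift_self[OF ch[OF t0J]] unfolding v_def by auto
  qed
  then have "dual_norm S P (chart_inv c (?f t0)) (v t0) \<le> 1"
    using lipschitz_frameD(4)[OF frame, of "?f t0" "v t0"] B(2,3)[of "\<beta> t0"] t0J tangent_lift_in[OF ch[OF t0J]]
    by (simp add: J_def v_def)
  then have "dual_norm S P (\<gamma> t0) (v t0) \<le> 1" using B(3)[of "\<beta> t0"] t0J \<beta>\<gamma>[OF t0] by (simp add: J_def)
  then show ?thesis using vel[OF t0J t0] by blast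
qed

text \<open>Smoothness of the composite at times where \<open>\<theta>\<close> takes the value 0 or
  \<open>T\<close> comes from the extension \<open>\<beta>\<close>, which is smooth on an open
  interval around \<open>{0..T}\<close>.\<close>

lemma smooth_subunit_curve_imp_smooth_link:
  assumes sm: "smooth_curve S 0 T \<gamma>" and su: "subunit_curve S P 0 T \<gamma>" and T: "0 < T" "T < T'"
  shows "smooth_link P T' (\<gamma> 0) (\<gamma> T)"
proof -
  obtain e \<beta> where e: "0 < e" and \<beta>\<gamma>: "\<And>t. t \<in> {0..T} \<Longrightarrow> \<beta> t = \<gamma> t"
    and smooth: "\<And>c. c \<in> S \<Longrightarrow> smooth_on ({0-e<..<T+e} \<inter> \<beta> -` fst c) (snd c \<circ> \<beta>)"
    using sm unfolding smooth_curve_def by blast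
  obtain \<theta> \<theta>' where \<theta>s: "smooth_on UNIV \<theta>" "smooth_on UNIV \<theta>'"
    and \<theta>: "\<And>t. (\<theta> has_real_derivative \<theta>' t) (at t)" "\<And>t. 0 \<le> \<theta>' t" "\<And>t. \<theta>' t \<le> 1"
      "\<And>t. t \<le> 0 \<Longrightarrow> \<theta> t = 0" "\<And>t. t \<ge> T' \<Longrightarrow> \<theta> t = T" "\<And>t. 0 \<le> \<theta> t" "\<And>t. \<theta> t \<le> T"
    by (rule smooth_slow_transition[OF T]) blast
  have eq: "\<beta> (\<theta> t) = \<gamma> (\<theta> t)" for t using \<beta>\<gamma> \<theta>(6,7) by simp
  show ?thesis
  proof (rule smooth_link_reparam[OF smooth_subunit_curve_velocity[OF sm su T(1)] _ \<theta>])
    fix c assume c: "c \<in> S" and W: "open ((\<lambda>t. \<gamma> (\<theta> t)) -` fst c)"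
    have "0 - e < \<theta> t" "\<theta> t < T + e" for t using \<theta>(6)[of t] \<theta>(7)[of t] e by auto
    then have "smooth_on ((\<lambda>t. \<gamma> (\<theta> t)) -` fst c) (\<lambda>t. (snd c \<circ> \<beta>) (\<theta> t))"
      by (intro smooth_on_compose[OF W smooth_on_subset[OF \<theta>s(1)] smooth[OF c]]) (auto simp: eq)
    then show "smooth_on ((\<lambda>t. \<gamma> (\<theta> t)) -` fst c) (snd c \<circ> (\<lambda>t. \<gamma> (\<theta> t)))"
      by (simp add: o_def eq)
  qed (use T in auto)
qed


section \<open>The smooth distance\<close>

text \<open>A smooth subunit curve becomes a link at the cost of an arbitrarily small extra time,
  which the infimum ignores. Links can be reversed and concatenated, whereas concatenating smooth
  curves directly may create corners.\<close>

lemma rho_smooth_eq: "rho_smooth S P x y = Inf {ennreal T | T. smooth_link P T x y}"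
proof (rule antisym)
  show "rho_smooth S P x y \<le> Inf {ennreal T | T. smooth_link P T x y}"
  proof (rule Inf_greatest)
    fix r assume "r \<in> {ennreal T | T. smooth_link P T x y}"
    then obtain T \<beta> where r: "r = ennreal T" "0 < T" and \<beta>: "smooth_subunit P \<beta>" "\<forall>t\<le>0. \<beta> t = x" "\<forall>t\<ge>T. \<beta> t = y"
      unfolding smooth_link_def by blast
    then show "rho_smooth S P x y \<le> r" using rho_smooth_le[OF \<beta>(1) r(2)] by simp
  qed
  show "Inf {ennreal T | T. smooth_link P T x y} \<le> rho_smooth S P x y"
    unfolding rho_smooth_def distance_of_def
  proof (rule Inf_greatest)
    fix r assume "r \<in> {ennreal T |T. 0 < T \<and> (\<exists>\<gamma>. (smooth_curve S 0 T \<gamma> \<and> subunit_curve S P 0 T \<gamma>) \<and> \<gamma> 0 = x \<and> \<gamma> T = y)}"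
    then obtain T \<gamma> where r: "r = ennreal T" "0 < T" and \<gamma>: "smooth_curve S 0 T \<gamma>" "subunit_curve S P 0 T \<gamma>" "\<gamma> 0 = x" "\<gamma> T = y"
      by blast
    show "Inf {ennreal T | T. smooth_link P T x y} \<le> r"
    proof (rule ennreal_le_epsilon)
      fix e :: real assume e: "0 < e"
      have "smooth_link P (T + e) x y"
        using smooth_subunit_curve_imp_smooth_link[OF \<gamma>(1,2) r(2), of "T + e"] e \<gamma>(3,4) by simp
      then have "Inf {ennreal T | T. smooth_link P T x y} \<le> ennreal (T + e)" by (intro Inf_lower) blast
      then show "Inf {ennreal T | T. smooth_link P T x y} \<le> r + ennreal e" using r e by simp
    qed
  qed
qed

lemma rho_smooth_sym: "rho_smooth S P x y = rho_smooth S P y x"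
proof -
  have "smooth_link P T x y \<longleftrightarrow> smooth_link P T y x" for T using smooth_link_sym by blast
  then show ?thesis unfolding rho_smooth_eq by simp
qed

lemma rho_smooth_triangle: "rho_smooth S P x z \<le> rho_smooth S P x y + rho_smooth S P y z"
  unfolding rho_smooth_eq
proof (rule Inf_ennreal_triangle)
  fix b c :: ennreal and e :: real
  assume "b \<in> {ennreal T |T. smooth_link P T x y}" "c \<in> {ennreal T |T. smooth_link P T y z}" and e: "0 < e"
  then obtain T T' where T: "smooth_link P T x y" "b = ennreal T" "smooth_link P T' y z" "c = ennreal T'"
    by auto
  have "0 < T" "0 < T'" using T by (auto simp: smooth_link_def)
  then have "b + c + ennreal e = ennreal (T + T' + e)" using T e by simp
  then show "\<exists>a\<in>{ennreal T |T. smooth_link P T x z}. a \<le> b + c + ennreal e"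
    using smooth_link_trans[OF T(1,3) e] by auto
qed

text \<open>Each flow step is smoothed on its own, and the triangle inequality sums the steps; no
  smoothing of the entire piecewise curve has to be constructed.\<close>

lemma rho_smooth_le_rho_flow: "rho_smooth S P x y \<le> rho_flow S P x y"
proof -
  have flow_step_le: "rho_smooth S P x y \<le> ennreal h" if "flow_step P h x y" for h x y
  proof (rule ennreal_le_epsilon)
    fix e :: real assume e: "0 < e"
    have h: "0 < h" using that by (simp add: flow_step_def)
    have "rho_smooth S P x y \<le> ennreal (h + e)"
      unfolding rho_smooth_eq using flow_step_imp_smooth_link[OF that, of "h + e"] e by (intro Inf_lower) auto
    then show "rho_smooth S P x y \<le> ennreal h + ennreal e" using h e by simp
  qed
  have "rho_smooth S P x y \<le> ennreal T" if "flow_chain P T x y" for T x y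
    using that
  proof (induction rule: flow_chain.induct)
    case (step T x y h z)
    have "rho_smooth S P x z \<le> ennreal T + ennreal h"
      using rho_smooth_triangle add_mono[OF step.IH flow_step_le[OF step.hyps(2)]]
      by (rule order_trans)
    also have "\<dots> = ennreal (T + h)"
      using flow_chain_nonneg[OF step.hyps(1)] step.hyps(2) by (simp add: flow_step_def)
    finally show ?case .
  qed (simp add: rho_smooth_refl)
  then show ?thesis unfolding rho_flow_eq by (intro Inf_greatest) auto
qed

section \<open>Lengths of smooth curves\<close>

text \<open>The distance between two points of the curve is at most the time elapsed between them,
  and these times telescope over any partition.\<close>

lemma curve_length_smooth_subunit_le:
  assumes \<beta>: "smooth_subunit P \<beta>" and "a \<le> b"
  shows "curve_length S P a b \<beta> \<le> ennreal (b - a)"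
  unfolding curve_length_def
proof (rule Sup_least)
  fix r assume "r \<in> {\<Sum>j=1..m. rho S P (\<beta> (t (j - 1))) (\<beta> (t j)) | (m::nat) t.
            t 0 = a \<and> t m = b \<and> (\<forall>j\<in>{1..m}. t (j - 1) \<le> t j)}"
  then obtain m :: nat and t where r: "r = (\<Sum>j=1..m. rho S P (\<beta> (t (j - 1))) (\<beta> (t j)))"
    and t: "t 0 = a" "t m = b" "\<And>j. j \<in> {1..m} \<Longrightarrow> t (j - 1) \<le> t j" by blast
  have le: "rho S P (\<beta> s) (\<beta> s') \<le> ennreal (s' - s)" if "s \<le> s'" for s s'
  proof (cases "s = s'")
    case True
    then show ?thesis using rho_le_rho_smooth[of P "\<beta> s" "\<beta> s"] rho_smooth_refl[of P "\<beta> s"] by simp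
  next
    case False
    then show ?thesis using rho_le_rho_smooth rho_smooth_le[OF \<beta>, of s s'] that by (meson order_trans less_le)
  qed
  have "t 0 \<le> t k \<and> (\<Sum>j=1..k. rho S P (\<beta> (t (j - 1))) (\<beta> (t j))) \<le> ennreal (t k - t 0)" if "k \<le> m" for k
    using that
  proof (induction k)
    case (Suc k)
    have tk: "t k \<le> t (Suc k)" using t(3)[of "Suc k"] Suc.prems by simp
    have "(\<Sum>j=1..Suc k. rho S P (\<beta> (t (j - 1))) (\<beta> (t j))) \<le> ennreal (t k - t 0) + ennreal (t (Suc k) - t k)"
      using Suc add_mono[OF _ le[OF tk]] by simp
    also have "\<dots> = ennreal (t (Suc k) - t 0)" using Suc tk by (simp flip: ennreal_plus)
    finally show ?case using Suc tk by simp
  qed simp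
  from this[of m] show "r \<le> ennreal (b - a)" using r t by simp
qed

text \<open>The partition with the single interval from \<open>a\<close> to \<open>b\<close> already
  contributes \<open>rho S P x y\<close> to the supremum defining the length.\<close>

lemma rho_le_Inf_curve_length:
  "rho S P x y \<le> Inf {curve_length S P a b \<gamma> | a b \<gamma>. a \<le> b \<and> smooth_curve S a b \<gamma> \<and> \<gamma> a = x \<and> \<gamma> b = y}"
proof (rule Inf_greatest)
  fix r assume "r \<in> {curve_length S P a b \<gamma> | a b \<gamma>. a \<le> b \<and> smooth_curve S a b \<gamma> \<and> \<gamma> a = x \<and> \<gamma> b = y}"
  then obtain a b \<gamma> where r: "r = curve_length S P a b \<gamma>" "a \<le> b" "\<gamma> a = x" "\<gamma> b = y" by blast
  show "rho S P x y \<le> r" unfolding r(1) curve_length_def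
    by (rule Sup_upper, intro CollectI exI[of _ "1::nat"] exI[of _ "\<lambda>j::nat. if j = 0 then a else b"])
      (use r in auto)
qed

text \<open>Together with the preceding bound this places the infimum of lengths between
  \<open>rho\<close> and \<open>rho_smooth\<close>, so it equals both once these agree.\<close>

lemma Inf_curve_length_le_rho_smooth:
  "Inf {curve_length S P a b \<gamma> | a b \<gamma>. a \<le> b \<and> smooth_curve S a b \<gamma> \<and> \<gamma> a = x \<and> \<gamma> b = y} \<le> rho_smooth S P x y"
  unfolding rho_smooth_eq
proof (rule Inf_greatest)
  fix r assume "r \<in> {ennreal T | T. smooth_link P T x y}"
  then obtain T \<beta> where r: "r = ennreal T" "0 < T" and \<beta>: "smooth_subunit P \<beta>" "\<forall>t\<le>0. \<beta> t = x" "\<forall>t\<ge>T. \<beta> t = y"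
    unfolding smooth_link_def by blast
  have "Inf {curve_length S P a b \<gamma> | a b \<gamma>. a \<le> b \<and> smooth_curve S a b \<gamma> \<and> \<gamma> a = x \<and> \<gamma> b = y} \<le> curve_length S P 0 T \<beta>"
    using r(2) \<beta> smooth_subunit_imp_smooth_curve[OF \<beta>(1)]
    by (intro Inf_lower CollectI exI[of _ 0] exI[of _ T] exI[of _ \<beta>]) auto
  also have "\<dots> \<le> r" using curve_length_smooth_subunit_le[OF \<beta>(1), of 0 T] r by simp
  finally show "Inf {curve_length S P a b \<gamma> | a b \<gamma>. a \<le> b \<and> smooth_curve S a b \<gamma> \<and> \<gamma> a = x \<and> \<gamma> b = y} \<le> r" .
qed

end

section \<open>Varietal distances and the conclusion\<close>

text \<open>For a varietal distance the points with \<open>d y z < e\<close> form a neighbourhood of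
  \<open>y\<close>, and there the triangle inequality gives \<open>d x y \<le> d x z + e\<close>.
  The argument remains valid when \<open>d x y\<close> is infinite.\<close>

lemma varietal_imp_le_Liminf:
  fixes d :: "'m::topological_space \<Rightarrow> 'm \<Rightarrow> ennreal"
  assumes var: "varietal d" and refl: "\<And>x. d x x = 0" and sym: "\<And>x y. d x y = d y x"
    and triangle: "\<And>x y z. d x z \<le> d x y + d y z"
  shows "d x y \<le> Liminf (at y) (d x)"
proof (rule ennreal_le_epsilon)
  fix e :: real assume e: "0 < e"
  \<comment> \<open>A \<open>varietal\<close> topology is given by a condition on balls around every
    point of the set; for a ball around \<open>y\<close> the triangle inequality supplies the radius
    \<open>e - d y z\<close> at each of its points \<open>z\<close>.\<close>
  have "open {z. d y z < ennreal e}"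
    unfolding var[unfolded varietal_def, rule_format]
  proof (intro ballI)
    fix z assume z: "z \<in> {z. d y z < ennreal e}"
    have "w \<in> {z. d y z < ennreal e}" if "d z w < ennreal e - d y z" for w
    proof -
      have "d y w \<le> d y z + d z w" by (rule triangle)
      also have "\<dots> < ennreal e" using that by (simp add: less_diff_eq_ennreal add.commute less_top[symmetric] order_less_trans)
      finally show ?thesis by simp
    qed
    then show "\<exists>r>0. \<forall>w. d z w < r \<longrightarrow> w \<in> {z. d y z < ennreal e}"
      using z by (intro exI[of _ "ennreal e - d y z"]) (auto simp: diff_gr0_ennreal)
  qed
  then have "eventually (\<lambda>z. d y z < ennreal e) (at y)"
    using refl e by (auto simp: eventually_at_topological intro!: exI[of _ "{z. d y z < ennreal e}"])
  \<comment> \<open>Subtracting on the left produces a constant lower bound for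
    \<open>d x z\<close>, which passes to the lower limit.\<close>
  then have "eventually (\<lambda>z. d x y - ennreal e \<le> d x z) (at y)"
  proof eventually_elim
    case (elim z)
    have "d x y \<le> d x z + d y z" using triangle[of x y z] sym[of z y] by simp
    also have "\<dots> \<le> ennreal e + d x z" using elim by (simp add: add.commute add_left_mono less_imp_le)
    finally show ?case by (simp add: ennreal_minus_le_iff)
  qed
  then have "d x y - ennreal e \<le> Liminf (at y) (d x)" by (rule Liminf_bounded)
  then show "d x y \<le> Liminf (at y) (d x) + ennreal e"
    by (simp add: ennreal_minus_le_iff add.commute)
qed

theorem corollary4p26:
  fixes S A :: "('m::t2_space, 'e::euclidean_space) chart set"
    and P :: "'m \<times> ('m, 'e) covector \<Rightarrow> real"
  assumes "smooth_manifold S"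
    and "unit_ball_atlas S A"
    and "continuous_fibre_seminorm S P"
    and "lipschitz_seminorm_condition S A P"
  shows "(\<forall>x y. x \<noteq> y \<longrightarrow> rho S P x y \<ge> Liminf (at y) (\<lambda>z. rho_flow S P x z)) \<and>
    (varietal (rho_flow S P) \<longrightarrow> rho S P = rho_flow S P) \<and>
    (varietal (rho_smooth S P) \<longrightarrow>
      (\<forall>x y. rho S P x y = rho_smooth S P x y \<and>
        rho S P x y = Inf {curve_length S P a b \<gamma> | a b \<gamma>.
          a \<le> b \<and> smooth_curve S a b \<gamma> \<and> \<gamma> a = x \<and> \<gamma> b = y}))"
proof -
  interpret lipschitz_seminorm_manifold S A P
    by unfold_locales (use assms in auto)
  have rho_flow_eq: "rho S P x y = rho_flow S P x y" if v: "varietal (rho_flow S P)" for x y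
  proof (rule antisym)
    show "rho S P x y \<le> rho_flow S P x y"
      using rho_le_rho_smooth rho_smooth_le_rho_flow by (rule order_trans)
    show "rho_flow S P x y \<le> rho S P x y"
    \<comment> \<open>The lower limit inequality is available for distinct points only; on the
      diagonal the larger distance is 0.\<close>
    proof (cases "x = y")
      case False
      have "rho_flow S P x y \<le> Liminf (at y) (rho_flow S P x)"
        by (rule varietal_imp_le_Liminf[OF v rho_flow_refl rho_flow_sym rho_flow_triangle])
      also have "\<dots> \<le> rho S P x y" by (rule Liminf_rho_flow_le_rho[OF False])
      finally show ?thesis .
    qed (simp add: rho_flow_refl)
  qed
  have rho_smooth_eq: "rho S P x y = rho_smooth S P x y" if v: "varietal (rho_smooth S P)" for x y
  proof (rule antisym)
    show "rho S P x y \<le> rho_smooth S P x y" by (rule rho_le_rho_smooth)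
    show "rho_smooth S P x y \<le> rho S P x y"
    proof (cases "x = y")
      case False
      have "rho_smooth S P x y \<le> Liminf (at y) (rho_smooth S P x)"
        by (rule varietal_imp_le_Liminf[OF v rho_smooth_refl rho_smooth_sym rho_smooth_triangle])
      also have "\<dots> \<le> Liminf (at y) (rho_flow S P x)"
        by (rule Liminf_mono) (simp add: rho_smooth_le_rho_flow)
      also have "\<dots> \<le> rho S P x y" by (rule Liminf_rho_flow_le_rho[OF False])
      finally show ?thesis .
    qed (simp add: rho_smooth_refl)
  qed
  have length_eq: "rho S P x y = Inf {curve_length S P a b \<gamma> | a b \<gamma>.
      a \<le> b \<and> smooth_curve S a b \<gamma> \<and> \<gamma> a = x \<and> \<gamma> b = y}"
    if v: "varietal (rho_smooth S P)" for x y
  proof (rule antisym)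
    show "Inf {curve_length S P a b \<gamma> | a b \<gamma>. a \<le> b \<and> smooth_curve S a b \<gamma> \<and> \<gamma> a = x \<and> \<gamma> b = y}
        \<le> rho S P x y"
      unfolding rho_smooth_eq[OF v] by (rule Inf_curve_length_le_rho_smooth)
  qed (rule rho_le_Inf_curve_length)
  show ?thesis
  proof (intro conjI allI impI)
    show "rho S P = rho_flow S P" if "varietal (rho_flow S P)"
      by (intro ext rho_flow_eq that)
  qed (fact Liminf_rho_flow_le_rho rho_smooth_eq length_eq)+
qed

end
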